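(* Let $d=2m\ge 2$ be an even integer ($m\ge 1$ an integer) and let $k\ge 0$ be an integer. There exists a function $\psi_{d,k}\in\Psi_d^+$ such that (i) the even continuation of $\psi_{d,k}$ is $2k$ times differentiable at $0$; (ii) $\psi_{d,k}\in C^{2k+m-1}(0,\pi)$; (iii) $\psi_{d,k}^{(2k+m)}(\pi/2)$ does not exist; (iv) the even continuation of $\psi_{d,k}$ is not $2k+2$ times differentiable at $0$; (v) $\psi_{d,k}\notin\Psi_{d+1}$. Thus $2k+m-1=2k+\lfloor (d-1)/2\rfloor$ is the largest integer $r\ge 0$ such that every $\psi\in\Psi_d$ whose even continuation is $2k$ times differentiable at $0$ belongs to $C^r(0,\pi)$.
   Context: For an integer $d\ge 1$ let $\mathbb S^d=\{x\in\mathbb R^{d+1}:\|x\|=1\}$ and $\vartheta(x,y)=\arccos\langle x,y\rangle$. A continuous function $\psi:[0,\pi]\to\mathbb R$ belongs to $\Psi_d$ if $\psi(0)=1$ and $\sum_{i=1}^N\sum_{j=1}^N c_ic_j\,\psi(\vartheta(x_i,x_j))\ge 0$ for every integer $N\ge 1$, all $x_1,\dots,x_N\in\mathbb S^d$ and all $c_1,\dots,c_N\in\mathbb R$. The class $\Psi_d^+$ consists of those $\psi\in\Psi_d$ for which this inequality is strict whenever $x_1,\dots,x_N$ are pairwise distinct and $(c_1,\dots,c_N)\neq 0$. For an interval $I$ and an integer $r\ge 0$, $C^r(I)$ is the space of functions $f:I\to\mathbb R$ for which $f,f',\dots,f^{(r)}$ exist and are continuous on $I$; $C^r(0,\pi)$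 means $C^r$ on the open interval $(0,\pi)$ (for the restriction of the function to it). For $r\ge1$, "$f^{(r)}(\theta_0)$ exists" means that $f^{(r-1)}$ is defined in a neighborhood of $\theta_0$ and has a finite two-sided derivative at $\theta_0$. The even continuation of $\psi$ is $\psi_e(t)=\psi(|t|)$ for $-\pi<t<\pi$. For $q\ge 1$, "$\psi_e$ is $2q$ times differentiable at $0$" means that $\psi_e^{(2q)}(0)$ exists in this sense; "zero times differentiable at $0$" means continuous at $0$. *)

theory Defs
  imports "HOL-Analysis.Analysis"
begin

text \<open>
  The unit sphere of \<open>\<real>\<^bsup>d+1\<^esup>\<close> is \<open>topspace (nsphere d)\<close>: sequences \<open>x :: nat \<Rightarrow> real\<close> with
  \<open>x i = 0\<close> for \<open>i > d\<close> and \<open>(\<Sum>i\<le>d. (x i)\<^sup>2) = 1\<close>.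
\<close>

definition geo_dist :: "nat \<Rightarrow> (nat \<Rightarrow> real) \<Rightarrow> (nat \<Rightarrow> real) \<Rightarrow> real" where
  "geo_dist d x y = arccos (\<Sum>i\<le>d. x i * y i)"

text \<open>
  A function on \<open>[0, \<pi>]\<close> is represented by a total function, of which only the values on
  \<open>{0..pi}\<close> matter.
\<close>

definition Psi :: "nat \<Rightarrow> (real \<Rightarrow> real) set" where
  "Psi d = {\<psi>. continuous_on {0..pi} \<psi> \<and> \<psi> 0 = 1 \<and>
     (\<forall>N\<ge>1. \<forall>(x :: nat \<Rightarrow> nat \<Rightarrow> real) (c :: nat \<Rightarrow> real).
        (\<forall>i\<in>{1..N}. x i \<in> topspace (nsphere d)) \<longrightarrow>
        (\<Sum>i=1..N. \<Sum>j=1..N. c i * c j * \<psi> (geo_dist d (x i) (x j))) \<ge> 0)}"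

definition Psi_plus :: "nat \<Rightarrow> (real \<Rightarrow> real) set" where
  "Psi_plus d = {\<psi> \<in> Psi d.
     (\<forall>N\<ge>1. \<forall>(x :: nat \<Rightarrow> nat \<Rightarrow> real) (c :: nat \<Rightarrow> real).
        (\<forall>i\<in>{1..N}. x i \<in> topspace (nsphere d)) \<and> inj_on x {1..N} \<and> (\<exists>i\<in>{1..N}. c i \<noteq> 0) \<longrightarrow>
        (\<Sum>i=1..N. \<Sum>j=1..N. c i * c j * \<psi> (geo_dist d (x i) (x j))) > 0)}"

text \<open>
  \<open>nth_deriv_exists n f x\<close>: the derivative \<open>f\<^bsup>(n)\<^esup>(x)\<close> exists and is finite. Since \<open>deriv\<close> is a total
  operator with unspecified values at points of non-differentiability, the existence of
  \<open>f\<^bsup>(n)\<^esup>\<close> in a neighbourhood of \<open>x\<close> has to be required separately.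
\<close>

fun nth_deriv_exists :: "nat \<Rightarrow> (real \<Rightarrow> real) \<Rightarrow> real \<Rightarrow> bool" where
  "nth_deriv_exists 0 f x \<longleftrightarrow> True"
| "nth_deriv_exists (Suc n) f x \<longleftrightarrow>
     (\<forall>\<^sub>F y in nhds x. nth_deriv_exists n f y) \<and> ((deriv ^^ n) f) differentiable (at x)"

definition times_differentiable_at :: "nat \<Rightarrow> (real \<Rightarrow> real) \<Rightarrow> real \<Rightarrow> bool" where
  "times_differentiable_at n f x \<longleftrightarrow> (if n = 0 then isCont f x else nth_deriv_exists n f x)"

text \<open>
  The space \<open>C\<^bsup>r\<^esup>(S)\<close>, meaningful for open \<open>S\<close> only (derivatives are two-sided); for such \<open>S\<close> it
  depends only on the restriction of \<open>f\<close> to \<open>S\<close>.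
\<close>

definition C_diff_on :: "nat \<Rightarrow> real set \<Rightarrow> (real \<Rightarrow> real) set" where
  "C_diff_on r S = {f. \<forall>j\<le>r. (\<forall>x\<in>S. nth_deriv_exists j f x) \<and> continuous_on S ((deriv ^^ j) f)}"

text \<open>
  Only the restriction to \<open>{-pi<..<pi}\<close> is the even continuation of a function on \<open>[0, \<pi>]\<close>;
  it is used for local properties at \<open>0\<close>.
\<close>

definition even_cont :: "(real \<Rightarrow> real) \<Rightarrow> real \<Rightarrow> real" where
  "even_cont \<psi> t = \<psi> \<bar>t\<bar>"

end

theory Submission
  imports Defs "HOL-Computational_Algebra.Polynomial"
begin

text \<open>
  By Schoenberg's theorem the functions in \<open>\<Psi>\<^sub>d\<close> are the series \<open>\<Sum> b\<^sub>n P\<^sub>n (cos \<theta>)\<close> with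
  \<open>b\<^sub>n \<ge> 0\<close>, \<open>\<Sum> b\<^sub>n = 1\<close>, where \<open>P\<^sub>n\<close> is the Gegenbauer polynomial of index \<open>\<lambda> = (d - 1) / 2\<close>
  with value 1 at 1. Away from the poles \<open>P\<^sub>n (cos \<theta>)\<close> has size \<open>n\<^bsup>-\<lambda>\<^esup>\<close>, and a derivative costs a
  factor \<open>n\<close>. So \<open>\<lambda> + 2k\<close> derivatives may be taken term by term as soon as \<open>\<Sum> b\<^sub>n n\<^bsup>2k\<^esup>\<close> converges,
  and this moment condition is what \<open>2k\<close>-fold differentiability at 0 amounts to
  (\<open>moments_summable\<close>), since all the functions \<open>P\<^sub>n (cos \<theta>)\<close> have central differences of order \<open>2k\<close>
  of one and the same sign at 0. For \<open>d = 2m\<close> the index \<open>\<lambda> = m - 1/2\<close> is a half-integer, whence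
  \<open>2k + m - 1\<close> continuous derivatives, and half an order is left over with which the next
  derivative can be destroyed.

  Regularity. As \<open>\<Psi>\<^bsub>2m\<^esub>\<close> is contained in \<open>\<Psi>\<^bsub>2m-1\<^esub>\<close> and both have the same bound, odd spheres
  suffice. There no asymptotics are needed: \<open>(sin\<^sup>d \<theta> P\<^sub>n)' = d sin\<^bsup>d-1\<^esup> \<theta> Q\<^bsub>n+1\<^esub>\<close> holds for \<open>P\<^sub>n\<close>
  belonging to \<open>d + 2\<close> and \<open>Q\<^sub>n\<close> to \<open>d\<close> (\<open>DERIV_sin_power_Geg\<close>), with the same coefficients
  \<open>b\<^sub>n\<close> on both sides of the resulting identity of series. So two dimensions are worth one
  derivative, and after finitely many steps one is left with a cosine series on the circle
  (\<open>odd_sphere_series_Ck_on\<close>).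

  Schoenberg's expansion. That \<open>b\<^sub>n \<ge> 0\<close> is seen by averaging the positive definite kernel
  \<open>\<psi> P\<^sub>n\<close> over pairs of points of the sphere. Both facts needed for this, the positive definiteness of
  \<open>P\<^sub>n\<close> and a substitute for the invariant measure, come by induction on the dimension from the
  addition formula (\<open>Geg_addition_formula\<close>), which in turn reduces to the product formula
  (\<open>Geg_product_formula\<close>): averaging \<open>P\<^sub>n\<close> over a circle of latitude gives an eigenfunction of the
  zonal Laplacian, and by completeness there is only one up to a factor.

  Sharpness. For \<open>r = 2k + m\<close> the coefficient of \<open>t\<^sup>r\<close> in \<open>P\<^sub>n(t)\<close>, for suitable \<open>n\<close>, exceeds any
  multiple of \<open>n\<^bsup>2k\<^esup>\<close> (\<open>Geg_coeff_growth\<close>). A gliding hump then yields weights \<open>\<beta>\<^sub>j > 0\<close> and degrees \<open>n\<^sub>j\<close> with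
  \<open>\<Sum> \<beta>\<^sub>j n\<^sub>j\<^bsup>2k\<^esup>\<close> finite but with unbounded difference quotients of order \<open>r\<close> at \<open>t = 0\<close>, that is at
  \<open>\<theta> = \<pi>/2\<close>. Adding the smooth kernel \<open>exp ((cos \<theta> - 1) / 2)\<close> makes the sum strictly positive definite.
  The function is not \<open>2k + 2\<close> times differentiable at 0 and not in \<open>\<Psi>\<^bsub>d+1\<^esub>\<close>, for otherwise
  the regularity theorems would produce the missing derivative at \<open>\<pi>/2\<close>.
\<close>

section \<open>Normalised Gegenbauer polynomials\<close>

text \<open>
  The Gegenbauer polynomial of index \<open>e / 2\<close>, scaled to the value 1 at 1: the zonal polynomial of
  degree \<open>n\<close> on the sphere of dimension \<open>e + 1\<close>. The parameter \<open>e\<close> is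
  used in place of the dimension because it is also the exponent of the surface weight
  \<open>sin\<^sup>e\<close>, and \<open>e = 0\<close> is the circle.
\<close>

fun Geg :: "nat \<Rightarrow> nat \<Rightarrow> real poly" where
  "Geg e 0 = 1"
| "Geg e (Suc 0) = [:0, 1:]"
| "Geg e (Suc (Suc n)) =
     smult ((2 * real n + real e + 2) / (real n + real e + 1)) ([:0, 1:] * Geg e (Suc n))
     - smult ((real n + 1) / (real n + real e + 1)) (Geg e n)"

abbreviation zonal :: "nat \<Rightarrow> nat \<Rightarrow> real \<Rightarrow> real" where
  "zonal e n \<theta> \<equiv> poly (Geg e n) (cos \<theta>)"

declare Geg.simps(3) [simp del]

lemma Geg_rec:
  "(real n + real e + 1) * poly (Geg e (Suc (Suc n))) x =
     (2 * real n + real e + 2) * x * poly (Geg e (Suc n)) x - (real n + 1) * poly (Geg e n) x"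
proof -
  define N where "N = real n + real e + 1"
  have nz: "N \<noteq> 0" unfolding N_def by linarith
  have "poly (Geg e (Suc (Suc n))) x =
     (2 * real n + real e + 2) / N * (x * poly (Geg e (Suc n)) x) - (real n + 1) / N * poly (Geg e n) x"
    by (subst Geg.simps(3)) (simp add: N_def)
  then show ?thesis unfolding N_def[symmetric] using nz
    by (simp add: right_diff_distrib mult.assoc)
qed




lemma pderiv_Geg_rec:
  "(real n + real e + 1) * poly (pderiv (Geg e (Suc (Suc n)))) x =
     (2 * real n + real e + 2) * (poly (Geg e (Suc n)) x + x * poly (pderiv (Geg e (Suc n))) x)
     - (real n + 1) * poly (pderiv (Geg e n)) x"
proof -
  define N where "N = real n + real e + 1"
  define a b where "a = (2 * real n + real e + 2) / N" and "b = (real n + 1) / N"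
  have nz: "N \<noteq> 0" unfolding N_def by linarith
  have ab: "N * a = 2 * real n + real e + 2" "N * b = real n + 1"
    using nz by (simp_all add: a_def b_def)
  have "Geg e (Suc (Suc n)) = smult a ([:0, 1:] * Geg e (Suc n)) - smult b (Geg e n)"
    by (simp add: Geg.simps(3) a_def b_def N_def)
  then have "pderiv (Geg e (Suc (Suc n))) =
     smult a (Geg e (Suc n) + [:0, 1:] * pderiv (Geg e (Suc n))) - smult b (pderiv (Geg e n))"
    by (simp only: pderiv_diff pderiv_smult pderiv_mult) (simp add: pderiv_pCons add.commute)
  then have "poly (pderiv (Geg e (Suc (Suc n)))) x =
     a * (poly (Geg e (Suc n)) x + x * poly (pderiv (Geg e (Suc n))) x) - b * poly (pderiv (Geg e n)) x"
    by simp
  then show ?thesis unfolding N_def[symmetric] using ab by algebra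
qed

lemma induct_two [case_names 0 1 step]:
  assumes "P (0::nat)" "P (Suc 0)" "\<And>n. P n \<Longrightarrow> P (Suc n) \<Longrightarrow> P (Suc (Suc n))"
  shows "P n"
proof -
  have "P n \<and> P (Suc n)" by (induction n) (use assms in auto)
  then show ?thesis ..
qed

lemma Geg_at_1 [simp]: "poly (Geg e n) 1 = 1"
proof (induction n rule: induct_two)
  case (step n)
  have "real n + real e + 1 \<noteq> 0" by linarith
  moreover have "(real n + real e + 1) * poly (Geg e (Suc (Suc n))) 1 = real n + real e + 1"
    unfolding Geg_rec step by simp
  ultimately show ?case by simp
qed auto

lemma degree_Geg: "degree (Geg e n) = n \<and> coeff (Geg e n) n > 0"
proof (induction n rule: induct_two)
  case (step n)
  have pos: "(2 * real n + real e + 2) / (real n + real e + 1) > 0" by simp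
  have d1: "degree (Geg e (Suc (Suc n))) \<le> Suc (Suc n)"
    unfolding Geg.simps(3) using step
    by (intro degree_diff_le order.trans[OF degree_smult_le]) (auto intro: degree_mult_le[THEN order.trans])
  have "coeff (Geg e n) (Suc (Suc n)) = 0" using step by (simp add: coeff_eq_0)
  then have c: "coeff (Geg e (Suc (Suc n))) (Suc (Suc n)) > 0"
    unfolding Geg.simps(3) using step pos by simp
  show ?case using d1 c le_degree[of "Geg e (Suc (Suc n))" "Suc (Suc n)"] by auto
qed auto

text \<open>
  Raising \<open>e\<close> by 2 is differentiation, up to a factor; this and the next lemmas are the contiguity
  relations behind it. The inductions use the three-term recurrences of both families to eliminate all but two
  neighbouring polynomials. At \<open>n = 0\<close> the truncated index \<open>n - 1\<close> is harmless because
  its coefficient vanishes.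
\<close>

lemma Geg_shift:
  "(real e + 1) * poly (Geg e (Suc n)) x =
     (real n + real e + 1) * x * poly (Geg (e + 2) n) x - real n * poly (Geg (e + 2) (n - 1)) x"
proof (induction n rule: induct_two)
  case 1
  have "(real e + 1) * poly (Geg e (Suc (Suc 0))) x = (real e + 2) * x * x - 1"
    using Geg_rec[of 0 e x] by simp
  then show ?case by simp
next
  case (step n)
  let ?Q = "\<lambda>n. poly (Geg (e + 2) n) x"
  let ?P = "\<lambda>n. poly (Geg e n) x"
  define N E where "N = real n" and "E = real e"
  have r1: "(N + 1 + E + 1) * ?P (Suc (Suc (Suc n))) = (2 * N + E + 4) * x * ?P (Suc (Suc n)) - (N + 2) * ?P (Suc n)"
    using Geg_rec[of "Suc n" e x] by (simp add: N_def E_def algebra_simps)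
  have r2: "(N + E + 3) * ?Q (Suc (Suc n)) = (2 * N + E + 4) * x * ?Q (Suc n) - (N + 1) * ?Q n"
    using Geg_rec[of n "e + 2" x] by (simp add: N_def E_def algebra_simps)
  have r3: "(N + E + 2) * ?Q (Suc n) = (2 * N + E + 2) * x * ?Q n - N * ?Q (n - 1)"
    by (cases n) (use Geg_rec[of "n - 1" "e + 2" x] in \<open>auto simp: N_def E_def algebra_simps\<close>)
  have i1: "(E + 1) * ?P (Suc n) = (N + E + 1) * x * ?Q n - N * ?Q (n - 1)"
    using step(1) by (simp add: N_def E_def)
  have i2: "(E + 1) * ?P (Suc (Suc n)) = (N + E + 2) * x * ?Q (Suc n) - (N + 1) * ?Q n"
    using step(2) by (simp add: N_def E_def algebra_simps)
  have nz: "N + E + 2 \<noteq> 0" unfolding N_def E_def by linarith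
  have "(N + E + 2) * ((E + 1) * ?P (Suc (Suc (Suc n)))) =
        (N + E + 2) * ((N + E + 3) * x * ?Q (Suc (Suc n)) - (N + 2) * ?Q (Suc n))"
    using r1 r2 r3 i1 i2 by algebra
  then have "(E + 1) * ?P (Suc (Suc (Suc n))) = (N + E + 3) * x * ?Q (Suc (Suc n)) - (N + 2) * ?Q (Suc n)"
    using nz by simp
  then show ?case by (simp add: N_def E_def algebra_simps)
qed auto

lemma pderiv_Geg_aux:
  "(real e + 1) * poly (pderiv (Geg e (Suc n))) x =
     (real n + 1) * (real n + real e + 1) * poly (Geg (e + 2) n) x"
proof (induction n rule: induct_two)
  case 0
  then show ?case by (simp add: pderiv_pCons)
next
  case 1
  then show ?case using pderiv_Geg_rec[of 0 e x] by (simp add: pderiv_pCons algebra_simps)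
next
  case (step n)
  let ?Q = "\<lambda>n. poly (Geg (e + 2) n) x"
  let ?P = "\<lambda>n. poly (Geg e n) x"
  let ?D = "\<lambda>n. poly (pderiv (Geg e n)) x"
  define N E where "N = real n" and "E = real e"
  have nz: "N + E + 2 \<noteq> 0" unfolding N_def E_def by linarith
  have r1: "(N + E + 2) * ?D (Suc (Suc (Suc n))) = (2 * N + E + 4) * (?P (Suc (Suc n)) + x * ?D (Suc (Suc n)))
        - (N + 2) * ?D (Suc n)"
    using pderiv_Geg_rec[of "Suc n" e x] by (simp add: N_def E_def algebra_simps)
  have r2: "(N + E + 3) * ?Q (Suc (Suc n)) = (2 * N + E + 4) * x * ?Q (Suc n) - (N + 1) * ?Q n"
    using Geg_rec[of n "e + 2" x] by (simp add: N_def E_def algebra_simps)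
  have r3: "(E + 1) * ?P (Suc (Suc n)) = (N + E + 2) * x * ?Q (Suc n) - (N + 1) * ?Q n"
    using Geg_shift[of e "Suc n" x] by (simp add: N_def E_def algebra_simps)
  have i1: "(E + 1) * ?D (Suc n) = (N + 1) * (N + E + 1) * ?Q n"
    using step(1) by (simp add: N_def E_def)
  have i2: "(E + 1) * ?D (Suc (Suc n)) = (N + 2) * (N + E + 2) * ?Q (Suc n)"
    using step(2) by (simp add: N_def E_def algebra_simps)
  have "(N + E + 2) * ((E + 1) * ?D (Suc (Suc (Suc n)))) =
        (N + E + 2) * ((N + 3) * (N + E + 3) * ?Q (Suc (Suc n)))"
    using r1 r2 r3 i1 i2 by algebra
  then have "(E + 1) * ?D (Suc (Suc (Suc n))) = (N + 3) * (N + E + 3) * ?Q (Suc (Suc n))"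
    using nz by simp
  then show ?case by (simp add: N_def E_def algebra_simps)
qed

lemma pderiv_Geg:
  "pderiv (Geg e (Suc n)) = smult ((real n + 1) * (real n + real e + 1) / (real e + 1)) (Geg (e + 2) n)"
proof -
  have "real e + 1 \<noteq> 0" by linarith
  then have "poly (pderiv (Geg e (Suc n))) x =
      poly (smult ((real n + 1) * (real n + real e + 1) / (real e + 1)) (Geg (e + 2) n)) x" for x
    using pderiv_Geg_aux[of e n x] by (simp add: field_simps)
  then show ?thesis by (simp add: poly_eq_poly_eq_iff[symmetric] fun_eq_iff del: poly_eq_poly_eq_iff)
qed

lemma Geg_pderiv_rec:
  "(1 - x\<^sup>2) * poly (pderiv (Geg e n)) x = real n * (poly (Geg e (n - 1)) x - x * poly (Geg e n) x)"
proof (induction n rule: induct_two)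
  case 1
  then show ?case by (simp add: pderiv_pCons power2_eq_square)
next
  case (step n)
  let ?P = "\<lambda>n. poly (Geg e n) x"
  let ?D = "\<lambda>n. poly (pderiv (Geg e n)) x"
  define N E where "N = real n" and "E = real e"
  have nz: "N + E + 1 \<noteq> 0" unfolding N_def E_def by linarith
  have r1: "(N + E + 1) * ?D (Suc (Suc n)) =
     (2 * N + E + 2) * (?P (Suc n) + x * ?D (Suc n)) - (N + 1) * ?D n"
    using pderiv_Geg_rec[of n e x] by (simp add: N_def E_def)
  have r2: "(N + E + 1) * ?P (Suc (Suc n)) = (2 * N + E + 2) * x * ?P (Suc n) - (N + 1) * ?P n"
    using Geg_rec[of n e x] by (simp add: N_def E_def algebra_simps)
  have r3: "(N + E) * ?P (Suc n) = (2 * N + E) * x * ?P n - N * ?P (n - 1)"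
    by (cases n) (use Geg_rec[of "n - 1" e x] in \<open>auto simp: N_def E_def algebra_simps\<close>)
  have i1: "(1 - x\<^sup>2) * ?D n = N * (?P (n - 1) - x * ?P n)"
    using step(1) by (simp add: N_def E_def)
  have i2: "(1 - x\<^sup>2) * ?D (Suc n) = (N + 1) * (?P n - x * ?P (Suc n))"
    using step(2) by (simp add: N_def E_def algebra_simps)
  have "(N + E + 1) * ((1 - x\<^sup>2) * ?D (Suc (Suc n))) =
        (N + E + 1) * ((N + 2) * (?P (Suc n) - x * ?P (Suc (Suc n))))"
    using r1 r2 r3 i1 i2 by algebra
  then have "(1 - x\<^sup>2) * ?D (Suc (Suc n)) = (N + 2) * (?P (Suc n) - x * ?P (Suc (Suc n)))"
    using nz by simp
  then show ?case by (simp add: N_def E_def algebra_simps)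
qed auto

lemma Geg_weighted_pderiv:
  "(real e + 1) * poly (Geg e (Suc n)) x =
     (real e + 1) * x * poly (Geg (e + 2) n) x - (1 - x\<^sup>2) * poly (pderiv (Geg (e + 2) n)) x"
  using Geg_shift[of e n x] Geg_pderiv_rec[of x "e + 2" n] by (simp add: algebra_simps)

text \<open>
  The descent by two dimensions. No factor depending on \<open>n\<close> appears on the right, so a series with
  coefficients \<open>b\<^sub>n\<close> is differentiated without any loss.
\<close>

lemma DERIV_sin_power_Geg:
  "((\<lambda>\<theta>. sin \<theta> ^ Suc e * zonal (e + 2) n \<theta>) has_real_derivative
     (real e + 1) * sin \<theta> ^ e * zonal e (Suc n) \<theta>) (at \<theta>)"
proof -
  have *: "(1 - (cos \<theta>)\<^sup>2) = sin \<theta> * sin \<theta>"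
    by (metis sin_squared_eq power2_eq_square)
  have "(real e + 1) * sin \<theta> ^ e * zonal e (Suc n) \<theta> =
     sin \<theta> ^ e * ((real e + 1) * cos \<theta> * zonal (e + 2) n \<theta>
       - (1 - (cos \<theta>)\<^sup>2) * poly (pderiv (Geg (e + 2) n)) (cos \<theta>))"
    by (subst Geg_weighted_pderiv[symmetric]) (simp only: ac_simps)
  also have "\<dots> = (real (Suc e)) * sin \<theta> ^ e * cos \<theta> * zonal (e + 2) n \<theta>
      + sin \<theta> ^ Suc e * (poly (pderiv (Geg (e + 2) n)) (cos \<theta>) * (- sin \<theta>))"
    unfolding * by (simp add: algebra_simps)
  also have "\<dots> = (1 + real e) * (cos \<theta> * sin \<theta> ^ e) * zonal (e + 2) n \<theta>
      + poly (pderiv (Geg (e + 2) n)) (cos \<theta>) * (- sin \<theta>) * sin \<theta> ^ Suc e"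
    by simp
  finally have eq: "(1 + real e) * (cos \<theta> * sin \<theta> ^ e) * zonal (e + 2) n \<theta>
      + poly (pderiv (Geg (e + 2) n)) (cos \<theta>) * (- sin \<theta>) * sin \<theta> ^ Suc e
      = (real e + 1) * sin \<theta> ^ e * zonal e (Suc n) \<theta>" ..
  show ?thesis
    by (rule DERIV_cong[OF DERIV_mult[OF DERIV_power_Suc[OF DERIV_sin] DERIV_chain2[OF poly_DERIV DERIV_cos]] eq])
qed

text \<open>
  The polynomial is an eigenfunction of the zonal part of the Laplacian on the sphere.
\<close>

lemma Geg_ode:
  "(1 - x\<^sup>2) * poly (pderiv (pderiv (Geg e n))) x - (real e + 1) * x * poly (pderiv (Geg e n)) x
     + real n * (real n + real e) * poly (Geg e n) x = 0"
proof (cases n)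
  case (Suc k)
  have aux: "y * (c * R) - e1 * x * (c * Q) + M * P = 0"
    if "e1 * P = e1 * x * Q - y * R" "c * e1 = M" for c e1 M P Q R y :: real
    using that by algebra
  define c where "c = (real k + 1) * (real k + real e + 1) / (real e + 1)"
  have "real e + 1 \<noteq> 0" by linarith
  then have c: "c * (real e + 1) = real n * (real n + real e)"
    by (simp add: c_def Suc) (simp add: algebra_simps)
  have "pderiv (Geg e n) = smult c (Geg (e + 2) k)" "pderiv (pderiv (Geg e n)) = smult c (pderiv (Geg (e + 2) k))"
    by (simp_all add: Suc pderiv_Geg c_def pderiv_smult)
  then show ?thesis
    using aux[OF Geg_weighted_pderiv[of e k x] c] by (simp only: Suc poly_smult)
qed simp

lemma Geg_0_cos: "zonal 0 n \<theta> = cos (real n * \<theta>)"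
proof (induction n rule: induct_two)
  case (step n)
  have "real n + 1 \<noteq> 0" by linarith
  moreover have "(real n + 1) * zonal 0 (Suc (Suc n)) \<theta> =
     (real n + 1) * (2 * cos \<theta> * cos (real (Suc n) * \<theta>) - cos (real n * \<theta>))"
    using Geg_rec[of n 0 "cos \<theta>"] by (simp add: step algebra_simps)
  ultimately have "zonal 0 (Suc (Suc n)) \<theta> = 2 * cos \<theta> * cos (real (Suc n) * \<theta>) - cos (real n * \<theta>)"
    by simp
  also have "\<dots> = cos (real (Suc (Suc n)) * \<theta>)"
  proof -
    have a: "real (Suc (Suc n)) * \<theta> = real (Suc n) * \<theta> + \<theta>" "real n * \<theta> = real (Suc n) * \<theta> - \<theta>"
      by (simp_all add: algebra_simps)
    show ?thesis unfolding a cos_add cos_diff by simp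
  qed
  finally show ?case .
qed auto

lemma poly_in_Geg_span:
  assumes "degree p \<le> n"
  shows "\<exists>c. p = (\<Sum>q\<le>n. smult (c q) (Geg e q))"
  using assms
proof (induction n arbitrary: p)
  case 0
  then obtain a where "p = [:a:]" by (auto elim: degree_eq_zeroE)
  then show ?case by (intro exI[of _ "\<lambda>_. a"]) simp
next
  case (Suc n)
  define a where "a = coeff p (Suc n) / coeff (Geg e (Suc n)) (Suc n)"
  have nz: "coeff (Geg e (Suc n)) (Suc n) \<noteq> 0" "degree (Geg e (Suc n)) = Suc n"
    using degree_Geg[of e "Suc n"] by auto
  have "degree (p - smult a (Geg e (Suc n))) \<le> n"
  proof (rule degree_le, intro allI impI)
    fix i assume i: "n < i"
    show "coeff (p - smult a (Geg e (Suc n))) i = 0"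
    proof (cases "i = Suc n")
      case True
      then show ?thesis using nz by (simp add: a_def)
    next
      case False
      then have "i > Suc n" using i by simp
      then show ?thesis using nz Suc.prems by (simp add: coeff_eq_0)
    qed
  qed
  from Suc.IH[OF this] obtain c where c: "p - smult a (Geg e (Suc n)) = (\<Sum>q\<le>n. smult (c q) (Geg e q))"
    by blast
  have "p = (\<Sum>q\<le>n. smult (c q) (Geg e q)) + smult a (Geg e (Suc n))"
    using c by (simp add: algebra_simps)
  also have "\<dots> = (\<Sum>q\<le>Suc n. smult ((c(Suc n := a)) q) (Geg e q))"
    by simp
  finally show ?case by blast
qed

section \<open>Integration against the surface weight\<close>

lemma DERIV_has_integral_0_pi:
  assumes "\<And>x. (F has_real_derivative f x) (at x)"
  shows "(f has_integral (F pi - F 0)) {0..pi}"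
  by (rule fundamental_theorem_of_calculus)
    (use assms in \<open>auto simp: has_real_derivative_iff_has_vector_derivative intro: has_vector_derivative_at_within\<close>)

text \<open>
  The weight \<open>sin\<^sup>e\<close> is the surface measure of the sphere of dimension \<open>e + 1\<close>,
  expressed by the distance from a pole.
\<close>

definition wint :: "nat \<Rightarrow> (real \<Rightarrow> real) \<Rightarrow> real" where
  "wint e u = integral {0..pi} (\<lambda>\<theta>. u \<theta> * sin \<theta> ^ e)"

lemma continuous_on_poly_cos [continuous_intros]:
  "continuous_on S (\<lambda>\<theta>::real. poly p (cos \<theta>))"
  by (intro continuous_on_poly continuous_intros)

lemma wint_integrable:
  assumes "continuous_on {0..pi} u"
  shows "(\<lambda>\<theta>. u \<theta> * sin \<theta> ^ e) integrable_on {0..pi}"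
  by (intro integrable_continuous_interval continuous_intros assms)

lemma wint_add:
  assumes "continuous_on {0..pi} u" "continuous_on {0..pi} v"
  shows "wint e (\<lambda>\<theta>. u \<theta> + v \<theta>) = wint e u + wint e v"
  unfolding wint_def distrib_right using assms by (intro integral_add wint_integrable)

lemma wint_diff:
  assumes "continuous_on {0..pi} u" "continuous_on {0..pi} v"
  shows "wint e (\<lambda>\<theta>. u \<theta> - v \<theta>) = wint e u - wint e v"
  unfolding wint_def left_diff_distrib using assms by (intro integral_diff wint_integrable)

lemma wint_cmult: "wint e (\<lambda>\<theta>. c * u \<theta>) = c * wint e u"
  unfolding wint_def mult.assoc by simp

lemma wint_sum:
  assumes "finite I" "\<And>i. i \<in> I \<Longrightarrow> continuous_on {0..pi} (u i)"
  shows "wint e (\<lambda>\<theta>. \<Sum>i\<in>I. u i \<theta>) = (\<Sum>i\<in>I. wint e (u i))"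
  unfolding wint_def sum_distrib_right using assms by (intro integral_sum wint_integrable) auto

lemma wint_mono:
  assumes "continuous_on {0..pi} u" "continuous_on {0..pi} v" "\<And>\<theta>. \<theta> \<in> {0..pi} \<Longrightarrow> u \<theta> \<le> v \<theta>"
  shows "wint e u \<le> wint e v"
  unfolding wint_def using assms
  by (intro integral_le wint_integrable) (auto intro!: mult_right_mono zero_le_power sin_ge_zero)

lemma wint_cong:
  assumes "\<And>\<theta>. \<theta> \<in> {0..pi} \<Longrightarrow> u \<theta> = v \<theta>"
  shows "wint e u = wint e v"
  unfolding wint_def using assms by (intro integral_cong) auto

lemma wint_eq_0_imp:
  assumes cont: "continuous_on {0..pi} u" and nonneg: "\<And>\<theta>. \<theta> \<in> {0..pi} \<Longrightarrow> u \<theta> \<ge> 0"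
    and "wint e u = 0" and \<theta>: "\<theta> \<in> {0..pi}"
  shows "u \<theta> = 0"
proof -
  have "((\<lambda>\<theta>. u \<theta> * sin \<theta> ^ e) has_integral 0) {0..pi}"
    using integrable_integral[OF wint_integrable[OF cont, of e]] \<open>wint e u = 0\<close> by (simp add: wint_def)
  then have int: "((\<lambda>\<theta>. u \<theta> * sin \<theta> ^ e) has_integral 0) (cbox 0 pi)" by simp
  have "u x * sin x ^ e = 0" if "x \<in> {0..pi}" for x
  proof (rule has_integral_0_cbox_imp_0[OF _ _ int])
    show "continuous_on (cbox 0 pi) (\<lambda>\<theta>. u \<theta> * sin \<theta> ^ e)"
      unfolding cbox_interval by (intro continuous_intros cont)
    show "0 \<le> u x * sin x ^ e" if "x \<in> box 0 pi" for x
      using that nonneg[of x] sin_gt_zero[of x] by simp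
    show "box 0 pi \<noteq> ({} :: real set)" using pi_gt_zero by (simp add: not_le del: pi_gt_zero)
    show "x \<in> cbox 0 pi" using that by simp
  qed
  then have inner: "u x = 0" if "x \<in> {0<..<pi}" for x
  proof -
    have "sin x > 0" "x \<in> {0..pi}" using that sin_gt_zero[of x] by auto
    with \<open>\<And>x. x \<in> {0..pi} \<Longrightarrow> u x * sin x ^ e = 0\<close>[of x] show ?thesis by simp
  qed
  have "closure {0<..<pi} = {0..pi}" by (simp add: closure_greaterThanLessThan)
  then show ?thesis
    using continuous_constant_on_closure[of "{0<..<pi}" u 0 \<theta>] cont inner \<theta> by simp
qed

lemma wint_1_pos: "wint e (\<lambda>_. 1) > 0"
proof -
  have "wint e (\<lambda>_. 0) \<le> wint e (\<lambda>_. 1)" by (intro wint_mono) auto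
  moreover have "wint e (\<lambda>_. 1) \<noteq> 0" using wint_eq_0_imp[of "\<lambda>_. 1" e 0] by auto
  ultimately show ?thesis by (simp add: wint_def)
qed

text \<open>
  Integration by parts against the primitive given by \<open>DERIV_sin_power_Geg\<close>; the boundary terms
  vanish with the sine. Iterated, it moves all derivatives to the other factor, as Rodrigues' formula would.
\<close>

lemma wint_pderiv:
  "(real e + 1) * wint e (\<lambda>\<theta>. poly p (cos \<theta>) * zonal e (Suc n) \<theta>) =
     wint (e + 2) (\<lambda>\<theta>. poly (pderiv p) (cos \<theta>) * zonal (e + 2) n \<theta>)"
proof -
  let ?A = "\<lambda>\<theta>. poly p (cos \<theta>) * zonal e (Suc n) \<theta>"
  let ?B = "\<lambda>\<theta>. poly (pderiv p) (cos \<theta>) * zonal (e + 2) n \<theta>"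
  let ?F = "\<lambda>\<theta>. poly p (cos \<theta>) * (sin \<theta> ^ Suc e * zonal (e + 2) n \<theta>)"
  let ?f = "\<lambda>\<theta>. (real e + 1) * (?A \<theta> * sin \<theta> ^ e) - ?B \<theta> * sin \<theta> ^ (e + 2)"
  have "(?F has_real_derivative ?f \<theta>) (at \<theta>)" for \<theta>
    by (rule DERIV_cong[OF DERIV_mult[OF DERIV_chain2[OF poly_DERIV DERIV_cos] DERIV_sin_power_Geg]])
      (simp add: algebra_simps)
  then have "(?f has_integral (?F pi - ?F 0)) {0..pi}"
    by (rule DERIV_has_integral_0_pi)
  then have "integral {0..pi} ?f = 0" by (simp add: integral_unique)
  moreover have "integral {0..pi} ?f = (real e + 1) * wint e ?A - wint (e + 2) ?B"
    unfolding wint_def by (subst integral_diff) (auto intro!: integrable_continuous_interval continuous_intros)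
  ultimately show ?thesis by simp
qed

lemma wint_poly_Geg_eq_0:
  assumes "degree p < n"
  shows "wint e (\<lambda>\<theta>. poly p (cos \<theta>) * zonal e n \<theta>) = 0"
  using assms
proof (induction n arbitrary: p e)
  case (Suc n)
  have "wint (e + 2) (\<lambda>\<theta>. poly (pderiv p) (cos \<theta>) * zonal (e + 2) n \<theta>) = 0"
  proof (cases "n = 0")
    case True
    then have "degree p = 0" using Suc.prems by simp
    then have "pderiv p = 0" by (simp add: pderiv_eq_0_iff)
    then show ?thesis by (simp add: wint_def)
  next
    case False
    then show ?thesis using Suc by (intro Suc.IH) (auto simp: degree_pderiv)
  qed
  moreover have "real e + 1 \<noteq> 0" by linarith
  ultimately show ?case using wint_pderiv[of e p n] by simp
qed simp

lemma wint_Geg_orthogonal: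
  assumes "q \<noteq> n"
  shows "wint e (\<lambda>\<theta>. zonal e q \<theta> * zonal e n \<theta>) = 0"
proof (cases "q < n")
  case True
  then show ?thesis by (intro wint_poly_Geg_eq_0) (simp add: degree_Geg)
next
  case False
  then have "wint e (\<lambda>\<theta>. zonal e n \<theta> * zonal e q \<theta>) = 0"
    using assms by (intro wint_poly_Geg_eq_0) (simp add: degree_Geg)
  then show ?thesis by (simp add: mult.commute)
qed

definition Geg_norm2 :: "nat \<Rightarrow> nat \<Rightarrow> real" where
  "Geg_norm2 e n = wint e (\<lambda>\<theta>. (zonal e n \<theta>)\<^sup>2)"

lemma Geg_norm2_pos: "Geg_norm2 e n > 0"
proof -
  have "wint e (\<lambda>_. 0) \<le> Geg_norm2 e n" unfolding Geg_norm2_def by (intro wint_mono continuous_intros) auto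
  moreover have "Geg_norm2 e n \<noteq> 0"
  proof
    assume "Geg_norm2 e n = 0"
    then have "(zonal e n 0)\<^sup>2 = 0"
      unfolding Geg_norm2_def
      by (intro wint_eq_0_imp[of "\<lambda>\<theta>. (zonal e n \<theta>)\<^sup>2" e 0] continuous_intros) auto
    then show False by simp
  qed
  ultimately show ?thesis by (simp add: wint_def)
qed

lemma wint_Geg_Geg:
  "wint e (\<lambda>\<theta>. zonal e q \<theta> * zonal e n \<theta>) = (if q = n then Geg_norm2 e n else 0)"
  using wint_Geg_orthogonal[of q n e] by (auto simp: Geg_norm2_def power2_eq_square)

lemma wint_sum_Geg_Geg:
  assumes "finite A"
  shows "wint e (\<lambda>\<theta>. (\<Sum>q\<in>A. c q * zonal e q \<theta>) * zonal e n \<theta>) =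
    (if n \<in> A then c n * Geg_norm2 e n else 0)"
proof -
  have "wint e (\<lambda>\<theta>. (\<Sum>q\<in>A. c q * zonal e q \<theta>) * zonal e n \<theta>) =
     (\<Sum>q\<in>A. wint e (\<lambda>\<theta>. c q * (zonal e q \<theta> * zonal e n \<theta>)))"
    unfolding sum_distrib_right mult.assoc using assms
    by (intro wint_sum continuous_intros)
  also have "\<dots> = (\<Sum>q\<in>A. if q = n then c n * Geg_norm2 e n else 0)"
    by (intro sum.cong refl) (simp add: wint_cmult wint_Geg_Geg)
  finally show ?thesis using assms by simp
qed

lemma poly_Geg_expansion:
  assumes "degree p \<le> n"
  shows "poly p x = (\<Sum>q\<le>n. wint e (\<lambda>\<theta>. poly p (cos \<theta>) * zonal e q \<theta>) / Geg_norm2 e q * poly (Geg e q) x)"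
proof -
  obtain c where c: "p = (\<Sum>q\<le>n. smult (c q) (Geg e q))" using poly_in_Geg_span[OF assms] by blast
  have pc: "poly p x = (\<Sum>q\<le>n. c q * poly (Geg e q) x)" for x
    by (subst c) (simp add: poly_sum)
  have "wint e (\<lambda>\<theta>. poly p (cos \<theta>) * zonal e q \<theta>) = c q * Geg_norm2 e q" if "q \<le> n" for q
    unfolding pc using that by (subst wint_sum_Geg_Geg) auto
  then show ?thesis unfolding pc using less_imp_neq[OF Geg_norm2_pos[of e]] by (intro sum.cong) (auto simp: eq_commute[of 0])
qed

lemma uniform_poly_cos_approx:
  assumes "continuous_on {0..pi} \<psi>" "\<epsilon> > 0"
  obtains p where "\<And>\<theta>. \<theta> \<in> {0..pi} \<Longrightarrow> \<bar>\<psi> \<theta> - poly p (cos \<theta>)\<bar> < \<epsilon>"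
proof -
  have "continuous_on {-1..1} (\<lambda>t. \<psi> (arccos t))"
    by (rule continuous_on_compose2[OF assms(1)]) (auto intro!: continuous_intros arccos_lbound arccos_ubound)
  from Stone_Weierstrass_real_polynomial_function[OF compact_Icc this assms(2)]
  obtain g where g: "real_polynomial_function g" "\<And>t. t \<in> {-1..1} \<Longrightarrow> \<bar>\<psi> (arccos t) - g t\<bar> < \<epsilon>"
    by auto
  then obtain a n where a: "g = (\<lambda>x. \<Sum>i\<le>n. a i * x ^ i)"
    unfolding real_polynomial_function_iff_sum by blast
  define p where "p = (\<Sum>i\<le>n. monom (a i) i)"
  have "poly p x = g x" for x by (simp add: p_def a poly_sum poly_monom)
  then have "\<bar>\<psi> \<theta> - poly p (cos \<theta>)\<bar> < \<epsilon>" if "\<theta> \<in> {0..pi}" for \<theta>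
    using g(2)[of "cos \<theta>"] that by (simp add: arccos_cos)
  then show ?thesis by (rule that)
qed

lemma le_0_if_le_eps:
  fixes A B :: real
  assumes "\<And>\<epsilon>. \<epsilon> > 0 \<Longrightarrow> A \<le> \<epsilon> * B" "B \<ge> 0"
  shows "A \<le> 0"
proof (rule ccontr)
  assume "\<not> A \<le> 0"
  then have "A / (2 * (B + 1)) > 0" using assms(2) by simp
  from assms(1)[OF this] have "A \<le> A / (2 * (B + 1)) * B" .
  also have "\<dots> = A / 2 * (B / (B + 1))" by simp
  also have "\<dots> \<le> A / 2 * 1" using \<open>\<not> A \<le> 0\<close> assms(2) by (intro mult_left_mono) auto
  finally show False using \<open>\<not> A \<le> 0\<close> by simp
qed

text \<open>
  Since every polynomial in \<open>cos \<theta>\<close> is a combination of the functions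
  \<open>P\<^sub>n (cos \<theta>)\<close>, the function is orthogonal to its own polynomial approximations,
  hence to itself.
\<close>

lemma Geg_complete:
  assumes cont: "continuous_on {0..pi} \<psi>"
    and zero: "\<And>n. wint e (\<lambda>\<theta>. \<psi> \<theta> * zonal e n \<theta>) = 0" and \<theta>: "\<theta> \<in> {0..pi}"
  shows "\<psi> \<theta> = 0"
proof -
  have poly0: "wint e (\<lambda>\<theta>. \<psi> \<theta> * poly p (cos \<theta>)) = 0" for p
  proof -
    obtain c where c: "p = (\<Sum>q\<le>degree p. smult (c q) (Geg e q))"
      using poly_in_Geg_span[of p "degree p"] by blast
    have pc: "poly p x = (\<Sum>q\<le>degree p. c q * poly (Geg e q) x)" for x
      by (subst c) (simp add: poly_sum)
    have "wint e (\<lambda>\<theta>. \<psi> \<theta> * poly p (cos \<theta>)) =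
      (\<Sum>q\<le>degree p. wint e (\<lambda>\<theta>. c q * (\<psi> \<theta> * zonal e q \<theta>)))"
      unfolding pc sum_distrib_left
      by (subst wint_sum[symmetric]) (auto intro!: continuous_intros cont wint_cong sum.cong simp: algebra_simps)
    then show ?thesis by (simp add: wint_cmult zero)
  qed
  have "wint e (\<lambda>\<theta>. (\<psi> \<theta>)\<^sup>2) \<le> \<epsilon> * wint e (\<lambda>\<theta>. \<bar>\<psi> \<theta>\<bar>)" if "\<epsilon> > 0" for \<epsilon>
  proof -
    obtain p where p: "\<And>\<theta>. \<theta> \<in> {0..pi} \<Longrightarrow> \<bar>\<psi> \<theta> - poly p (cos \<theta>)\<bar> < \<epsilon>"
      using uniform_poly_cos_approx[OF cont \<open>\<epsilon> > 0\<close>] by blast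
    have "wint e (\<lambda>\<theta>. (\<psi> \<theta>)\<^sup>2) = wint e (\<lambda>\<theta>. \<psi> \<theta> * (\<psi> \<theta> - poly p (cos \<theta>)))"
      unfolding right_diff_distrib
      by (subst wint_diff) (auto intro!: continuous_intros cont simp: poly0 power2_eq_square)
    also have "\<dots> \<le> wint e (\<lambda>\<theta>. \<epsilon> * \<bar>\<psi> \<theta>\<bar>)"
    proof (intro wint_mono continuous_intros cont)
      fix \<theta> assume "\<theta> \<in> {0..pi}"
      then have "\<bar>\<psi> \<theta>\<bar> * \<bar>\<psi> \<theta> - poly p (cos \<theta>)\<bar> \<le> \<bar>\<psi> \<theta>\<bar> * \<epsilon>"
        using p[of \<theta>] by (intro mult_left_mono) auto
      then show "\<psi> \<theta> * (\<psi> \<theta> - poly p (cos \<theta>)) \<le> \<epsilon> * \<bar>\<psi> \<theta>\<bar>"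
        unfolding abs_mult[symmetric] by (simp add: mult.commute)
    qed
    finally show ?thesis by (simp add: wint_cmult)
  qed
  moreover have "wint e (\<lambda>\<theta>. \<bar>\<psi> \<theta>\<bar>) \<ge> 0"
    using wint_mono[of "\<lambda>_. 0" "\<lambda>\<theta>. \<bar>\<psi> \<theta>\<bar>" e] cont by (auto simp: wint_def intro!: continuous_intros)
  ultimately have "wint e (\<lambda>\<theta>. (\<psi> \<theta>)\<^sup>2) \<le> 0"
    by (rule le_0_if_le_eps)
  moreover have "wint e (\<lambda>\<theta>. (\<psi> \<theta>)\<^sup>2) \<ge> 0"
    using wint_mono[of "\<lambda>_. 0" "\<lambda>\<theta>. (\<psi> \<theta>)\<^sup>2" e] cont by (auto simp: wint_def intro!: continuous_intros)
  ultimately have "wint e (\<lambda>\<theta>. (\<psi> \<theta>)\<^sup>2) = 0" by simp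
  from wint_eq_0_imp[OF _ _ this \<theta>] show ?thesis using cont by (auto intro!: continuous_intros)
qed

lemma Geg_times_x:
  "\<exists>a\<ge>0. \<exists>b\<ge>0. \<forall>x. x * poly (Geg e n) x = a * poly (Geg e (Suc n)) x + b * poly (Geg e (n - 1)) x"
proof (cases n)
  case 0
  then show ?thesis by (intro exI[of _ 1] conjI exI[of _ 0]) auto
next
  case (Suc k)
  define c where "c = 2 * real k + real e + 2"
  have c: "c > 0" by (simp add: c_def)
  have "x * poly (Geg e n) x = (real k + real e + 1) / c * poly (Geg e (Suc n)) x + (real k + 1) / c * poly (Geg e (n - 1)) x" for x
  proof -
    have "c * x * poly (Geg e n) x = (real k + real e + 1) * poly (Geg e (Suc n)) x + (real k + 1) * poly (Geg e (n - 1)) x"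
      using Geg_rec[of k e x] by (simp add: Suc c_def)
    then show ?thesis using c by (simp add: divide_simps mult_ac)
  qed
  then show ?thesis using c
    by (intro exI[of _ "(real k + real e + 1) / c"] conjI exI[of _ "(real k + 1) / c"]) auto
qed

text \<open>
  Multiplication by \<open>1 + x\<close> maps the polynomials to nonnegative combinations of themselves, by the
  recurrence, so nonnegativity of all coefficients survives multiplication by powers of
  \<open>1 + cos \<theta>\<close>.
\<close>

lemma wint_nonneg_times_power:
  assumes cont: "continuous_on {0..pi} \<psi>"
    and nonneg: "\<And>n. wint e (\<lambda>\<theta>. \<psi> \<theta> * zonal e n \<theta>) \<ge> 0"
  shows "wint e (\<lambda>\<theta>. \<psi> \<theta> * (1 + cos \<theta>) ^ k * zonal e n \<theta>) \<ge> 0"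
proof (induction k arbitrary: n)
  case (Suc k)
  obtain a b where ab: "a \<ge> 0" "b \<ge> 0"
    "\<And>x. x * poly (Geg e n) x = a * poly (Geg e (Suc n)) x + b * poly (Geg e (n - 1)) x"
    using Geg_times_x[of e n] by blast
  let ?u = "\<lambda>n \<theta>. \<psi> \<theta> * (1 + cos \<theta>) ^ k * zonal e n \<theta>"
  have u: "continuous_on {0..pi} (?u n)" for n by (intro continuous_intros cont)
  have "\<psi> \<theta> * (1 + cos \<theta>) ^ Suc k * zonal e n \<theta> = ?u n \<theta> + (a * ?u (Suc n) \<theta> + b * ?u (n - 1) \<theta>)" for \<theta>
  proof -
    have "\<psi> \<theta> * (1 + cos \<theta>) ^ Suc k * zonal e n \<theta> =
      ?u n \<theta> + \<psi> \<theta> * (1 + cos \<theta>) ^ k * (cos \<theta> * zonal e n \<theta>)"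
      by (simp add: algebra_simps)
    also have "\<dots> = ?u n \<theta> + (a * ?u (Suc n) \<theta> + b * ?u (n - 1) \<theta>)"
      unfolding ab(3) by (simp add: algebra_simps)
    finally show ?thesis .
  qed
  then have "wint e (\<lambda>\<theta>. \<psi> \<theta> * (1 + cos \<theta>) ^ Suc k * zonal e n \<theta>) =
     wint e (?u n) + (a * wint e (?u (Suc n)) + b * wint e (?u (n - 1)))"
    using u by (simp add: wint_add wint_cmult continuous_intros)
  then show ?case using ab Suc.IH by simp
qed (use nonneg in simp)

text \<open>
  The powers \<open>(1 + cos \<theta>)\<^sup>k\<close> concentrate at 0 as \<open>k\<close> grows: the mean of
  \<open>1 - cos \<theta>\<close> with respect to them is at most \<open>(e + 1) / k\<close> for
  \<open>k > 0\<close>. The identity is the integral of the derivative of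
  \<open>sin\<^bsup>e+1\<^esup> \<theta> (1 + cos \<theta>)\<^sup>k\<close>.
\<close>

lemma wint_concentration:
  "real k * wint e (\<lambda>\<theta>. (1 - cos \<theta>) * (1 + cos \<theta>) ^ k) = (real e + 1) * wint e (\<lambda>\<theta>. cos \<theta> * (1 + cos \<theta>) ^ k)"
proof (cases k)
  case 0
  have "wint e (\<lambda>\<theta>. poly 1 (cos \<theta>) * zonal e 1 \<theta>) = 0" by (intro wint_poly_Geg_eq_0) auto
  then show ?thesis by (simp add: 0)
next
  case (Suc j)
  let ?F = "\<lambda>\<theta>::real. sin \<theta> ^ Suc e * (1 + cos \<theta>) ^ k"
  let ?A = "\<lambda>\<theta>::real. cos \<theta> * (1 + cos \<theta>) ^ k"
  let ?B = "\<lambda>\<theta>::real. (1 - cos \<theta>) * (1 + cos \<theta>) ^ k"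
  let ?f = "\<lambda>\<theta>::real. (real e + 1) * (?A \<theta> * sin \<theta> ^ e) - real k * (?B \<theta> * sin \<theta> ^ e)"
  have "(?F has_real_derivative ?f \<theta>) (at \<theta>)" for \<theta>
  proof -
    have "((\<lambda>\<theta>. 1 + cos \<theta>) has_real_derivative - sin \<theta>) (at \<theta>)"
      by (auto intro!: derivative_eq_intros)
    note D = DERIV_mult[OF DERIV_power_Suc[OF DERIV_sin, of e \<theta>] DERIV_power_Suc[OF this, of j]]
    have s: "sin \<theta> * sin \<theta> = (1 - cos \<theta>) * (1 + cos \<theta>)"
      using sin_squared_eq[of \<theta>] by (simp add: power2_eq_square algebra_simps)
    have "(1 + of_nat j) * (- sin \<theta> * (1 + cos \<theta>) ^ j) * sin \<theta> ^ Suc e =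
       - (1 + real j) * (sin \<theta> * sin \<theta>) * (1 + cos \<theta>) ^ j * sin \<theta> ^ e"
      by (simp only: power_Suc of_nat_id) (simp add: algebra_simps)
    also have "\<dots> = - real k * (?B \<theta> * sin \<theta> ^ e)" unfolding s Suc by simp
    finally have h: "(1 + of_nat j) * (- sin \<theta> * (1 + cos \<theta>) ^ j) * sin \<theta> ^ Suc e = - real k * (?B \<theta> * sin \<theta> ^ e)" .
    have "(1 + of_nat e) * (cos \<theta> * sin \<theta> ^ e) * (1 + cos \<theta>) ^ Suc j
      + (1 + of_nat j) * (- sin \<theta> * (1 + cos \<theta>) ^ j) * sin \<theta> ^ Suc e = ?f \<theta>"
      unfolding h unfolding Suc of_nat_Suc of_nat_id by algebra
    from DERIV_cong[OF D this] show ?thesis by (simp add: Suc)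
  qed
  then have "(?f has_integral (?F pi - ?F 0)) {0..pi}"
    by (rule DERIV_has_integral_0_pi)
  then have "integral {0..pi} ?f = 0" by (simp add: integral_unique)
  moreover have "integral {0..pi} ?f = (real e + 1) * wint e ?A - real k * wint e ?B"
    unfolding wint_def by (subst integral_diff) (auto intro!: integrable_continuous_interval continuous_intros)
  ultimately show ?thesis by simp
qed

lemma one_plus_cos_power_nonneg [simp]: "0 \<le> (1 + cos \<theta> :: real) ^ k"
  using cos_ge_minus_one[of \<theta>] by (intro zero_le_power) linarith

text \<open>
  Testing with the concentrating powers of \<open>1 + cos \<theta>\<close> picks out the value at 0. A majorant
  \<open>C (1 - cos \<theta>) - \<eta>\<close> of the function does away with a separate estimate far from 0.
\<close>

lemma value_at_0_nonneg:
  assumes cont: "continuous_on {0..pi} \<psi>"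
    and nonneg: "\<And>n. wint e (\<lambda>\<theta>. \<psi> \<theta> * zonal e n \<theta>) \<ge> 0"
  shows "\<psi> 0 \<ge> 0"
proof (rule ccontr)
  assume "\<not> \<psi> 0 \<ge> 0"
  then have neg: "\<psi> 0 < 0" by simp
  define \<eta> where "\<eta> = - \<psi> 0 / 2"
  have \<eta>: "\<eta> > 0" using neg by (simp add: \<eta>_def)
  obtain \<delta>' where \<delta>': "\<delta>' > 0" "\<And>\<theta>. \<theta> \<in> {0..pi} \<Longrightarrow> dist \<theta> 0 < \<delta>' \<Longrightarrow> dist (\<psi> \<theta>) (\<psi> 0) < \<eta>"
    using cont \<eta> unfolding continuous_on_iff by (metis atLeastAtMost_iff order.refl pi_ge_zero)
  define \<delta> where "\<delta> = min \<delta>' pi"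
  have \<delta>: "0 < \<delta>" "\<delta> \<le> pi" using \<delta>'(1) by (auto simp: \<delta>_def)
  have near: "\<psi> \<theta> \<le> - \<eta>" if "\<theta> \<in> {0..pi}" "\<theta> < \<delta>" for \<theta>
    using \<delta>'(2)[of \<theta>] that by (auto simp: \<delta>_def dist_real_def \<eta>_def)
  have "bounded (\<psi> ` {0..pi})" by (intro compact_imp_bounded compact_continuous_image cont) auto
  then obtain M where M: "M > 0" "\<And>\<theta>. \<theta> \<in> {0..pi} \<Longrightarrow> \<bar>\<psi> \<theta>\<bar> \<le> M"
    unfolding bounded_pos by auto
  have cos\<delta>: "cos \<delta> < 1" using cos_monotone_0_pi[of 0 \<delta>] \<delta> by simp
  \<comment> \<open>Beyond \<open>\<delta>\<close> the majorant has to reach the bound \<open>M\<close>.\<close>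
  define C where "C = (M + \<eta>) / (1 - cos \<delta>)"
  have C: "C > 0" using M \<eta> cos\<delta> by (simp add: C_def)
  have major: "\<psi> \<theta> \<le> C * (1 - cos \<theta>) - \<eta>" if "\<theta> \<in> {0..pi}" for \<theta>
  proof (cases "\<theta> < \<delta>")
    case True
    have "C * (1 - cos \<theta>) \<ge> 0" using C by (intro mult_nonneg_nonneg) auto
    then show ?thesis using near[OF that True] by simp
  next
    case False
    then have "cos \<theta> \<le> cos \<delta>" using that \<delta> by (intro cos_monotone_0_pi_le) auto
    then have "C * (1 - cos \<theta>) \<ge> C * (1 - cos \<delta>)" using C by (intro mult_left_mono) auto
    moreover have "C * (1 - cos \<delta>) = M + \<eta>" using cos\<delta> by (simp add: C_def)
    ultimately show ?thesis using M(2)[OF that] by linarith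
  qed
  obtain k where k: "real k > C * (real e + 1) / \<eta>" using reals_Archimedean2 by blast
  let ?K = "\<lambda>\<theta>::real. (1 + cos \<theta>) ^ k"
  have k0: "real k > 0"
  proof -
    have "C * (real e + 1) / \<eta> > 0" using C \<eta> by simp
    then show ?thesis using k by linarith
  qed
  have Kpos: "wint e ?K > 0"
  proof -
    have 1: "wint e (\<lambda>_. 0) \<le> wint e ?K" by (intro wint_mono continuous_intros) auto
    have "wint e ?K \<noteq> 0"
    proof
      assume "wint e ?K = 0"
      then have "(1 + cos 0 :: real) ^ k = 0"
        by (intro wint_eq_0_imp[of ?K e 0] continuous_intros) auto
      then show False by simp
    qed
    then show ?thesis using 1 by (simp add: wint_def)
  qed
  have "0 \<le> wint e (\<lambda>\<theta>. \<psi> \<theta> * ?K \<theta>)"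
    using wint_nonneg_times_power[OF cont nonneg, of k 0] by simp
  also have "\<dots> \<le> wint e (\<lambda>\<theta>. (C * (1 - cos \<theta>) - \<eta>) * ?K \<theta>)"
    by (intro wint_mono continuous_intros cont mult_right_mono major) auto
  also have "\<dots> = C * wint e (\<lambda>\<theta>. (1 - cos \<theta>) * ?K \<theta>) - \<eta> * wint e ?K"
  proof -
    have "wint e (\<lambda>\<theta>. (C * (1 - cos \<theta>) - \<eta>) * ?K \<theta>) = wint e (\<lambda>\<theta>. C * ((1 - cos \<theta>) * ?K \<theta>) - \<eta> * ?K \<theta>)"
      by (intro wint_cong) (simp add: algebra_simps)
    also have "\<dots> = wint e (\<lambda>\<theta>. C * ((1 - cos \<theta>) * ?K \<theta>)) - wint e (\<lambda>\<theta>. \<eta> * ?K \<theta>)"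
      by (intro wint_diff continuous_intros)
    finally show ?thesis by (simp only: wint_cmult)
  qed
  finally have "\<eta> * wint e ?K \<le> C * wint e (\<lambda>\<theta>. (1 - cos \<theta>) * ?K \<theta>)" by simp
  then have "real k * (\<eta> * wint e ?K) \<le> real k * (C * wint e (\<lambda>\<theta>. (1 - cos \<theta>) * ?K \<theta>))"
    by (rule mult_left_mono) simp
  also have "\<dots> = C * (real k * wint e (\<lambda>\<theta>. (1 - cos \<theta>) * ?K \<theta>))" by (simp only: mult.left_commute)
  also have "\<dots> \<le> C * ((real e + 1) * wint e ?K)"
  proof -
    have "cos \<theta> * ?K \<theta> \<le> 1 * ?K \<theta>" for \<theta> by (intro mult_right_mono) auto
    then have "wint e (\<lambda>\<theta>. cos \<theta> * ?K \<theta>) \<le> wint e ?K" by (intro wint_mono continuous_intros) auto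
    then show ?thesis unfolding wint_concentration using C by (intro mult_left_mono) auto
  qed
  finally have "(real k * \<eta>) * wint e ?K \<le> (C * (real e + 1)) * wint e ?K"
    by (simp only: mult.assoc)
  then have "real k * \<eta> \<le> C * (real e + 1)"
    using Kpos by (rule mult_right_le_imp_le)
  then show False using k \<eta> by (simp add: field_simps)
qed

section \<open>The addition formula\<close>

lemma wint_has_derivative:
  assumes D: "\<And>s \<phi>. ((\<lambda>s. U s \<phi>) has_real_derivative U' s \<phi>) (at s)"
    and cont: "\<And>s. continuous_on {0..pi} (U s)"
    and cont': "continuous_on (UNIV \<times> {0..pi}) (\<lambda>(s, \<phi>). U' s \<phi>)"
  shows "((\<lambda>s. wint e (U s)) has_real_derivative wint e (U' s)) (at s)"
proof -
  have "((\<lambda>s. integral (cbox 0 pi) (\<lambda>\<phi>. U s \<phi> * sin \<phi> ^ e)) has_real_derivative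
      integral (cbox 0 pi) (\<lambda>\<phi>. U' s \<phi> * sin \<phi> ^ e)) (at s within UNIV)"
  proof (rule leibniz_rule_field_derivative)
    show "((\<lambda>s. U s \<phi> * sin \<phi> ^ e) has_real_derivative U' s \<phi> * sin \<phi> ^ e) (at s within UNIV)" for s \<phi>
      by (rule DERIV_cmult_right[OF D])
    show "(\<lambda>\<phi>. U s \<phi> * sin \<phi> ^ e) integrable_on cbox 0 pi" for s
      using wint_integrable[OF cont] by simp
    show "continuous_on (UNIV \<times> cbox 0 pi) (\<lambda>(s, \<phi>). U' s \<phi> * sin \<phi> ^ e)"
      using cont' by (auto simp: split_beta intro!: continuous_intros)
  qed auto
  then show ?thesis by (simp add: wint_def)
qed

text \<open>
  The cosine of the third side of a spherical triangle in which sides \<open>s\<close> and \<open>t\<close>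
  enclose the angle \<open>\<phi>\<close>.
\<close>

definition law_of_cosines :: "real \<Rightarrow> real \<Rightarrow> real \<Rightarrow> real" where
  "law_of_cosines s t \<phi> = cos s * cos t + sin s * sin t * cos \<phi>"

text \<open>
  The unnormalised mean of \<open>P\<^sub>n\<close> over a circle of latitude about the point at distance
  \<open>t\<close> inherits the differential equation of \<open>P\<^sub>n\<close>, in the distance
  \<open>s\<close>. After differentiation under the integral sign the left-hand side is the integral of an exact
  derivative in \<open>\<phi>\<close>, so that it vanishes. The equation is multiplied through by
  \<open>sin s\<close> to hold at the poles too.
\<close>

lemma Geg_product_ode:
  fixes e n :: nat and t :: real
  assumes H_def: "H = (\<lambda>s. wint e (\<lambda>\<phi>. poly (Geg (Suc e) n) (law_of_cosines s t \<phi>)))"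
  shows "\<exists>H1 H2. \<forall>s. (H has_real_derivative H1 s) (at s) \<and> (H1 has_real_derivative H2 s) (at s) \<and>
    sin s * H2 s + (real e + 1) * cos s * H1 s + real n * (real n + real e + 1) * sin s * H s = 0"
proof -
  define F where "F = Geg (Suc e) n"
  define F1 where "F1 = pderiv F"
  define F2 where "F2 = pderiv F1"
  define Ws where "Ws s \<phi> = - sin s * cos t + cos s * sin t * cos \<phi>" for s \<phi> :: real
  have DW: "((\<lambda>s. law_of_cosines s t \<phi>) has_real_derivative Ws s \<phi>) (at s)" for s \<phi>
    unfolding law_of_cosines_def Ws_def by (auto intro!: derivative_eq_intros)
  have DWs: "((\<lambda>s. Ws s \<phi>) has_real_derivative - law_of_cosines s t \<phi>) (at s)" for s \<phi>
    unfolding law_of_cosines_def Ws_def by (auto intro!: derivative_eq_intros)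
  have D\<phi>: "((\<lambda>\<phi>. law_of_cosines s t \<phi>) has_real_derivative - sin s * sin t * sin \<phi>) (at \<phi>)" for s \<phi>
    unfolding law_of_cosines_def by (auto intro!: derivative_eq_intros)
  define H1 where "H1 = (\<lambda>s. wint e (\<lambda>\<phi>. poly F1 (law_of_cosines s t \<phi>) * Ws s \<phi>))"
  define H2 where "H2 = (\<lambda>s. wint e (\<lambda>\<phi>. poly F2 (law_of_cosines s t \<phi>) * Ws s \<phi> * Ws s \<phi> + - law_of_cosines s t \<phi> * poly F1 (law_of_cosines s t \<phi>)))"
  have cW: "continuous_on S (\<lambda>(s, \<phi>). law_of_cosines s t \<phi>)" "continuous_on S (\<lambda>(s, \<phi>). Ws s \<phi>)" for S
    by (auto simp: law_of_cosines_def Ws_def split_beta intro!: continuous_intros)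
  have cW1 [continuous_intros]: "continuous_on S (\<lambda>\<phi>. law_of_cosines s t \<phi>)" "continuous_on S (\<lambda>\<phi>. Ws s \<phi>)" for S s
    by (auto simp: law_of_cosines_def Ws_def intro!: continuous_intros)
  have dH: "(H has_real_derivative H1 s) (at s)" for s
    unfolding H_def H1_def F_def[symmetric]
  proof (rule wint_has_derivative)
    show "((\<lambda>s. poly F (law_of_cosines s t \<phi>)) has_real_derivative poly F1 (law_of_cosines s t \<phi>) * Ws s \<phi>) (at s)" for s \<phi>
      unfolding F1_def by (rule DERIV_chain2[OF poly_DERIV DW])
    show "continuous_on (UNIV \<times> {0..pi}) (\<lambda>(s, \<phi>). poly F1 (law_of_cosines s t \<phi>) * Ws s \<phi>)"
      using cW by (auto simp: split_beta intro!: continuous_intros continuous_on_poly)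
  qed (intro continuous_intros continuous_on_poly)
  have dH1: "(H1 has_real_derivative H2 s) (at s)" for s
    unfolding H1_def H2_def
  proof (rule wint_has_derivative)
    show "((\<lambda>s. poly F1 (law_of_cosines s t \<phi>) * Ws s \<phi>) has_real_derivative
      poly F2 (law_of_cosines s t \<phi>) * Ws s \<phi> * Ws s \<phi> + - law_of_cosines s t \<phi> * poly F1 (law_of_cosines s t \<phi>)) (at s)" for s \<phi>
      unfolding F2_def by (rule DERIV_mult[OF DERIV_chain2[OF poly_DERIV DW] DWs])
    show "continuous_on (UNIV \<times> {0..pi}) (\<lambda>(s, \<phi>). poly F2 (law_of_cosines s t \<phi>) * Ws s \<phi> * Ws s \<phi> + - law_of_cosines s t \<phi> * poly F1 (law_of_cosines s t \<phi>))"
      using cW by (auto simp: split_beta intro!: continuous_intros continuous_on_poly)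
  qed (intro continuous_intros continuous_on_poly)
  have "sin s * H2 s + (real e + 1) * cos s * H1 s + real n * (real n + real e + 1) * sin s * H s = 0" for s
  proof -
    define N where "N = real n * (real n + real e + 1)"
    let ?u = "\<lambda>\<phi>. sin s * (poly F2 (law_of_cosines s t \<phi>) * Ws s \<phi> * Ws s \<phi> + - law_of_cosines s t \<phi> * poly F1 (law_of_cosines s t \<phi>))
       + (real e + 1) * cos s * (poly F1 (law_of_cosines s t \<phi>) * Ws s \<phi>) + N * sin s * poly F (law_of_cosines s t \<phi>)"
    let ?K = "\<lambda>\<phi>. sin t * (poly F1 (law_of_cosines s t \<phi>) * sin \<phi> ^ Suc e)"
    have u: "?u \<phi> * sin \<phi> ^ e = sin t * (poly F2 (law_of_cosines s t \<phi>) * (- sin s * sin t * sin \<phi>) * sin \<phi> ^ Suc e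
       + (1 + real e) * (cos \<phi> * sin \<phi> ^ e) * poly F1 (law_of_cosines s t \<phi>))" for \<phi>
    proof -
      have ode: "(1 - (law_of_cosines s t \<phi>)\<^sup>2) * poly F2 (law_of_cosines s t \<phi>) - (real e + 2) * law_of_cosines s t \<phi> * poly F1 (law_of_cosines s t \<phi>) + N * poly F (law_of_cosines s t \<phi>) = 0"
        using Geg_ode[of "law_of_cosines s t \<phi>" "Suc e" n]
        by (simp add: F_def F1_def F2_def N_def algebra_simps)
      have s: "(sin s)\<^sup>2 + (cos s)\<^sup>2 = 1" and t: "(sin t)\<^sup>2 + (cos t)\<^sup>2 = 1" and p: "(sin \<phi>)\<^sup>2 + (cos \<phi>)\<^sup>2 = 1"
        by simp_all
      \<comment> \<open>The law of sines: up to sign, \<open>Ws\<close> is the sine of the third side times the cosine of the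
        angle between it and the side \<open>s\<close>.\<close>
      have a: "1 - (law_of_cosines s t \<phi>)\<^sup>2 - (Ws s \<phi>)\<^sup>2 = (sin t)\<^sup>2 * (sin \<phi>)\<^sup>2"
        unfolding law_of_cosines_def Ws_def using s t p by algebra
      have b: "law_of_cosines s t \<phi> * sin s + cos s * Ws s \<phi> = sin t * cos \<phi>"
        unfolding law_of_cosines_def Ws_def using s t p by algebra
      have "?u \<phi> = sin t * (- poly F2 (law_of_cosines s t \<phi>) * sin s * sin t * (sin \<phi>)\<^sup>2 + (real e + 1) * poly F1 (law_of_cosines s t \<phi>) * cos \<phi>)"
        using ode a b by algebra
      then show ?thesis by (simp only:) (simp add: algebra_simps power2_eq_square)
    qed
    have "(?K has_real_derivative ?u \<phi> * sin \<phi> ^ e) (at \<phi>)" for \<phi>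
      unfolding u
      by (rule DERIV_cmult[OF DERIV_cong[OF DERIV_mult[OF DERIV_chain2[OF poly_DERIV D\<phi>] DERIV_power_Suc[OF DERIV_sin]]]])
        (simp add: F2_def)
    then have "((\<lambda>\<phi>. ?u \<phi> * sin \<phi> ^ e) has_integral (?K pi - ?K 0)) {0..pi}"
      by (rule DERIV_has_integral_0_pi)
    then have "wint e ?u = 0" by (simp add: wint_def integral_unique)
    moreover have "wint e ?u = sin s * H2 s + (real e + 1) * cos s * H1 s + N * sin s * H s"
    proof -
      let ?a = "\<lambda>\<phi>. sin s * (poly F2 (law_of_cosines s t \<phi>) * Ws s \<phi> * Ws s \<phi> + - law_of_cosines s t \<phi> * poly F1 (law_of_cosines s t \<phi>))"
      let ?b = "\<lambda>\<phi>. (real e + 1) * cos s * (poly F1 (law_of_cosines s t \<phi>) * Ws s \<phi>)"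
      let ?c = "\<lambda>\<phi>. N * sin s * poly F (law_of_cosines s t \<phi>)"
      have c: "continuous_on {0..pi} ?a" "continuous_on {0..pi} ?b" "continuous_on {0..pi} ?c"
        by (intro continuous_intros continuous_on_poly)+
      have "wint e (\<lambda>\<phi>. ?a \<phi> + ?b \<phi> + ?c \<phi>) = wint e ?a + wint e ?b + wint e ?c"
        using wint_add[OF continuous_on_add[OF c(1,2)] c(3)] wint_add[OF c(1,2)] by simp
      then show ?thesis
        unfolding H_def H1_def H2_def F_def[symmetric] by (simp only: wint_cmult)
    qed
    ultimately show ?thesis by (simp add: N_def)
  qed
  with dH dH1 show ?thesis by blast
qed

text \<open>
  By self-adjointness, the mean is orthogonal to all eigenfunctions with a different eigenvalue, hence by
  completeness a multiple of \<open>P\<^sub>n (cos s)\<close>. The factor is read off at \<open>s = 0\<close>,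
  where the integrand is constant.
\<close>

lemma Geg_product_formula:
  assumes "s \<in> {0..pi}"
  shows "wint e (\<lambda>\<phi>. poly (Geg (Suc e) n) (law_of_cosines s t \<phi>)) =
    wint e (\<lambda>_. 1) * zonal (Suc e) n s * zonal (Suc e) n t"
proof -
  define H where "H = (\<lambda>s. wint e (\<lambda>\<phi>. poly (Geg (Suc e) n) (law_of_cosines s t \<phi>)))"
  obtain H1 H2 where dH: "\<And>s. (H has_real_derivative H1 s) (at s)"
    and dH1: "\<And>s. (H1 has_real_derivative H2 s) (at s)"
    and odeH: "\<And>s. sin s * H2 s + (real e + 1) * cos s * H1 s + real n * (real n + real e + 1) * sin s * H s = 0"
    using Geg_product_ode[OF H_def] by blast
  have contH: "continuous_on S H" for S
    using dH by (meson DERIV_continuous_on has_field_derivative_at_within)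
  have orth: "wint (Suc e) (\<lambda>s. H s * zonal (Suc e) q s) = 0" if "q \<noteq> n" for q
  proof -
    define g where "g = (\<lambda>s. zonal (Suc e) q s)"
    define g1 where "g1 = (\<lambda>s. poly (pderiv (Geg (Suc e) q)) (cos s) * (- sin s))"
    define g2 where "g2 = (\<lambda>s. poly (pderiv (pderiv (Geg (Suc e) q))) (cos s) * (- sin s) * (- sin s)
        + - cos s * poly (pderiv (Geg (Suc e) q)) (cos s))"
    define N M where "N = real n * (real n + real e + 1)" and "M = real q * (real q + real e + 1)"
    have dg: "(g has_real_derivative g1 s) (at s)" for s
      unfolding g_def g1_def by (rule DERIV_chain2[OF poly_DERIV DERIV_cos])
    have dg1: "(g1 has_real_derivative g2 s) (at s)" for s
      unfolding g1_def g2_def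
      by (rule DERIV_mult[OF DERIV_chain2[OF poly_DERIV DERIV_cos] DERIV_minus[OF DERIV_sin]])
    have odeg: "sin s * g2 s + (real e + 1) * cos s * g1 s + M * sin s * g s = 0" for s
    proof -
      have ode: "(1 - (cos s)\<^sup>2) * poly (pderiv (pderiv (Geg (Suc e) q))) (cos s)
          - (real e + 2) * cos s * poly (pderiv (Geg (Suc e) q)) (cos s) + M * g s = 0"
        using Geg_ode[of "cos s" "Suc e" q] by (simp add: g_def M_def algebra_simps)
      have "(sin s)\<^sup>2 + (cos s)\<^sup>2 = 1" by simp
      with ode show ?thesis unfolding g1_def g2_def by algebra
    qed
    \<comment> \<open>The weighted Wronskian of \<open>H\<close> and \<open>g\<close>.\<close>
    let ?R = "\<lambda>s. sin s ^ Suc e * (H1 s * g s - H s * g1 s)"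
    have "(?R has_real_derivative (M - N) * (H s * g s * sin s ^ Suc e)) (at s)" for s
    proof -
      have D: "(?R has_real_derivative (1 + real e) * (cos s * sin s ^ e) * (H1 s * g s - H s * g1 s)
         + (H2 s * g s + g1 s * H1 s - (H1 s * g1 s + g2 s * H s)) * sin s ^ Suc e) (at s)"
        by (rule DERIV_mult[OF DERIV_power_Suc[OF DERIV_sin] DERIV_diff[OF DERIV_mult[OF dH1 dg] DERIV_mult[OF dH dg1]]])
      have "(1 + real e) * (cos s * sin s ^ e) * (H1 s * g s - H s * g1 s)
         + (H2 s * g s + g1 s * H1 s - (H1 s * g1 s + g2 s * H s)) * sin s ^ Suc e =
         sin s ^ e * (g s * (sin s * H2 s + (real e + 1) * cos s * H1 s) - H s * (sin s * g2 s + (real e + 1) * cos s * g1 s))"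
        by (simp add: algebra_simps)
      also have "\<dots> = sin s ^ e * (g s * (- N * sin s * H s) - H s * (- M * sin s * g s))"
      proof -
        have "sin s * H2 s + (real e + 1) * cos s * H1 s = - N * sin s * H s"
          using odeH[of s] by (simp add: N_def algebra_simps)
        moreover have "sin s * g2 s + (real e + 1) * cos s * g1 s = - M * sin s * g s"
          using odeg[of s] by (simp add: algebra_simps)
        ultimately show ?thesis by simp
      qed
      also have "\<dots> = (M - N) * (H s * g s * sin s ^ Suc e)" by (simp add: algebra_simps)
      finally show ?thesis using D by simp
    qed
    then have "((\<lambda>s. (M - N) * (H s * g s * sin s ^ Suc e)) has_integral (?R pi - ?R 0)) {0..pi}"
      by (rule DERIV_has_integral_0_pi)
    then have "(M - N) * wint (Suc e) (\<lambda>s. H s * g s) = 0"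
      by (simp add: wint_def integral_unique flip: integral_mult_right)
    moreover have "M - N = (real q - real n) * (real q + real n + real e + 1)"
      by (simp add: M_def N_def algebra_simps)
    moreover have "real q + real n + real e + 1 \<noteq> 0" by linarith
    ultimately show ?thesis using that by (simp add: g_def)
  qed
  define c where "c = wint (Suc e) (\<lambda>s. H s * zonal (Suc e) n s) / Geg_norm2 (Suc e) n"
  have eq: "H s - c * zonal (Suc e) n s = 0" if "s \<in> {0..pi}" for s
  proof (rule Geg_complete[where e = "Suc e", OF _ _ that])
    show "continuous_on {0..pi} (\<lambda>s. H s - c * zonal (Suc e) n s)"
      by (intro continuous_intros contH)
    fix q
    have "wint (Suc e) (\<lambda>s. (H s - c * zonal (Suc e) n s) * zonal (Suc e) q s) =
       wint (Suc e) (\<lambda>s. H s * zonal (Suc e) q s - c * (zonal (Suc e) n s * zonal (Suc e) q s))"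
      by (intro wint_cong) (simp add: algebra_simps)
    also have "\<dots> = wint (Suc e) (\<lambda>s. H s * zonal (Suc e) q s) - c * (if n = q then Geg_norm2 (Suc e) q else 0)"
      by (subst wint_diff) (auto intro!: continuous_intros contH simp: wint_cmult wint_Geg_Geg)
    also have "\<dots> = 0" using orth[of q] less_imp_neq[OF Geg_norm2_pos[of "Suc e" n]] by (auto simp: c_def)
    finally show "wint (Suc e) (\<lambda>s. (H s - c * zonal (Suc e) n s) * zonal (Suc e) q s) = 0" .
  qed
  have "H 0 = zonal (Suc e) n t * wint e (\<lambda>_. 1)"
    unfolding H_def law_of_cosines_def wint_cmult[symmetric] by simp
  then have "c = zonal (Suc e) n t * wint e (\<lambda>_. 1)" using eq[of 0] by simp
  then show ?thesis using eq[OF assms] by (simp add: H_def)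
qed

text \<open>
  The product structure exhibits the coefficients as positive semidefinite in \<open>(s, t)\<close>. By
  \<open>wint_pderiv\<close> the coefficient of degree \<open>q\<close> is, up to a nonnegative constant and the
  factor \<open>sin s sin t\<close>, the one of degree \<open>q - 1\<close> two dimensions higher; the case
  \<open>q = 0\<close> is the product formula.
\<close>

lemma Geg_addition_coeff:
  "\<exists>g. \<forall>s\<in>{0..pi}. \<forall>t\<in>{0..pi}.
     wint e (\<lambda>\<phi>. poly (Geg (Suc e) n) (law_of_cosines s t \<phi>) * zonal e q \<phi>) = g s * g t"
proof (induction q arbitrary: e n)
  case 0
  have "wint e (\<lambda>_. 1) \<ge> 0" using wint_1_pos[of e] by simp
  then show ?case
    by (intro exI[of _ "\<lambda>s. sqrt (wint e (\<lambda>_. 1)) * zonal (Suc e) n s"])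
      (auto simp: Geg_product_formula)
next
  case (Suc q)
  show ?case
  proof (cases n)
    case 0
    have "wint e (\<lambda>\<phi>. poly 1 (cos \<phi>) * zonal e (Suc q) \<phi>) = 0"
      by (intro wint_poly_Geg_eq_0) simp
    then show ?thesis by (intro exI[of _ "\<lambda>_. 0"]) (simp add: 0)
  next
    case (Suc m)
    define \<kappa> where "\<kappa> = (real m + 1) * (real m + real (Suc e) + 1) / (real (Suc e) + 1)"
    have \<kappa>: "\<kappa> \<ge> 0" by (simp add: \<kappa>_def)
    obtain g where g: "\<And>s t. s \<in> {0..pi} \<Longrightarrow> t \<in> {0..pi} \<Longrightarrow>
       wint (e + 2) (\<lambda>\<phi>. poly (Geg (Suc (e + 2)) m) (law_of_cosines s t \<phi>) * zonal (e + 2) q \<phi>) = g s * g t"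
      using Suc.IH[of "e + 2" m] by blast
    have "wint e (\<lambda>\<phi>. poly (Geg (Suc e) n) (law_of_cosines s t \<phi>) * zonal e (Suc q) \<phi>) =
      (sqrt (\<kappa> / (real e + 1)) * sin s * g s) * (sqrt (\<kappa> / (real e + 1)) * sin t * g t)"
      if "s \<in> {0..pi}" "t \<in> {0..pi}" for s t
    proof -
      let ?L = "[:cos s * cos t, sin s * sin t:]"
      define p where "p = pcompose (Geg (Suc e) n) ?L"
      have p: "poly p (cos \<phi>) = poly (Geg (Suc e) n) (law_of_cosines s t \<phi>)" for \<phi>
        by (simp add: p_def poly_pcompose law_of_cosines_def algebra_simps)
      have dp: "poly (pderiv p) (cos \<phi>) = \<kappa> * sin s * sin t * poly (Geg (Suc (e + 2)) m) (law_of_cosines s t \<phi>)" for \<phi>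
      proof -
        have "poly (pderiv p) (cos \<phi>) = poly (pderiv (Geg (Suc e) n)) (law_of_cosines s t \<phi>) * (sin s * sin t)"
          by (simp add: p_def pderiv_pcompose poly_pcompose pderiv_pCons law_of_cosines_def algebra_simps)
        also have "pderiv (Geg (Suc e) n) = smult \<kappa> (Geg (Suc (e + 2)) m)"
          unfolding Suc pderiv_Geg \<kappa>_def by simp
        finally show ?thesis by simp
      qed
      have "(real e + 1) * wint e (\<lambda>\<phi>. poly (Geg (Suc e) n) (law_of_cosines s t \<phi>) * zonal e (Suc q) \<phi>) =
         wint (e + 2) (\<lambda>\<phi>. poly (pderiv p) (cos \<phi>) * zonal (e + 2) q \<phi>)"
        using wint_pderiv[of e p q] by (simp add: p)
      also have "\<dots> = \<kappa> * sin s * sin t * (g s * g t)"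
        unfolding dp g[OF that, symmetric] wint_cmult[symmetric] by (simp add: mult.assoc)
      finally have "wint e (\<lambda>\<phi>. poly (Geg (Suc e) n) (law_of_cosines s t \<phi>) * zonal e (Suc q) \<phi>) =
         \<kappa> * sin s * sin t * (g s * g t) / (real e + 1)"
        by (simp add: eq_divide_eq mult.commute) 
      also have "\<dots> = (\<kappa> / (real e + 1)) * (sin s * g s * (sin t * g t))" by simp
      also have "\<kappa> / (real e + 1) = sqrt (\<kappa> / (real e + 1)) * sqrt (\<kappa> / (real e + 1))"
        using \<kappa> by simp
      finally show ?thesis by (simp only: mult_ac)
    qed
    then show ?thesis by (intro exI[of _ "\<lambda>s. sqrt (\<kappa> / (real e + 1)) * sin s * g s"]) blast
  qed
qed

text \<open>
  The zonal polynomial in polar coordinates, as a combination of those one dimension lower. The case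
  \<open>s = t\<close>, \<open>u = 1\<close> reads \<open>\<Sum>q\<le>n. (g q s)\<^sup>2 = 1\<close> and bounds
  all the factors.
\<close>

theorem Geg_addition_formula:
  "\<exists>g. (\<forall>s\<in>{0..pi}. \<forall>t\<in>{0..pi}. \<forall>u. poly (Geg (Suc e) n) (cos s * cos t + sin s * sin t * u) =
          (\<Sum>q\<le>n. g q s * g q t * poly (Geg e q) u)) \<and>
       (\<forall>s. g 0 s = zonal (Suc e) n s)"
proof -
  obtain g where g: "\<And>q s t. s \<in> {0..pi} \<Longrightarrow> t \<in> {0..pi} \<Longrightarrow>
     wint e (\<lambda>\<phi>. poly (Geg (Suc e) n) (law_of_cosines s t \<phi>) * zonal e q \<phi>) = g q s * g q t"
    using Geg_addition_coeff[of e n] by metis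
  define h where "h q s = (if q = 0 then zonal (Suc e) n s else g q s / sqrt (Geg_norm2 e q))" for q s
  have "poly (Geg (Suc e) n) (cos s * cos t + sin s * sin t * u) = (\<Sum>q\<le>n. h q s * h q t * poly (Geg e q) u)"
    if "s \<in> {0..pi}" "t \<in> {0..pi}" for s t u
  proof -
    define p where "p = pcompose (Geg (Suc e) n) [:cos s * cos t, sin s * sin t:]"
    have p: "poly p (cos \<phi>) = poly (Geg (Suc e) n) (law_of_cosines s t \<phi>)" for \<phi>
      by (simp add: p_def poly_pcompose law_of_cosines_def algebra_simps)
    have "degree p \<le> n" unfolding p_def
      by (rule order.trans[OF degree_pcompose_le]) (simp add: degree_Geg)
    from poly_Geg_expansion[OF this, where e = e and x = u]
    have "poly p u = (\<Sum>q\<le>n. wint e (\<lambda>\<phi>. poly (Geg (Suc e) n) (law_of_cosines s t \<phi>) * zonal e q \<phi>) / Geg_norm2 e q * poly (Geg e q) u)"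
      by (simp only: p)
    also have "\<dots> = (\<Sum>q\<le>n. h q s * h q t * poly (Geg e q) u)"
    proof (intro sum.cong refl)
      fix q
      have "wint e (\<lambda>\<phi>. poly (Geg (Suc e) n) (law_of_cosines s t \<phi>) * zonal e q \<phi>) / Geg_norm2 e q = h q s * h q t"
      proof (cases "q = 0")
        case True
        have "Geg_norm2 e 0 = wint e (\<lambda>_. 1)" by (simp add: Geg_norm2_def)
        then show ?thesis using True that wint_1_pos[of e] by (simp add: h_def Geg_product_formula)
      next
        case False
        then show ?thesis using that Geg_norm2_pos[of e q] by (simp add: h_def g real_sqrt_mult_self abs_of_pos)
      qed
      then show "wint e (\<lambda>\<phi>. poly (Geg (Suc e) n) (law_of_cosines s t \<phi>) * zonal e q \<phi>) / Geg_norm2 e q * poly (Geg e q) u =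
        h q s * h q t * poly (Geg e q) u" by simp
    qed
    finally show ?thesis by (simp add: p_def poly_pcompose algebra_simps)
  qed
  moreover have "\<And>s. h 0 s = zonal (Suc e) n s" by (simp add: h_def)
  ultimately show ?thesis by blast
qed

section \<open>Spheres in polar coordinates\<close>

abbreviation dotp :: "nat \<Rightarrow> (nat \<Rightarrow> real) \<Rightarrow> (nat \<Rightarrow> real) \<Rightarrow> real" where
  "dotp d x y \<equiv> \<Sum>i\<le>d. x i * y i"

lemma nsphere_iff: "x \<in> topspace (nsphere d) \<longleftrightarrow> (\<forall>i>d. x i = 0) \<and> dotp d x x = 1"
  by (auto simp: nsphere_def topspace_Euclidean_space power2_eq_square Suc_le_eq)

lemma dotp_bound:
  assumes "x \<in> topspace (nsphere d)" "y \<in> topspace (nsphere d)"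
  shows "\<bar>dotp d x y\<bar> \<le> 1"
proof -
  have "2 * \<bar>x i * y i\<bar> \<le> x i * x i + y i * y i" for i
    using sum_squares_bound[of "x i" "y i"] sum_squares_bound[of "x i" "- y i"]
    by (auto simp: power2_eq_square abs_if)
  then have "(\<Sum>i\<le>d. 2 * \<bar>x i * y i\<bar>) \<le> (\<Sum>i\<le>d. x i * x i + y i * y i)" by (intro sum_mono)
  also have "\<dots> = 2" using assms by (simp add: nsphere_iff sum.distrib)
  finally have "(\<Sum>i\<le>d. \<bar>x i * y i\<bar>) \<le> 1" by (simp flip: sum_distrib_left)
  then show ?thesis by (rule order.trans[OF sum_abs])
qed

lemma geo_dist_range:
  assumes "x \<in> topspace (nsphere d)" "y \<in> topspace (nsphere d)"
  shows "geo_dist d x y \<in> {0..pi}" "cos (geo_dist d x y) = dotp d x y"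
  using dotp_bound[OF assms] by (auto simp: geo_dist_def abs_le_iff intro!: arccos_lbound arccos_ubound cos_arccos)

text \<open>
  The new coordinate, of index \<open>d + 1\<close>, is the height over the equator, on which \<open>v\<close>
  lies.
\<close>

definition polar :: "nat \<Rightarrow> real \<Rightarrow> (nat \<Rightarrow> real) \<Rightarrow> nat \<Rightarrow> real" where
  "polar d s v = (\<lambda>i. if i = Suc d then cos s else sin s * v i)"

lemma dotp_polar: "dotp (Suc d) (polar d s v) (polar d t w) = cos s * cos t + sin s * sin t * dotp d v w"
proof -
  have "(\<Sum>i\<le>d. polar d s v i * polar d t w i) = (\<Sum>i\<le>d. sin s * sin t * (v i * w i))"
    by (intro sum.cong) (auto simp: polar_def)
  then show ?thesis by (simp add: polar_def sum_distrib_left)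
qed

lemma polar_in_nsphere:
  assumes "v \<in> topspace (nsphere d)"
  shows "polar d s v \<in> topspace (nsphere (Suc d))"
  using assms unfolding nsphere_iff dotp_polar by (auto simp: polar_def simp flip: power2_eq_square)

text \<open>
  At the two poles the equatorial point is arbitrary.
\<close>

lemma polar_surj:
  assumes x: "x \<in> topspace (nsphere (Suc d))"
  shows "\<exists>s v. s \<in> {0..pi} \<and> v \<in> topspace (nsphere d) \<and> x = polar d s v"
proof -
  define s where "s = arccos (x (Suc d))"
  have sum: "dotp d x x + x (Suc d) * x (Suc d) = 1" and out: "\<And>i. i > Suc d \<Longrightarrow> x i = 0"
    using x by (auto simp: nsphere_iff)
  have nonneg: "dotp d x x \<ge> 0" by (intro sum_nonneg) simp
  have "(x (Suc d))\<^sup>2 \<le> 1\<^sup>2" using sum nonneg by (simp add: power2_eq_square)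
  then have "\<bar>x (Suc d)\<bar> \<le> 1" using abs_le_square_iff[of "x (Suc d)" 1] by simp
  then have s: "s \<in> {0..pi}" "cos s = x (Suc d)"
    by (auto simp: s_def abs_le_iff intro!: arccos_lbound arccos_ubound cos_arccos)
  have sin2: "dotp d x x = (sin s)\<^sup>2"
    using sum s(2) sin_squared_eq[of s] by (simp add: power2_eq_square)
  show ?thesis
  proof (cases "sin s = 0")
    case True
    then have "dotp d x x = 0" using sin2 by simp
    then have "\<forall>i\<in>{..d}. x i * x i = 0"
      by (subst (asm) sum_nonneg_eq_0_iff) auto
    then have "x = polar d s (\<lambda>i. if i = 0 then 1 else 0)"
      using True s(2) out by (force simp: polar_def fun_eq_iff not_le[symmetric] le_Suc_eq)
    then show ?thesis using s(1) in_topspace_nsphere by blast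
  next
    case False
    define v where "v = (\<lambda>i. if i \<le> d then x i / sin s else 0)"
    have "dotp d v v = (\<Sum>i\<le>d. x i * x i / (sin s)\<^sup>2)"
      by (intro sum.cong) (auto simp: v_def power2_eq_square)
    also have "\<dots> = 1" using sin2 False by (simp flip: sum_divide_distrib)
    finally have "v \<in> topspace (nsphere d)" by (simp add: nsphere_iff v_def)
    moreover have "x = polar d s v"
      using False s(2) out by (auto simp: polar_def v_def fun_eq_iff)
    ultimately show ?thesis using s(1) by blast
  qed
qed

lemma polar_choice:
  obtains s v where "\<And>x. x \<in> topspace (nsphere (Suc d)) \<Longrightarrow>
    s x \<in> {0..pi} \<and> v x \<in> topspace (nsphere d) \<and> x = polar d (s x) (v x)"
  using polar_surj[of _ d] by metis

text \<open>
  A finite-dimensional feature map certifies positive definiteness. It is preferred to positive definiteness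
  itself since products with an arbitrary positive definite kernel then need no diagonalisation
  (\<open>Psi_mult_features_nonneg\<close>).
\<close>

definition has_features :: "'a set \<Rightarrow> ('a \<Rightarrow> 'a \<Rightarrow> real) \<Rightarrow> bool" where
  "has_features S K \<longleftrightarrow> (\<exists>fs :: ('a \<Rightarrow> real) list. \<forall>x\<in>S. \<forall>y\<in>S. K x y = (\<Sum>f\<leftarrow>fs. f x * f y))"

lemma has_features_add:
  assumes "has_features S K" "has_features S L"
  shows "has_features S (\<lambda>x y. K x y + L x y)"
proof -
  obtain fs gs where "\<forall>x\<in>S. \<forall>y\<in>S. K x y = (\<Sum>f\<leftarrow>fs. f x * f y)" "\<forall>x\<in>S. \<forall>y\<in>S. L x y = (\<Sum>f\<leftarrow>gs. f x * f y)"
    using assms unfolding has_features_def by blast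
  then show ?thesis unfolding has_features_def by (intro exI[of _ "fs @ gs"]) simp
qed

lemma has_features_sum:
  assumes "finite I" "\<And>i. i \<in> I \<Longrightarrow> has_features S (K i)"
  shows "has_features S (\<lambda>x y. \<Sum>i\<in>I. K i x y)"
  using assms
proof (induction I rule: finite_induct)
  case empty
  then show ?case unfolding has_features_def by (intro exI[of _ "[]"]) simp
next
  case (insert i I)
  then show ?case using has_features_add[of S "K i" "\<lambda>x y. \<Sum>i\<in>I. K i x y"] by simp
qed

lemma has_features_pullback:
  assumes "has_features S K" "\<And>x. x \<in> T \<Longrightarrow> v x \<in> S"
  shows "has_features T (\<lambda>x y. g x * g y * K (v x) (v y))"
proof -
  obtain fs where "\<forall>x\<in>S. \<forall>y\<in>S. K x y = (\<Sum>f\<leftarrow>fs. f x * f y)"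
    using assms unfolding has_features_def by blast
  then show ?thesis unfolding has_features_def using assms(2)
    by (intro exI[of _ "map (\<lambda>f x. g x * f (v x)) fs"])
      (auto simp: o_def sum_list_const_mult[symmetric] mult_ac)
qed

text \<open>
  The zonal polynomials are positive definite, by induction on the dimension: the addition formula writes the
  kernel in polar coordinates as a sum of pulled-back kernels of one dimension less. On the circle it is the
  addition theorem of the cosine.
\<close>

lemma Geg_has_features: "has_features (topspace (nsphere (Suc e))) (\<lambda>x y. poly (Geg e n) (dotp (Suc e) x y))"
proof (induction e arbitrary: n)
  case 0
  have "\<exists>a. x 0 = cos a \<and> x 1 = sin a" if "x \<in> topspace (nsphere (Suc 0))" for x
  proof -
    have "(x 0)\<^sup>2 + (x 1)\<^sup>2 = 1" using that by (simp add: nsphere_iff power2_eq_square)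
    then show ?thesis by (metis sincos_total_2pi)
  qed
  then obtain a where a: "\<And>x. x \<in> topspace (nsphere (Suc 0)) \<Longrightarrow> x 0 = cos (a x) \<and> x 1 = sin (a x)"
    by metis
  have "poly (Geg 0 n) (dotp (Suc 0) x y) =
      (\<Sum>f\<leftarrow>[\<lambda>x. cos (real n * a x), \<lambda>x. sin (real n * a x)]. f x * f y)"
    if "x \<in> topspace (nsphere (Suc 0))" "y \<in> topspace (nsphere (Suc 0))" for x y
  proof -
    have "dotp (Suc 0) x y = cos (a x - a y)" using a[OF that(1)] a[OF that(2)] by (simp add: cos_diff)
    then have "poly (Geg 0 n) (dotp (Suc 0) x y) = cos (real n * a x - real n * a y)"
      by (simp only: Geg_0_cos right_diff_distrib)
    then show ?thesis by (simp add: cos_diff)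
  qed
  then show ?case unfolding has_features_def by blast
next
  case (Suc e)
  let ?S = "topspace (nsphere (Suc e))" and ?T = "topspace (nsphere (Suc (Suc e)))"
  obtain s v where sv: "\<And>x. x \<in> ?T \<Longrightarrow> s x \<in> {0..pi} \<and> v x \<in> ?S \<and> x = polar (Suc e) (s x) (v x)"
    using polar_choice[of "Suc e"] by blast
  obtain g where g: "\<And>s t u. s \<in> {0..pi} \<Longrightarrow> t \<in> {0..pi} \<Longrightarrow>
       poly (Geg (Suc e) n) (cos s * cos t + sin s * sin t * u) = (\<Sum>q\<le>n. g q s * g q t * poly (Geg e q) u)"
    using Geg_addition_formula[of e n] by blast
  have eq: "poly (Geg (Suc e) n) (dotp (Suc (Suc e)) x y) =
      (\<Sum>q\<le>n. g q (s x) * g q (s y) * poly (Geg e q) (dotp (Suc e) (v x) (v y)))"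
    if "x \<in> ?T" "y \<in> ?T" for x y
  proof -
    have xy: "polar (Suc e) (s x) (v x) = x" "polar (Suc e) (s y) (v y) = y"
      and s: "s x \<in> {0..pi}" "s y \<in> {0..pi}"
      using sv[OF that(1)] sv[OF that(2)] by auto
    have "poly (Geg (Suc e) n) (dotp (Suc (Suc e)) (polar (Suc e) (s x) (v x)) (polar (Suc e) (s y) (v y))) =
      (\<Sum>q\<le>n. g q (s x) * g q (s y) * poly (Geg e q) (dotp (Suc e) (v x) (v y)))"
      unfolding dotp_polar by (rule g[OF s])
    then show ?thesis by (simp only: xy)
  qed
  have "has_features ?T (\<lambda>x y. \<Sum>q\<le>n. g q (s x) * g q (s y) * poly (Geg e q) (dotp (Suc e) (v x) (v y)))"
    by (intro has_features_sum finite_atMost has_features_pullback[OF Suc.IH]) (use sv in blast)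
  then show ?case unfolding has_features_def using eq by simp
qed

text \<open>
  A finite substitute for the invariant measure: a weighted point set on the sphere of dimension
  \<open>e + 1\<close> for which the double sums of the zonal polynomials of degrees 1 to \<open>L\<close>
  nearly vanish, as the corresponding double integrals do.
\<close>

definition nearly_uniform :: "nat \<Rightarrow> nat \<Rightarrow> real \<Rightarrow> 'i set \<Rightarrow> ('i \<Rightarrow> real) \<Rightarrow> ('i \<Rightarrow> nat \<Rightarrow> real) \<Rightarrow> bool" where
  "nearly_uniform e L \<epsilon> I w x \<longleftrightarrow> finite I \<and> (\<forall>i\<in>I. w i \<ge> 0 \<and> x i \<in> topspace (nsphere (Suc e))) \<and> sum w I = 1 \<and>
     (\<forall>l\<in>{1..L}. \<bar>\<Sum>i\<in>I. \<Sum>j\<in>I. w i * w j * poly (Geg e l) (dotp (Suc e) (x i) (x j))\<bar> \<le> \<epsilon>)"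

lemma nearly_uniform_to_nat:
  assumes "nearly_uniform e L \<epsilon> (I :: 'i set) w x"
  shows "\<exists>(I' :: nat set) w' x'. nearly_uniform e L \<epsilon> I' w' x'"
proof -
  have fin: "finite I" using assms by (simp add: nearly_uniform_def)
  obtain h where h: "bij_betw h {0..<card I} I" using ex_bij_betw_nat_finite[OF fin] by blast
  have sum: "(\<Sum>i\<in>I. f i) = (\<Sum>i\<in>{0..<card I}. f (h i))" for f :: "'i \<Rightarrow> real"
    using sum.reindex_bij_betw[OF h, of f] by simp
  have mem: "i \<in> {0..<card I} \<Longrightarrow> h i \<in> I" for i using h by (auto simp: bij_betw_def)
  have "nearly_uniform e L \<epsilon> {0..<card I} (w \<circ> h) (x \<circ> h)"
    using assms mem unfolding nearly_uniform_def sum by simp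
  then show ?thesis by blast
qed

text \<open>
  Equidistant points on the circle are exactly uniform up to degree \<open>L\<close>, if there are more than
  \<open>L\<close> of them: the sum of the powers of a nontrivial root of unity is 0.
\<close>

lemma nearly_uniform_circle: "nearly_uniform 0 L 0 {..<Suc L} (\<lambda>_. 1 / real (Suc L))
    (\<lambda>i k. if k = 0 then cos (2 * pi * real i / real (Suc L)) else if k = 1 then sin (2 * pi * real i / real (Suc L)) else 0)"
proof -
  define N where "N = Suc L"
  define a where "a i = 2 * pi * real i / real N" for i
  have N: "N > 0" by (simp add: N_def)
  have zero: "(\<Sum>i<N. cos (real l * a i)) = 0 \<and> (\<Sum>i<N. sin (real l * a i)) = 0" if l: "l \<in> {1..L}" for l
  proof -
    define z where "z = cis (2 * pi * real l / real N)"
    have "z ^ N = cis (2 * pi * real l)" unfolding z_def Complex.DeMoivre using N by simp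
    also have "\<dots> = 1" by (simp add: cis_multiple_2pi)
    finally have zN: "z ^ N = 1" .
    have "z \<noteq> 1"
    proof
      assume "z = 1"
      then have "cos (2 * pi * real l / real N) = 1" by (simp add: z_def complex_eq_iff)
      then obtain k :: int where "2 * pi * real l / real N = of_int k * 2 * pi" using cos_one_2pi_int by blast
      then have "real l = of_int k * real N" using N by (simp add: field_simps)
      then have "int l = k * int N" by (metis of_int_eq_iff of_int_mult of_int_of_nat_eq)
      then have "N dvd l" by (metis dvd_triv_right int_dvd_int_iff)
      then show False using l by (auto simp: N_def dest: dvd_imp_le)
    qed
    then have "(\<Sum>i<N. z ^ i) = 0" using geometric_sum[of z N] zN by simp
    moreover have "z ^ i = cis (real l * a i)" for i
      unfolding z_def Complex.DeMoivre a_def by (simp add: field_simps)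
    ultimately have "(\<Sum>i<N. cis (real l * a i)) = 0" by simp
    then have "Re (\<Sum>i<N. cis (real l * a i)) = 0" "Im (\<Sum>i<N. cis (real l * a i)) = 0" by simp_all
    then show ?thesis by simp
  qed
  let ?x = "\<lambda>i k::nat. if k = 0 then cos (a i) else if k = 1 then sin (a i) else 0"
  have dotp: "dotp (Suc 0) (?x i) (?x j) = cos (a i - a j)" for i j by (simp add: cos_diff)
  have "(\<Sum>i<N. \<Sum>j<N. 1 / real N * (1 / real N) * poly (Geg 0 l) (dotp (Suc 0) (?x i) (?x j))) = 0" if "l \<in> {1..L}" for l
  proof -
    have "(\<Sum>i<N. \<Sum>j<N. 1 / real N * (1 / real N) * poly (Geg 0 l) (dotp (Suc 0) (?x i) (?x j))) =
      1 / real N * (1 / real N) * (\<Sum>i<N. \<Sum>j<N. cos (real l * a i) * cos (real l * a j) + sin (real l * a i) * sin (real l * a j))"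
      unfolding dotp Geg_0_cos sum_distrib_left[symmetric] by (simp add: right_diff_distrib cos_diff)
    also have "(\<Sum>i<N. \<Sum>j<N. cos (real l * a i) * cos (real l * a j) + sin (real l * a i) * sin (real l * a j)) =
      (\<Sum>i<N. cos (real l * a i)) * (\<Sum>i<N. cos (real l * a i)) + (\<Sum>i<N. sin (real l * a i)) * (\<Sum>i<N. sin (real l * a i))"
      by (simp add: sum_product sum.distrib)
    finally show ?thesis using zero[OF that] by simp
  qed
  moreover have "?x i \<in> topspace (nsphere (Suc 0))" for i
    by (auto simp: nsphere_iff simp flip: power2_eq_square)
  ultimately show ?thesis unfolding nearly_uniform_def N_def[symmetric] a_def[symmetric]
    using N by simp
qed

text \<open>
  Normalised Riemann sums of the weighted integral, in which all polynomials of positive degree have mean 0.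
\<close>

lemma Geg_quadrature:
  assumes "\<epsilon> > 0"
  obtains A :: "(real \<times> real set) set" and w where
    "finite A" "\<And>a. a \<in> A \<Longrightarrow> fst a \<in> {0..pi} \<and> w a \<ge> 0" "sum w A = 1"
    "\<And>l. l \<in> {1..L} \<Longrightarrow> \<bar>\<Sum>a\<in>A. w a * zonal e l (fst a)\<bar> \<le> \<epsilon>"
proof -
  define F where "F = division_filter (cbox 0 pi :: real set)"
  define R where "R f p = (\<Sum>(x, k)\<in>p. measure lborel k *\<^sub>R (f x * sin x ^ e))" for f :: "real \<Rightarrow> real" and p :: "(real \<times> real set) set"
  have lim: "(R f \<longlongrightarrow> wint e f) F" if "continuous_on {0..pi} f" for f
  proof -
    have "((\<lambda>x. f x * sin x ^ e) has_integral wint e f) (cbox 0 pi)"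
      using integrable_integral[OF wint_integrable[OF that, of e]] by (simp add: wint_def)
    then show ?thesis unfolding has_integral_cbox R_def F_def .
  qed
  have lim1: "(R (\<lambda>_. 1) \<longlongrightarrow> wint e (\<lambda>_. 1)) F" by (intro lim continuous_intros)
  have ev1: "eventually (\<lambda>p. R (\<lambda>_. 1) p > 0) F"
    using order_tendstoD(1)[OF lim1 wint_1_pos] .
  have ev2: "eventually (\<lambda>p. \<forall>l\<in>{1..L}. \<bar>R (\<lambda>\<theta>. zonal e l \<theta>) p / R (\<lambda>_. 1) p\<bar> < \<epsilon>) F"
  proof (intro eventually_ball_finite ballI)
    fix l assume l: "l \<in> {1..L}"
    have "wint e (\<lambda>\<theta>. poly 1 (cos \<theta>) * zonal e l \<theta>) = 0"
      using l by (intro wint_poly_Geg_eq_0) auto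
    then have J0: "wint e (\<lambda>\<theta>. zonal e l \<theta>) = 0" by simp
    have "(R (\<lambda>\<theta>. zonal e l \<theta>) \<longlongrightarrow> 0) F"
      using lim[of "\<lambda>\<theta>. zonal e l \<theta>"] by (simp add: J0 continuous_intros)
    then have "((\<lambda>p. R (\<lambda>\<theta>. zonal e l \<theta>) p / R (\<lambda>_. 1) p) \<longlongrightarrow> 0 / wint e (\<lambda>_. 1)) F"
      using lim1 less_imp_neq[OF wint_1_pos[of e]] by (intro tendsto_divide) auto
    then have "((\<lambda>p. \<bar>R (\<lambda>\<theta>. zonal e l \<theta>) p / R (\<lambda>_. 1) p\<bar>) \<longlongrightarrow> 0) F"
      by (intro tendsto_rabs_zero) simp
    then show "eventually (\<lambda>p. \<bar>R (\<lambda>\<theta>. zonal e l \<theta>) p / R (\<lambda>_. 1) p\<bar> < \<epsilon>) F"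
      using assms by (rule order_tendstoD(2))
  qed auto
  have ev3: "eventually (\<lambda>p. p tagged_division_of cbox 0 pi) F"
    unfolding F_def by (rule eventually_division_filter_tagged_division)
  have "F \<noteq> bot" unfolding F_def by (rule division_filter_not_empty)
  then obtain p where p: "R (\<lambda>_. 1) p > 0" "p tagged_division_of cbox 0 pi"
     "\<forall>l\<in>{1..L}. \<bar>R (\<lambda>\<theta>. zonal e l \<theta>) p / R (\<lambda>_. 1) p\<bar> < \<epsilon>"
    using eventually_happens'[OF _ eventually_conj[OF ev1 eventually_conj[OF ev2 ev3]]] by auto
  define w where "w a = measure lborel (snd a) * sin (fst a) ^ e / R (\<lambda>_. 1) p" for a :: "real \<times> real set"
  have Rw: "R f p / R (\<lambda>_. 1) p = (\<Sum>a\<in>p. w a * f (fst a))" for f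
    unfolding R_def w_def sum_divide_distrib by (intro sum.cong) (auto simp: split_beta)
  have mem: "fst a \<in> {0..pi}" if "a \<in> p" for a
    using tag_in_interval[OF p(2), of "fst a" "snd a"] that by simp
  show ?thesis
  proof (rule that[of p w])
    show "finite p" using p(2) by (rule tagged_division_ofD(1))
    show "fst a \<in> {0..pi} \<and> w a \<ge> 0" if "a \<in> p" for a
      using mem[OF that] p(1) by (auto simp: w_def intro!: divide_nonneg_pos mult_nonneg_nonneg zero_le_power sin_ge_zero)
    show "sum w p = 1" using Rw[of "\<lambda>_. 1"] p(1) by simp
    show "\<bar>\<Sum>a\<in>p. w a * zonal e l (fst a)\<bar> \<le> \<epsilon>" if "l \<in> {1..L}" for l
      using p(3) that by (auto simp: Rw less_imp_le)
  qed
qed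

text \<open>
  Take the product of a quadrature in latitude and a point set on the equator. By the addition formula the
  double sum of degree \<open>l\<close> splits into terms \<open>B\<^sub>q\<^sup>2 E\<^sub>q\<close>, with
  \<open>E\<^sub>q\<close> the double sum of degree \<open>q\<close> on the equator. For
  \<open>q \<ge> 1\<close> the factor \<open>E\<^sub>q\<close> is small, and for \<open>q = 0\<close> the factor
  \<open>B\<^sub>0\<close>, as the quadrature of a polynomial of degree \<open>l \<ge> 1\<close>.
\<close>

lemma nearly_uniform_exists:
  assumes "\<epsilon> > 0"
  shows "\<exists>(I :: nat set) w x. nearly_uniform e L \<epsilon> I w x"
  using assms
proof (induction e arbitrary: \<epsilon>)
  case 0
  have "nearly_uniform 0 L \<epsilon> {..<Suc L} (\<lambda>_. 1 / real (Suc L))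
    (\<lambda>i k. if k = 0 then cos (2 * pi * real i / real (Suc L)) else if k = 1 then sin (2 * pi * real i / real (Suc L)) else 0)"
    using nearly_uniform_circle[of L] 0 unfolding nearly_uniform_def by force
  then show ?case by blast
next
  case (Suc e)
  \<comment> \<open>Accuracies for the quadrature in latitude, where the error is squared, and for the equator, where up to
    \<open>L\<close> terms add up.\<close>
  define \<epsilon>1 \<epsilon>2 where "\<epsilon>1 = min 1 (\<epsilon> / 2)" and "\<epsilon>2 = \<epsilon> / (2 * (real L + 1))"
  have \<epsilon>12: "\<epsilon>1 > 0" "\<epsilon>2 > 0" using Suc.prems by (auto simp: \<epsilon>1_def \<epsilon>2_def)
  obtain I :: "nat set" and u v where uv: "nearly_uniform e L \<epsilon>2 I u v" using Suc.IH[OF \<epsilon>12(2)] by blast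
  obtain A :: "(real \<times> real set) set" and w where A: "finite A" "\<And>a. a \<in> A \<Longrightarrow> fst a \<in> {0..pi} \<and> w a \<ge> 0" "sum w A = 1"
    "\<And>l. l \<in> {1..L} \<Longrightarrow> \<bar>\<Sum>a\<in>A. w a * zonal (Suc e) l (fst a)\<bar> \<le> \<epsilon>1"
    using Geg_quadrature[OF \<epsilon>12(1)] by blast
  have I: "finite I" "\<And>i. i \<in> I \<Longrightarrow> u i \<ge> 0" "\<And>i. i \<in> I \<Longrightarrow> v i \<in> topspace (nsphere (Suc e))" "sum u I = 1"
    "\<And>l. l \<in> {1..L} \<Longrightarrow> \<bar>\<Sum>i\<in>I. \<Sum>j\<in>I. u i * u j * poly (Geg e l) (dotp (Suc e) (v i) (v j))\<bar> \<le> \<epsilon>2"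
    using uv by (auto simp: nearly_uniform_def)
  define ww where "ww = (\<lambda>(a, i). w a * u i)"
  define xx where "xx = (\<lambda>(a :: real \<times> real set, i). polar (Suc e) (fst a) (v i))"
  have "nearly_uniform (Suc e) L \<epsilon> (A \<times> I) ww xx"
    unfolding nearly_uniform_def
  proof (intro conjI ballI)
    show "finite (A \<times> I)" using A I by simp
    show "ww p \<ge> 0" if "p \<in> A \<times> I" for p using that A I by (auto simp: ww_def)
    show "xx p \<in> topspace (nsphere (Suc (Suc e)))" if "p \<in> A \<times> I" for p
      using that I by (auto simp: xx_def intro: polar_in_nsphere)
    have "sum ww (A \<times> I) = sum w A * sum u I"
      unfolding ww_def sum_product by (simp add: sum.cartesian_product)
    then show "sum ww (A \<times> I) = 1" using A I by simp
    fix l assume l: "l \<in> {1..L}"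
    obtain g where g: "\<And>s t u. s \<in> {0..pi} \<Longrightarrow> t \<in> {0..pi} \<Longrightarrow>
       poly (Geg (Suc e) l) (cos s * cos t + sin s * sin t * u) = (\<Sum>q\<le>l. g q s * g q t * poly (Geg e q) u)"
      and g0: "\<And>s. g 0 s = zonal (Suc e) l s"
      using Geg_addition_formula[of e l] by blast
    define E where "E q = (\<Sum>i\<in>I. \<Sum>j\<in>I. u i * u j * poly (Geg e q) (dotp (Suc e) (v i) (v j)))" for q
    define B where "B q = (\<Sum>a\<in>A. w a * g q (fst a))" for q
    have "(\<Sum>p\<in>A \<times> I. \<Sum>p'\<in>A \<times> I. ww p * ww p' * poly (Geg (Suc e) l) (dotp (Suc (Suc e)) (xx p) (xx p'))) =
       (\<Sum>p\<in>A \<times> I. \<Sum>p'\<in>A \<times> I. \<Sum>q\<le>l. (w (fst p) * g q (fst (fst p))) * (w (fst p') * g q (fst (fst p')))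
            * (u (snd p) * u (snd p') * poly (Geg e q) (dotp (Suc e) (v (snd p)) (v (snd p')))))"
    proof (intro sum.cong refl)
      fix p p' assume "p \<in> A \<times> I" "p' \<in> A \<times> I"
      then have "fst (fst p) \<in> {0..pi}" "fst (fst p') \<in> {0..pi}" using A(2) by auto
      then show "ww p * ww p' * poly (Geg (Suc e) l) (dotp (Suc (Suc e)) (xx p) (xx p')) =
        (\<Sum>q\<le>l. (w (fst p) * g q (fst (fst p))) * (w (fst p') * g q (fst (fst p')))
            * (u (snd p) * u (snd p') * poly (Geg e q) (dotp (Suc e) (v (snd p)) (v (snd p')))))"
        unfolding ww_def xx_def split_beta dotp_polar by (subst g) (auto simp: sum_distrib_left intro!: sum.cong)
    qed
    also have "\<dots> = (\<Sum>q\<le>l. \<Sum>p\<in>A \<times> I. \<Sum>p'\<in>A \<times> I. (w (fst p) * g q (fst (fst p))) * (w (fst p') * g q (fst (fst p')))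
            * (u (snd p) * u (snd p') * poly (Geg e q) (dotp (Suc e) (v (snd p)) (v (snd p')))))"
      by (subst sum.swap[of _ "{..l}"], subst sum.swap[of _ "{..l}"]) (rule refl)
    also have "\<dots> = (\<Sum>q\<le>l. B q * B q * E q)"
    proof (intro sum.cong refl)
      fix q
      let ?c = "\<lambda>a. w a * g q (fst a)" and ?k = "\<lambda>i j. u i * u j * poly (Geg e q) (dotp (Suc e) (v i) (v j))"
      have "(\<Sum>p\<in>A \<times> I. \<Sum>p'\<in>A \<times> I. ?c (fst p) * ?c (fst p') * ?k (snd p) (snd p')) =
         (\<Sum>a\<in>A. \<Sum>i\<in>I. \<Sum>b\<in>A. \<Sum>j\<in>I. ?c a * ?c b * ?k i j)"
        by (simp add: sum.cartesian_product' )
      also have "\<dots> = (\<Sum>a\<in>A. \<Sum>b\<in>A. \<Sum>i\<in>I. \<Sum>j\<in>I. ?c a * ?c b * ?k i j)"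
        by (intro sum.cong refl sum.swap)
      also have "\<dots> = B q * B q * E q"
      proof -
        have "B q * B q = (\<Sum>a\<in>A. \<Sum>b\<in>A. ?c a * ?c b)" unfolding B_def by (rule sum_product)
        then show ?thesis unfolding E_def by (simp only: sum_distrib_right) (simp only: sum_distrib_left)
      qed
      finally show "(\<Sum>p\<in>A \<times> I. \<Sum>p'\<in>A \<times> I. ?c (fst p) * ?c (fst p') * ?k (snd p) (snd p')) = B q * B q * E q" .
    qed
    finally have eq: "(\<Sum>p\<in>A \<times> I. \<Sum>p'\<in>A \<times> I. ww p * ww p' * poly (Geg (Suc e) l) (dotp (Suc (Suc e)) (xx p) (xx p')))
      = (\<Sum>q\<le>l. B q * B q * E q)" .
    \<comment> \<open>The squares of the factors sum to \<open>P\<^sub>l(1) = 1\<close>.\<close>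
    have g1: "\<bar>g q s\<bar> \<le> 1" if "s \<in> {0..pi}" "q \<le> l" for q s
    proof -
      have "(\<Sum>q\<le>l. (g q s)\<^sup>2) = poly (Geg (Suc e) l) (cos s * cos s + sin s * sin s * 1)"
        by (subst g[OF that(1) that(1)]) (simp add: power2_eq_square)
      also have "\<dots> = 1" by (simp flip: power2_eq_square)
      finally have "(\<Sum>q\<le>l. (g q s)\<^sup>2) = 1" .
      moreover have "(g q s)\<^sup>2 \<le> (\<Sum>q\<le>l. (g q s)\<^sup>2)" using that by (intro member_le_sum) auto
      ultimately show ?thesis by (simp add: abs_square_le_1)
    qed
    have B1: "\<bar>B q\<bar> \<le> 1" if "q \<le> l" for q
    proof -
      have "\<bar>B q\<bar> \<le> (\<Sum>a\<in>A. \<bar>w a * g q (fst a)\<bar>)" unfolding B_def by (rule sum_abs)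
      also have "\<dots> \<le> (\<Sum>a\<in>A. w a * 1)"
      proof (intro sum_mono)
        fix a assume "a \<in> A"
        then show "\<bar>w a * g q (fst a)\<bar> \<le> w a * 1"
          unfolding abs_mult using A(2)[of a] g1[OF _ that, of "fst a"] by (intro mult_mono) auto
      qed
      finally show ?thesis using A(3) by simp
    qed
    have "\<bar>B q * B q * E q\<bar> \<le> (if q = 0 then \<epsilon> / 2 else \<epsilon>2)" if "q \<le> l" for q
    proof (cases "q = 0")
      case True
      have "E 0 = sum u I * sum u I" unfolding E_def by (simp add: sum_product)
      moreover have "\<bar>B 0\<bar> \<le> \<epsilon>1" unfolding B_def g0 using A(4)[OF l] .
      moreover have "\<bar>B 0\<bar> * \<bar>B 0\<bar> \<le> \<epsilon>1 * 1"
        using \<open>\<bar>B 0\<bar> \<le> \<epsilon>1\<close> B1[of 0] \<epsilon>12 by (intro mult_mono) auto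
      ultimately show ?thesis using True I(4) by (simp add: abs_mult \<epsilon>1_def)
    next
      case False
      then have "\<bar>E q\<bar> \<le> \<epsilon>2" unfolding E_def using that l by (intro I(5)) auto
      moreover have "\<bar>B q\<bar> * \<bar>B q\<bar> \<le> 1 * 1" using B1[OF that] by (intro mult_mono) auto
      ultimately have "(\<bar>B q\<bar> * \<bar>B q\<bar>) * \<bar>E q\<bar> \<le> 1 * \<epsilon>2" by (intro mult_mono) auto
      then show ?thesis using False by (simp add: abs_mult)
    qed
    then have "\<bar>\<Sum>q\<le>l. B q * B q * E q\<bar> \<le> (\<Sum>q\<le>l. if q = 0 then \<epsilon> / 2 else \<epsilon>2)"
      by (intro order.trans[OF sum_abs] sum_mono) auto
    also have "\<dots> = \<epsilon> / 2 + real l * \<epsilon>2"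
      by (subst sum.atMost_shift) simp
    also have "\<dots> \<le> \<epsilon> / 2 + (real L + 1) * \<epsilon>2"
      using l \<epsilon>12 by (intro add_left_mono mult_right_mono) auto
    also have "\<dots> = \<epsilon>" by (simp add: \<epsilon>2_def field_simps)
    finally show "\<bar>\<Sum>p\<in>A \<times> I. \<Sum>p'\<in>A \<times> I. ww p * ww p' * poly (Geg (Suc e) l) (dotp (Suc (Suc e)) (xx p) (xx p'))\<bar> \<le> \<epsilon>"
      unfolding eq .
  qed
  then show ?case by (rule nearly_uniform_to_nat)
qed

section \<open>Expansion of positive definite functions\<close>

lemma Psi_double_sum_nonneg:
  assumes \<psi>: "\<psi> \<in> Psi d" and "finite I" and x: "\<And>i. i \<in> I \<Longrightarrow> x i \<in> topspace (nsphere d)"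
  shows "(\<Sum>i\<in>I. \<Sum>j\<in>I. c i * c j * \<psi> (geo_dist d (x i) (x j))) \<ge> 0"
proof (cases "I = {}")
  case False
  obtain h where h: "bij_betw h {1..card I} I" using ex_bij_betw_nat_finite_1[OF \<open>finite I\<close>] by blast
  have sum: "(\<Sum>i\<in>I. f i) = (\<Sum>i=1..card I. f (h i))" for f :: "'a \<Rightarrow> real"
    using sum.reindex_bij_betw[OF h, of f] by simp
  have mem: "i \<in> {1..card I} \<Longrightarrow> h i \<in> I" for i using h by (auto simp: bij_betw_def)
  have "card I \<ge> 1" using False \<open>finite I\<close> by (simp add: Suc_le_eq card_gt_0_iff)
  moreover have "\<forall>i\<in>{1..card I}. (x \<circ> h) i \<in> topspace (nsphere d)" using x mem by simp
  ultimately have "(\<Sum>i=1..card I. \<Sum>j=1..card I. (c \<circ> h) i * (c \<circ> h) j * \<psi> (geo_dist d ((x \<circ> h) i) ((x \<circ> h) j))) \<ge> 0"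
    using \<psi> unfolding Psi_def by blast
  then show ?thesis unfolding sum by simp
qed simp

lemma Psi_antimono:
  assumes "\<psi> \<in> Psi (Suc d)"
  shows "\<psi> \<in> Psi d"
proof -
  have up: "x \<in> topspace (nsphere (Suc d))" "\<And>y. geo_dist (Suc d) x y = geo_dist d x y"
    if "x \<in> topspace (nsphere d)" for x
    using that by (auto simp: nsphere_iff geo_dist_def)
  have "(\<Sum>i=1..N. \<Sum>j=1..N. c i * c j * \<psi> (geo_dist d (x i) (x j))) \<ge> 0"
    if "\<forall>i\<in>{1..N}. x i \<in> topspace (nsphere d)" for N and x :: "nat \<Rightarrow> nat \<Rightarrow> real" and c
  proof -
    have "(\<Sum>i=1..N. \<Sum>j=1..N. c i * c j * \<psi> (geo_dist d (x i) (x j))) =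
      (\<Sum>i=1..N. \<Sum>j=1..N. c i * c j * \<psi> (geo_dist (Suc d) (x i) (x j)))"
      using that up by (intro sum.cong refl) simp
    then show ?thesis using Psi_double_sum_nonneg[OF assms, of "{1..N}" x c] that up(1) by simp
  qed
  then show ?thesis using assms unfolding Psi_def by blast
qed

text \<open>
  The existential is uniform in the weights, which allows both \<open>w i j = c i * c j\<close> and weights with
  another kernel as factor.
\<close>

lemma features_double_sum:
  assumes "has_features S K" and x: "\<And>i. i \<in> I \<Longrightarrow> x i \<in> S"
  shows "\<exists>(N :: nat) f. \<forall>w :: 'i \<Rightarrow> 'i \<Rightarrow> real.
    (\<Sum>i\<in>I. \<Sum>j\<in>I. w i j * K (x i) (x j)) = (\<Sum>k<N. \<Sum>i\<in>I. \<Sum>j\<in>I. f k i * f k j * w i j)"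
proof -
  obtain fs where fs: "\<And>x y. x \<in> S \<Longrightarrow> y \<in> S \<Longrightarrow> K x y = (\<Sum>f\<leftarrow>fs. f x * f y)"
    using assms unfolding has_features_def by blast
  show ?thesis
  proof (intro exI[of _ "length fs"] exI[of _ "\<lambda>k i. (fs ! k) (x i)"] allI)
    fix w :: "'i \<Rightarrow> 'i \<Rightarrow> real"
    have "(\<Sum>i\<in>I. \<Sum>j\<in>I. w i j * K (x i) (x j)) =
      (\<Sum>i\<in>I. \<Sum>j\<in>I. \<Sum>k<length fs. (fs ! k) (x i) * (fs ! k) (x j) * w i j)"
      using x by (intro sum.cong refl)
        (simp add: fs sum_list_sum_nth atLeast0LessThan sum_distrib_left sum_distrib_right mult_ac)
    also have "\<dots> = (\<Sum>k<length fs. \<Sum>i\<in>I. \<Sum>j\<in>I. (fs ! k) (x i) * (fs ! k) (x j) * w i j)"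
      by (subst sum.swap[of _ "{..<length fs}"], subst sum.swap[of _ "{..<length fs}"]) (rule refl)
    finally show "(\<Sum>i\<in>I. \<Sum>j\<in>I. w i j * K (x i) (x j)) = \<dots>" .
  qed
qed

lemma features_positive_definite:
  assumes "has_features S K" "\<And>i. i \<in> I \<Longrightarrow> x i \<in> S"
  shows "(\<Sum>i\<in>I. \<Sum>j\<in>I. c i * c j * K (x i) (x j)) \<ge> (0 :: real)"
proof -
  obtain N :: nat and f where f: "\<And>w. (\<Sum>i\<in>I. \<Sum>j\<in>I. w i j * K (x i) (x j)) =
      (\<Sum>k<N. \<Sum>i\<in>I. \<Sum>j\<in>I. f k i * f k j * w i j)"
    using features_double_sum[of S K I x] assms by auto
  have "(\<Sum>i\<in>I. \<Sum>j\<in>I. f k i * f k j * (c i * c j)) = (\<Sum>i\<in>I. f k i * c i) * (\<Sum>i\<in>I. f k i * c i)" for k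
    unfolding sum_product by (intro sum.cong refl) simp
  then show ?thesis unfolding f by (simp add: sum_nonneg)
qed

text \<open>
  Schur's product theorem: every feature is absorbed into the coefficients \<open>c\<close>.
\<close>

lemma Psi_mult_features_nonneg:
  assumes "\<psi> \<in> Psi d" "has_features (topspace (nsphere d)) K" "finite I"
    and "\<And>i. i \<in> I \<Longrightarrow> x i \<in> topspace (nsphere d)"
  shows "(\<Sum>i\<in>I. \<Sum>j\<in>I. c i * c j * (\<psi> (geo_dist d (x i) (x j)) * K (x i) (x j))) \<ge> 0"
proof -
  obtain N :: nat and f where f: "\<And>w. (\<Sum>i\<in>I. \<Sum>j\<in>I. w i j * K (x i) (x j)) =
      (\<Sum>k<N. \<Sum>i\<in>I. \<Sum>j\<in>I. f k i * f k j * w i j)"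
    using features_double_sum[of _ K I x, OF assms(2)] assms(4) by auto
  have "(\<Sum>i\<in>I. \<Sum>j\<in>I. c i * c j * (\<psi> (geo_dist d (x i) (x j)) * K (x i) (x j))) =
     (\<Sum>k<N. \<Sum>i\<in>I. \<Sum>j\<in>I. f k i * f k j * (c i * c j * \<psi> (geo_dist d (x i) (x j))))"
    unfolding f[symmetric] by (simp add: mult.assoc)
  also have "\<dots> = (\<Sum>k<N. \<Sum>i\<in>I. \<Sum>j\<in>I. (f k i * c i) * (f k j * c j) * \<psi> (geo_dist d (x i) (x j)))"
    by (intro sum.cong refl) simp
  also have "\<dots> \<ge> 0" using assms by (intro sum_nonneg[of "{..<N}"] Psi_double_sum_nonneg)
  finally show ?thesis .
qed

text \<open>
  The double sum of the kernel \<open>\<psi> P\<^sub>n\<close> over a nearly uniform point set is nonnegative,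
  and it is close to the mean of \<open>\<psi> P\<^sub>n\<close> over the sphere: replace
  \<open>\<psi> P\<^sub>n\<close> by a polynomial, of whose expansion only the constant term survives.
\<close>

lemma Psi_Geg_coeff_nonneg:
  assumes \<psi>: "\<psi> \<in> Psi (Suc e)"
  shows "wint e (\<lambda>\<theta>. \<psi> \<theta> * zonal e n \<theta>) \<ge> 0"
proof -
  define h where "h = (\<lambda>\<theta>. \<psi> \<theta> * zonal e n \<theta>)"
  have cont: "continuous_on {0..pi} h" using \<psi> unfolding h_def Psi_def by (auto intro!: continuous_intros)
  have "- wint e h \<le> \<epsilon> * (3 * wint e (\<lambda>_. 1))" if \<epsilon>: "\<epsilon> > 0" for \<epsilon>
  proof -
    obtain p where p: "\<And>\<theta>. \<theta> \<in> {0..pi} \<Longrightarrow> \<bar>h \<theta> - poly p (cos \<theta>)\<bar> < \<epsilon>"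
      using uniform_poly_cos_approx[OF cont \<epsilon>] by blast
    define L where "L = degree p"
    obtain c where "p = (\<Sum>q\<le>L. smult (c q) (Geg e q))"
      using poly_in_Geg_span[of p L] by (auto simp: L_def)
    then have pc: "poly p u = (\<Sum>q\<le>L. c q * poly (Geg e q) u)" for u by (simp add: poly_sum)
    define C where "C = 1 + (\<Sum>q\<le>L. \<bar>c q\<bar>)"
    have C: "C > 0" unfolding C_def by (intro add_pos_nonneg sum_nonneg) auto
    then have "\<epsilon> / C > 0" using \<epsilon> by simp
    then obtain I :: "nat set" and w x where "nearly_uniform e L (\<epsilon> / C) I w x"
      using nearly_uniform_exists by blast
    then have I: "finite I" "\<And>i. i \<in> I \<Longrightarrow> w i \<ge> 0" "\<And>i. i \<in> I \<Longrightarrow> x i \<in> topspace (nsphere (Suc e))" "sum w I = 1"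
      "\<And>l. l \<in> {1..L} \<Longrightarrow> \<bar>\<Sum>i\<in>I. \<Sum>j\<in>I. w i * w j * poly (Geg e l) (dotp (Suc e) (x i) (x j))\<bar> \<le> \<epsilon> / C"
      by (auto simp: nearly_uniform_def)
    define E where "E q = (\<Sum>i\<in>I. \<Sum>j\<in>I. w i * w j * poly (Geg e q) (dotp (Suc e) (x i) (x j)))" for q
    have E0: "E 0 = 1" unfolding E_def using I(4) by (simp add: sum_product[symmetric])
    have "0 \<le> (\<Sum>i\<in>I. \<Sum>j\<in>I. w i * w j * (\<psi> (geo_dist (Suc e) (x i) (x j)) * poly (Geg e n) (dotp (Suc e) (x i) (x j))))"
      by (intro Psi_mult_features_nonneg[OF \<psi> Geg_has_features] I)
    also have "\<dots> = (\<Sum>i\<in>I. \<Sum>j\<in>I. w i * w j * h (geo_dist (Suc e) (x i) (x j)))"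
      unfolding h_def using geo_dist_range(2) I(3) by (intro sum.cong refl) simp
    also have "\<dots> \<le> (\<Sum>i\<in>I. \<Sum>j\<in>I. w i * w j * (poly p (dotp (Suc e) (x i) (x j)) + \<epsilon>))"
    proof (intro sum_mono mult_left_mono)
      fix i j assume ij: "i \<in> I" "j \<in> I"
      note r = geo_dist_range[OF I(3)[OF ij(1)] I(3)[OF ij(2)]]
      show "h (geo_dist (Suc e) (x i) (x j)) \<le> poly p (dotp (Suc e) (x i) (x j)) + \<epsilon>"
        using p[OF r(1)] unfolding r(2) by linarith
      show "0 \<le> w i * w j" using I(2) ij by simp
    qed
    also have "\<dots> = (\<Sum>q\<le>L. c q * E q) + \<epsilon>"
    proof -
      have "(\<Sum>i\<in>I. \<Sum>j\<in>I. w i * w j * (poly p (dotp (Suc e) (x i) (x j)) + \<epsilon>)) =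
        (\<Sum>i\<in>I. \<Sum>j\<in>I. \<Sum>q\<le>L. c q * (w i * w j * poly (Geg e q) (dotp (Suc e) (x i) (x j)))) + (\<Sum>i\<in>I. \<Sum>j\<in>I. w i * w j) * \<epsilon>"
        unfolding pc by (simp add: distrib_left sum.distrib sum_distrib_left sum_distrib_right mult_ac)
      also have "(\<Sum>i\<in>I. \<Sum>j\<in>I. w i * w j) = 1" using I(4) by (simp add: sum_product[symmetric])
      also have "(\<Sum>i\<in>I. \<Sum>j\<in>I. \<Sum>q\<le>L. c q * (w i * w j * poly (Geg e q) (dotp (Suc e) (x i) (x j)))) =
         (\<Sum>q\<le>L. \<Sum>i\<in>I. \<Sum>j\<in>I. c q * (w i * w j * poly (Geg e q) (dotp (Suc e) (x i) (x j))))"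
        by (subst sum.swap[of _ "{..L}"], subst sum.swap[of _ "{..L}"]) (rule refl)
      finally show ?thesis unfolding E_def by (simp add: sum_distrib_left)
    qed
    also have "(\<Sum>q\<le>L. c q * E q) \<le> c 0 + \<epsilon>"
    proof -
      have "(\<Sum>q\<le>L. c q * E q) = c 0 + (\<Sum>q\<in>{1..L}. c q * E q)"
        using E0 by (simp add: atMost_atLeast0 sum.atLeast_Suc_atMost)
      also have "(\<Sum>q\<in>{1..L}. c q * E q) \<le> (\<Sum>q\<in>{1..L}. \<bar>c q\<bar> * (\<epsilon> / C))"
      proof (intro sum_mono)
        fix q assume "q \<in> {1..L}"
        then have "\<bar>c q\<bar> * \<bar>E q\<bar> \<le> \<bar>c q\<bar> * (\<epsilon> / C)" unfolding E_def by (intro mult_left_mono I(5)) auto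
        then show "c q * E q \<le> \<bar>c q\<bar> * (\<epsilon> / C)" unfolding abs_mult[symmetric] by simp
      qed
      also have "\<dots> = (\<Sum>q\<in>{1..L}. \<bar>c q\<bar>) * (\<epsilon> / C)" by (rule sum_distrib_right[symmetric])
      also have "\<dots> \<le> C * (\<epsilon> / C)"
      proof (intro mult_right_mono)
        have "(\<Sum>q\<in>{1..L}. \<bar>c q\<bar>) \<le> (\<Sum>q\<le>L. \<bar>c q\<bar>)" by (intro sum_mono2) auto
        then show "(\<Sum>q\<in>{1..L}. \<bar>c q\<bar>) \<le> C" by (simp add: C_def)
      qed (use C \<epsilon> in auto)
      also have "\<dots> = \<epsilon>" using C by simp
      finally show ?thesis by simp
    qed
    finally have c0: "c 0 \<ge> - 2 * \<epsilon>" by simp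
    have "wint e (\<lambda>\<theta>. poly p (cos \<theta>)) = c 0 * wint e (\<lambda>_. 1)"
      using wint_sum_Geg_Geg[of "{..L}" e c 0] by (simp add: pc Geg_norm2_def)
    then have "wint e (\<lambda>\<theta>. poly p (cos \<theta>)) \<ge> - 2 * \<epsilon> * wint e (\<lambda>_. 1)"
      using mult_right_mono[OF c0, of "wint e (\<lambda>_. 1)"] wint_1_pos[of e] by simp
    moreover have "wint e (\<lambda>\<theta>. poly p (cos \<theta>)) \<le> wint e (\<lambda>\<theta>. h \<theta> + \<epsilon> * 1)"
      using p by (intro wint_mono continuous_intros cont) (force simp: abs_less_iff)
    moreover have "wint e (\<lambda>\<theta>. h \<theta> + \<epsilon> * 1) = wint e h + \<epsilon> * wint e (\<lambda>_. 1)"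
      unfolding wint_cmult[symmetric] by (intro wint_add continuous_intros cont)
    ultimately show ?thesis by simp
  qed
  moreover have "3 * wint e (\<lambda>_. 1) \<ge> 0" using wint_1_pos[of e] by linarith
  ultimately have "- wint e h \<le> 0" by (rule le_0_if_le_eps)
  then show ?thesis by (simp add: h_def)
qed

text \<open>
  The addition formula at \<open>s = t = \<pi>/2\<close>, where the coefficients are squares, lowers the
  dimension by one; iterate down to the circle.
\<close>

lemma Geg_cos_expansion:
  "\<exists>\<alpha>. (\<forall>l. \<alpha> l \<ge> 0) \<and> (\<forall>u. poly (Geg e n) u = (\<Sum>l\<le>n. \<alpha> l * poly (Geg 0 l) u))"
proof (induction e arbitrary: n)
  case 0
  show ?case by (intro exI[of _ "\<lambda>l. if l = n then 1 else 0"]) (auto simp: if_distrib[of "\<lambda>x. x * _"] cong: if_cong)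
next
  case (Suc e)
  obtain g where g: "\<forall>s\<in>{0..pi}. \<forall>t\<in>{0..pi}. \<forall>u. poly (Geg (Suc e) n) (cos s * cos t + sin s * sin t * u) =
          (\<Sum>q\<le>n. g q s * g q t * poly (Geg e q) u)"
    using Geg_addition_formula[of e n] by blast
  have "pi / 2 \<in> {0..pi}" by simp
  from g[rule_format, OF this this]
  have gu: "poly (Geg (Suc e) n) u = (\<Sum>q\<le>n. (g q (pi / 2))\<^sup>2 * poly (Geg e q) u)" for u
    by (simp add: power2_eq_square)
  obtain \<beta> where \<beta>: "\<And>q l. \<beta> q l \<ge> 0" "\<And>q u. poly (Geg e q) u = (\<Sum>l\<le>q. \<beta> q l * poly (Geg 0 l) u)"
    using Suc.IH by metis
  define \<alpha> where "\<alpha> l = (\<Sum>q\<le>n. (g q (pi / 2))\<^sup>2 * (if l \<le> q then \<beta> q l else 0))" for l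
  have "poly (Geg (Suc e) n) u = (\<Sum>l\<le>n. \<alpha> l * poly (Geg 0 l) u)" for u
  proof -
    have "poly (Geg e q) u = (\<Sum>l\<le>n. (if l \<le> q then \<beta> q l else 0) * poly (Geg 0 l) u)" if "q \<le> n" for q
      unfolding \<beta>(2) using that by (intro sum.mono_neutral_cong_left) auto
    then have "poly (Geg (Suc e) n) u =
        (\<Sum>q\<le>n. \<Sum>l\<le>n. (g q (pi / 2))\<^sup>2 * (if l \<le> q then \<beta> q l else 0) * poly (Geg 0 l) u)"
      unfolding gu by (intro sum.cong refl) (simp add: sum_distrib_left mult.assoc)
    also have "\<dots> = (\<Sum>l\<le>n. \<alpha> l * poly (Geg 0 l) u)"
      unfolding \<alpha>_def sum_distrib_right by (rule sum.swap)
    finally show ?thesis .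
  qed
  moreover have "\<alpha> l \<ge> 0" for l unfolding \<alpha>_def using \<beta>(1) by (intro sum_nonneg) auto
  ultimately show ?case by blast
qed

lemma Geg_abs_le_1: "\<bar>zonal e n \<theta>\<bar> \<le> 1"
proof -
  obtain \<alpha> where \<alpha>: "\<And>l. \<alpha> l \<ge> 0" "\<And>u. poly (Geg e n) u = (\<Sum>l\<le>n. \<alpha> l * poly (Geg 0 l) u)"
    using Geg_cos_expansion[of e n] by blast
  have "\<bar>zonal e n \<theta>\<bar> \<le> (\<Sum>l\<le>n. \<bar>\<alpha> l * zonal 0 l \<theta>\<bar>)" unfolding \<alpha>(2) by (rule sum_abs)
  also have "\<dots> \<le> (\<Sum>l\<le>n. \<alpha> l * 1)"
    unfolding abs_mult Geg_0_cos using \<alpha>(1) by (intro sum_mono mult_mono) auto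
  also have "\<dots> = 1" using \<alpha>(2)[of 1] by simp
  finally show ?thesis .
qed

lemma Geg_series:
  fixes b :: "nat \<Rightarrow> real" and e :: nat and k :: "nat \<Rightarrow> nat"
  assumes b: "\<And>n. b n \<ge> 0" "summable b"
  defines "S \<equiv> (\<lambda>\<theta>. \<Sum>n. b n * zonal e (k n) \<theta>)"
  shows "summable (\<lambda>n. b n * zonal e (k n) \<theta>)"
    and "uniform_limit UNIV (\<lambda>N \<theta>. \<Sum>n<N. b n * zonal e (k n) \<theta>) S sequentially"
    and "continuous_on A S"
proof -
  have le: "norm (b n * zonal e (k n) \<theta>) \<le> b n" for n \<theta>
    using mult_left_mono[OF Geg_abs_le_1[of e "k n" \<theta>] b(1)[of n]] b(1)[of n] by (simp add: abs_mult)
  show "summable (\<lambda>n. b n * zonal e (k n) \<theta>)"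
    by (rule summable_comparison_test'[OF b(2) le])
  show u: "uniform_limit UNIV (\<lambda>N \<theta>. \<Sum>n<N. b n * zonal e (k n) \<theta>) S sequentially"
    unfolding S_def by (rule Weierstrass_m_test[OF le b(2)])
  show "continuous_on A S"
    by (rule continuous_on_subset[OF uniform_limit_theorem[OF _ u]])
      (auto intro!: always_eventually continuous_intros)
qed

text \<open>
  After removal of finitely many terms of its expansion the function still has nonnegative coefficients, hence a
  nonnegative value at 0; so the partial sums of the coefficients are bounded by \<open>\<psi> 0 = 1\<close>.
  The series therefore converges uniformly, and it has the same coefficients as \<open>\<psi>\<close>.
\<close>

theorem Schoenberg:
  assumes \<psi>: "\<psi> \<in> Psi (Suc e)"
  shows "\<exists>b. (\<forall>n. b n \<ge> 0) \<and> summable b \<and>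
    (\<forall>\<theta>\<in>{0..pi}. \<psi> \<theta> = (\<Sum>n. b n * zonal e n \<theta>))"
proof -
  define b where "b n = wint e (\<lambda>\<theta>. \<psi> \<theta> * zonal e n \<theta>) / Geg_norm2 e n" for n
  have cont: "continuous_on {0..pi} \<psi>" and \<psi>0: "\<psi> 0 = 1" using \<psi> by (auto simp: Psi_def)
  have b0: "b n \<ge> 0" for n
    unfolding b_def using Psi_Geg_coeff_nonneg[OF \<psi>] Geg_norm2_pos[of e n] by (simp add: less_imp_le)
  have coeff: "wint e (\<lambda>\<theta>. (\<psi> \<theta> - (\<Sum>q<N. b q * zonal e q \<theta>)) * zonal e n \<theta>) =
      (if n < N then 0 else b n * Geg_norm2 e n)" for N n
  proof -
    have "wint e (\<lambda>\<theta>. (\<psi> \<theta> - (\<Sum>q<N. b q * zonal e q \<theta>)) * zonal e n \<theta>) =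
       wint e (\<lambda>\<theta>. \<psi> \<theta> * zonal e n \<theta>) - wint e (\<lambda>\<theta>. (\<Sum>q<N. b q * zonal e q \<theta>) * zonal e n \<theta>)"
      unfolding left_diff_distrib by (intro wint_diff continuous_intros cont)
    also have "wint e (\<lambda>\<theta>. \<psi> \<theta> * zonal e n \<theta>) = b n * Geg_norm2 e n"
      using Geg_norm2_pos[of e n] by (simp add: b_def)
    finally show ?thesis by (simp add: wint_sum_Geg_Geg)
  qed
  have partial: "(\<Sum>q<N. b q) \<le> 1" for N
  proof -
    have "0 \<le> \<psi> 0 - (\<Sum>q<N. b q * zonal e q 0)"
    proof (rule value_at_0_nonneg[where e = e])
      show "continuous_on {0..pi} (\<lambda>\<theta>. \<psi> \<theta> - (\<Sum>q<N. b q * zonal e q \<theta>))"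
        by (intro continuous_intros cont)
      show "wint e (\<lambda>\<theta>. (\<psi> \<theta> - (\<Sum>q<N. b q * zonal e q \<theta>)) * zonal e n \<theta>) \<ge> 0" for n
        unfolding coeff using b0[of n] Geg_norm2_pos[of e n] by simp
    qed
    then show ?thesis using \<psi>0 by simp
  qed
  have sum: "summable b"
    using b0 partial by (intro summableI_nonneg_bounded[of b 1]) auto
  define S where "S = (\<lambda>\<theta>. \<Sum>n. b n * zonal e n \<theta>)"
  have S: "uniform_limit UNIV (\<lambda>N \<theta>. \<Sum>n<N. b n * zonal e n \<theta>) S sequentially"
    "\<And>A. continuous_on A S"
    unfolding S_def using Geg_series[where b = b and e = e and k = "\<lambda>n. n", OF b0 sum] by auto
  have "\<psi> \<theta> - S \<theta> = 0" if "\<theta> \<in> {0..pi}" for \<theta>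
  proof (rule Geg_complete[where e = e, OF _ _ that])
    show "continuous_on {0..pi} (\<lambda>\<theta>. \<psi> \<theta> - S \<theta>)" by (intro continuous_intros cont S)
    fix n
    have "\<bar>wint e (\<lambda>\<theta>. (\<psi> \<theta> - S \<theta>) * zonal e n \<theta>)\<bar> \<le> \<epsilon> * wint e (\<lambda>_. 1)" if "\<epsilon> > 0" for \<epsilon>
    proof -
      have "eventually (\<lambda>N. \<forall>\<theta>\<in>UNIV. dist (\<Sum>n<N. b n * zonal e n \<theta>) (S \<theta>) < \<epsilon>) sequentially"
        using S(1) that by (auto simp: uniform_limit_iff)
      then obtain M where M: "\<And>N \<theta>. N \<ge> M \<Longrightarrow> dist (\<Sum>n<N. b n * zonal e n \<theta>) (S \<theta>) < \<epsilon>"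
        unfolding eventually_sequentially by auto
      define N where "N = max M (Suc n)"
      let ?P = "\<lambda>\<theta>. \<Sum>q<N. b q * zonal e q \<theta>"
      let ?D = "\<lambda>\<theta>. (?P \<theta> - S \<theta>) * zonal e n \<theta>"
      have D: "\<bar>?D \<theta>\<bar> \<le> \<epsilon>" for \<theta>
      proof -
        have "\<bar>?P \<theta> - S \<theta>\<bar> * \<bar>zonal e n \<theta>\<bar> \<le> \<epsilon> * 1"
          using M[of N \<theta>] Geg_abs_le_1[of e n \<theta>] that by (intro mult_mono) (auto simp: N_def dist_real_def)
        then show ?thesis by (simp add: abs_mult)
      qed
      have cD: "continuous_on {0..pi} ?D" by (intro continuous_intros S)
      have "wint e (\<lambda>\<theta>. (\<psi> \<theta> - S \<theta>) * zonal e n \<theta>) =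
        wint e (\<lambda>\<theta>. (\<psi> \<theta> - ?P \<theta>) * zonal e n \<theta> + ?D \<theta>)"
        by (intro wint_cong) (simp add: algebra_simps)
      also have "\<dots> = wint e (\<lambda>\<theta>. (\<psi> \<theta> - ?P \<theta>) * zonal e n \<theta>) + wint e ?D"
        by (intro wint_add cD continuous_intros cont)
      also have "\<dots> = wint e ?D" unfolding coeff by (simp add: N_def)
      finally have eq: "wint e (\<lambda>\<theta>. (\<psi> \<theta> - S \<theta>) * zonal e n \<theta>) = wint e ?D" .
      have "wint e ?D \<le> wint e (\<lambda>\<theta>. \<epsilon> * 1)" "wint e (\<lambda>\<theta>. (- \<epsilon>) * 1) \<le> wint e ?D"
        using D cD by (auto intro!: wint_mono continuous_intros simp: abs_le_iff) (smt (verit) D)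
      then show ?thesis unfolding eq wint_cmult by (simp add: abs_le_iff)
    qed
    moreover have "wint e (\<lambda>_. 1) \<ge> 0" using wint_1_pos[of e] by linarith
    ultimately have "\<bar>wint e (\<lambda>\<theta>. (\<psi> \<theta> - S \<theta>) * zonal e n \<theta>)\<bar> \<le> 0"
      by (rule le_0_if_le_eps)
    then show "wint e (\<lambda>\<theta>. (\<psi> \<theta> - S \<theta>) * zonal e n \<theta>) = 0" by simp
  qed
  then show ?thesis using b0 sum by (intro exI[of _ b]) (auto simp: S_def)
qed

section \<open>Derivatives, Peano expansions and differences\<close>

text \<open>
  \<open>C\<^sup>r\<close> on a set, as a chain of derivatives. Unlike iterates of \<open>deriv\<close>, the
  chain is free of junk values, so that closure properties are immediate inductions.
\<close>

fun Ck_on :: "nat \<Rightarrow> (real \<Rightarrow> real) \<Rightarrow> real set \<Rightarrow> bool" where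
  "Ck_on 0 f S \<longleftrightarrow> continuous_on S f"
| "Ck_on (Suc r) f S \<longleftrightarrow> (\<exists>g. (\<forall>x\<in>S. (f has_real_derivative g x) (at x)) \<and> Ck_on r g S)"

lemma Ck_on_SucI:
  assumes "\<And>x. x \<in> S \<Longrightarrow> (f has_real_derivative g x) (at x)" "Ck_on r g S"
  shows "Ck_on (Suc r) f S"
  using assms by auto

lemma Ck_on_SucE:
  assumes "Ck_on (Suc r) f S"
  obtains g where "\<And>x. x \<in> S \<Longrightarrow> (f has_real_derivative g x) (at x)" "Ck_on r g S"
  using assms by auto

lemma Ck_on_cong:
  assumes "open S" "Ck_on r f S" "\<And>x. x \<in> S \<Longrightarrow> f x = g x"
  shows "Ck_on r g S"
proof (cases r)
  case 0
  then show ?thesis using assms continuous_on_cong[of S S f g] by simp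
next
  case (Suc k)
  then obtain f' where f': "\<And>x. x \<in> S \<Longrightarrow> (f has_real_derivative f' x) (at x)" "Ck_on k f' S"
    using assms(2) by auto
  have "(g has_real_derivative f' x) (at x)" if "x \<in> S" for x
    by (rule has_field_derivative_transform_within_open[OF f'(1)[OF that] assms(1) that assms(3)])
  then show ?thesis using Suc f'(2) by auto
qed

lemma Ck_on_continuous: "Ck_on r f S \<Longrightarrow> continuous_on S f"
  by (cases r) (auto intro!: continuous_at_imp_continuous_on intro: DERIV_isCont)

lemma Ck_on_SucD: "Ck_on (Suc r) f S \<Longrightarrow> Ck_on r f S"
proof (induction r arbitrary: f)
  case 0
  then show ?case using Ck_on_continuous by (metis Ck_on.simps(1))
next
  case (Suc r)
  from Suc.prems obtain g where g: "\<And>x. x \<in> S \<Longrightarrow> (f has_real_derivative g x) (at x)" "Ck_on (Suc r) g S"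
    by (rule Ck_on_SucE) blast
  show ?case by (rule Ck_on_SucI[OF g(1) Suc.IH[OF g(2)]])
qed

lemma Ck_on_const: "Ck_on r (\<lambda>_. c) S"
proof (induction r arbitrary: c)
  case (Suc r)
  show ?case by (rule Ck_on_SucI[OF DERIV_const Suc])
qed simp

lemma Ck_on_ident: "Ck_on r (\<lambda>x. x) S"
proof (cases r)
  case (Suc k)
  show ?thesis unfolding Suc by (rule Ck_on_SucI[OF DERIV_ident Ck_on_const])
qed simp

lemma Ck_on_add: "Ck_on r f S \<Longrightarrow> Ck_on r g S \<Longrightarrow> Ck_on r (\<lambda>x. f x + g x) S"
proof (induction r arbitrary: f g)
  case 0
  then show ?case by (simp add: continuous_on_add)
next
  case (Suc r)
  from Suc.prems(1) obtain f' where f: "\<And>x. x \<in> S \<Longrightarrow> (f has_real_derivative f' x) (at x)" "Ck_on r f' S"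
    by (rule Ck_on_SucE) blast
  from Suc.prems(2) obtain g' where g: "\<And>x. x \<in> S \<Longrightarrow> (g has_real_derivative g' x) (at x)" "Ck_on r g' S"
    by (rule Ck_on_SucE) blast
  show ?case by (rule Ck_on_SucI[OF DERIV_add[OF f(1) g(1)] Suc.IH[OF f(2) g(2)]])
qed

lemma Ck_on_mult: "Ck_on r f S \<Longrightarrow> Ck_on r g S \<Longrightarrow> Ck_on r (\<lambda>x. f x * g x) S"
proof (induction r arbitrary: f g)
  case 0
  then show ?case by (simp add: continuous_on_mult)
next
  case (Suc r)
  from Suc.prems(1) obtain f' where f: "\<And>x. x \<in> S \<Longrightarrow> (f has_real_derivative f' x) (at x)" "Ck_on r f' S"
    by (rule Ck_on_SucE) blast
  from Suc.prems(2) obtain g' where g: "\<And>x. x \<in> S \<Longrightarrow> (g has_real_derivative g' x) (at x)" "Ck_on r g' S"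
    by (rule Ck_on_SucE) blast
  have "Ck_on r (\<lambda>x. f' x * g x + g' x * f x) S"
    by (intro Ck_on_add Suc.IH f g Ck_on_SucD[OF Suc.prems(1)] Ck_on_SucD[OF Suc.prems(2)])
  from Ck_on_SucI[OF DERIV_mult[OF f(1) g(1)] this] show ?case .
qed

lemma Ck_on_cmult: "Ck_on r f S \<Longrightarrow> Ck_on r (\<lambda>x. c * f x) S"
  by (intro Ck_on_mult Ck_on_const)

lemma Ck_on_diff: "Ck_on r f S \<Longrightarrow> Ck_on r g S \<Longrightarrow> Ck_on r (\<lambda>x. f x - g x) S"
  using Ck_on_add[of r f S "\<lambda>x. - 1 * g x"] Ck_on_cmult[of r g S "- 1"] by simp

lemma Ck_on_poly:
  assumes "Ck_on r f S"
  shows "Ck_on r (\<lambda>x. poly p (f x)) S"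
proof (induction p)
  case 0
  show ?case by (simp add: Ck_on_const)
next
  case (pCons a p)
  show ?case unfolding poly_pCons by (intro Ck_on_add Ck_on_mult Ck_on_const assms pCons)
qed

lemma Ck_on_sin_cos: "Ck_on r sin S \<and> Ck_on r cos S"
proof (induction r)
  case 0
  then show ?case by (simp add: continuous_on_sin continuous_on_cos)
next
  case (Suc r)
  have "Ck_on r (\<lambda>x. - 1 * sin x) S" using Suc by (intro Ck_on_cmult) auto
  then have "Ck_on r (\<lambda>x. - sin x) S" by simp
  with Suc show ?case by (blast intro: Ck_on_SucI[OF DERIV_sin] Ck_on_SucI[OF DERIV_cos])
qed

lemma Ck_on_exp_cos: "Ck_on r (\<lambda>x. exp ((cos x - 1) / 2)) S"
proof (induction r)
  case 0
  then show ?case by (auto intro!: continuous_intros)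
next
  case (Suc r)
  have "((\<lambda>x. exp ((cos x - 1) / 2)) has_real_derivative ((- 1 / 2) * sin x) * exp ((cos x - 1) / 2)) (at x)" for x
    by (auto intro!: derivative_eq_intros)
  moreover have "Ck_on r (\<lambda>x. ((- 1 / 2) * sin x) * exp ((cos x - 1) / 2)) S"
    using Suc Ck_on_sin_cos by (intro Ck_on_mult Ck_on_const) auto
  ultimately show ?case by (rule Ck_on_SucI)
qed

lemma Ck_on_inverse_sin: "Ck_on r (\<lambda>x. inverse (sin x)) {0<..<pi}"
proof (induction r)
  case 0
  have "sin x \<noteq> 0" if "x \<in> {0<..<pi}" for x using that sin_gt_zero[of x] by auto
  then show ?case by (auto intro!: continuous_intros)
next
  case (Suc r)
  have "((\<lambda>x. inverse (sin x)) has_real_derivative (- 1 * cos x) * (inverse (sin x) * inverse (sin x))) (at x)"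
    if "x \<in> {0<..<pi}" for x
  proof -
    have "sin x \<noteq> 0" using that sin_gt_zero[of x] by auto
    then show ?thesis by (auto intro!: derivative_eq_intros simp: power2_eq_square field_simps)
  qed
  moreover have "Ck_on r (\<lambda>x. (- 1 * cos x) * (inverse (sin x) * inverse (sin x))) {0<..<pi}"
    using Suc Ck_on_sin_cos by (intro Ck_on_mult Ck_on_const) auto
  ultimately show ?case by (rule Ck_on_SucI)
qed

lemma Ck_on_inverse_sqrt: "Ck_on r (\<lambda>t. inverse (sqrt (1 - t\<^sup>2))) {-1<..<1}"
proof (induction r)
  case 0
  have "1 - t\<^sup>2 > 0" if "t \<in> {-1<..<1}" for t :: real using that by (auto simp: abs_square_less_1 abs_less_iff)
  then have "sqrt (1 - t\<^sup>2) \<noteq> 0" if "t \<in> {-1<..<1}" for t :: real using that by force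
  then show ?case by (auto intro!: continuous_intros)
next
  case (Suc r)
  let ?v = "\<lambda>t::real. inverse (sqrt (1 - t\<^sup>2))"
  have "(?v has_real_derivative t * (?v t * (?v t * ?v t))) (at t)" if "t \<in> {-1<..<1}" for t
  proof -
    have pos: "1 - t\<^sup>2 > 0" using that by (auto simp: abs_square_less_1 abs_less_iff)
    have "((\<lambda>t. 1 - t\<^sup>2) has_real_derivative - 2 * t) (at t)" by (auto intro!: derivative_eq_intros)
    from DERIV_inverse_fun[OF DERIV_chain2[OF DERIV_real_sqrt[OF pos] this]] pos
    have "((\<lambda>t. inverse (sqrt (1 - t\<^sup>2))) has_real_derivative
      - (inverse (sqrt (1 - t\<^sup>2)) / 2 * (- 2 * t) * inverse (sqrt (1 - t\<^sup>2) ^ Suc (Suc 0)))) (at t)" by force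
    then show ?thesis by (rule DERIV_cong) (simp add: mult_ac del: real_sqrt_mult_self)
  qed
  moreover have "Ck_on r (\<lambda>t. t * (?v t * (?v t * ?v t))) {-1<..<1}"
    using Suc by (intro Ck_on_mult Ck_on_ident)
  ultimately show ?case by (rule Ck_on_SucI)
qed

lemma Ck_on_arccos: "Ck_on r arccos {-1<..<1}"
proof (cases r)
  case 0
  then show ?thesis by (auto intro!: continuous_intros)
next
  case (Suc k)
  have "(arccos has_real_derivative - 1 * inverse (sqrt (1 - t\<^sup>2))) (at t)" if "t \<in> {-1<..<1}" for t
    using DERIV_arccos[of t] that by simp
  moreover have "Ck_on k (\<lambda>t. - 1 * inverse (sqrt (1 - t\<^sup>2))) {-1<..<1}"
    by (intro Ck_on_cmult Ck_on_inverse_sqrt)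
  ultimately show ?thesis unfolding Suc by (rule Ck_on_SucI)
qed

text \<open>
  Here \<open>U i n\<close> is the derivative of order \<open>i\<close> of the term \<open>n\<close>.
\<close>

lemma Ck_on_suminf:
  fixes U :: "nat \<Rightarrow> nat \<Rightarrow> real \<Rightarrow> real"
  assumes D: "\<And>i n x. (U i n has_real_derivative U (Suc i) n x) (at x)"
    and M: "\<And>i n x. i \<le> r \<Longrightarrow> \<bar>U i n x\<bar> \<le> M i n" and sum: "\<And>i. i \<le> r \<Longrightarrow> summable (M i)"
  shows "Ck_on r (\<lambda>x. \<Sum>n. U 0 n x) UNIV"
  using assms
proof (induction r arbitrary: U M)
  case 0
  have "uniform_limit UNIV (\<lambda>N x. \<Sum>n<N. U 0 n x) (\<lambda>x. \<Sum>n. U 0 n x) sequentially"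
    by (rule Weierstrass_m_test[of _ _ "M 0"]) (use 0 in auto)
  then have "continuous_on UNIV (\<lambda>x. \<Sum>n. U 0 n x)"
  proof (rule uniform_limit_theorem[rotated])
    have "continuous_on UNIV (\<lambda>x. \<Sum>n<N. U 0 n x)" for N
      by (intro continuous_on_sum continuous_at_imp_continuous_on ballI DERIV_isCont[OF 0(1)])
    then show "\<forall>\<^sub>F N in sequentially. continuous_on UNIV (\<lambda>x. \<Sum>n<N. U 0 n x)"
      by (intro always_eventually allI)
  qed simp
  then show ?case by simp
next
  case (Suc r)
  have "uniform_limit UNIV (\<lambda>N x. \<Sum>n<N. U (Suc 0) n x) (\<lambda>x. \<Sum>n. U (Suc 0) n x) sequentially"
    by (rule Weierstrass_m_test[of _ _ "M (Suc 0)"]) (use Suc.prems in auto)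
  then have u: "uniformly_convergent_on UNIV (\<lambda>N x. \<Sum>n<N. U (Suc 0) n x)"
    by (auto simp: uniformly_convergent_on_def)
  have s: "summable (\<lambda>n. U 0 n 0)"
    by (rule summable_comparison_test'[of "M 0"]) (use Suc.prems in auto)
  have "((\<lambda>x. \<Sum>n. U 0 n x) has_real_derivative (\<Sum>n. U (Suc 0) n x)) (at x)" for x
    by (rule has_field_derivative_series'(2)[of UNIV "U 0" "U (Suc 0)" 0 x]) (use u s Suc.prems(1)[of 0] in auto)
  moreover have "Ck_on r (\<lambda>x. \<Sum>n. U (Suc 0) n x) UNIV"
    using Suc.IH[of "\<lambda>i. U (Suc i)" "\<lambda>i. M (Suc i)"] Suc.prems by simp
  ultimately show ?case by (rule Ck_on_SucI)
qed

text \<open>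
  The definition of \<open>nth_deriv_exists\<close> takes off the outermost derivative. This lemma and its
  converses take off the innermost one, as needed for inductions along \<open>Ck_on\<close> and for Taylor
  expansion.
\<close>

lemma nth_deriv_exists_SucI:
  "(\<forall>\<^sub>F y in nhds x. f differentiable (at y)) \<Longrightarrow> nth_deriv_exists n (deriv f) x \<Longrightarrow> nth_deriv_exists (Suc n) f x"
proof (induction n arbitrary: x)
  case 0
  have "nth_deriv_exists 0 f = (\<lambda>_. True)" by (simp add: fun_eq_iff)
  then show ?case using eventually_nhds_x_imp_x[OF 0(1)] by simp
next
  case (Suc n)
  have "\<forall>\<^sub>F y in nhds x. \<forall>\<^sub>F z in nhds y. f differentiable (at z)"
    using Suc.prems(1) by (simp add: eventually_eventually)
  moreover have "\<forall>\<^sub>F y in nhds x. nth_deriv_exists n (deriv f) y" using Suc.prems(2) by simp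
  ultimately have "\<forall>\<^sub>F y in nhds x. nth_deriv_exists (Suc n) f y"
    by eventually_elim (rule Suc.IH)
  moreover have "(deriv ^^ Suc n) f differentiable (at x)"
    using Suc.prems(2) by (simp only: nth_deriv_exists.simps funpow_Suc_right o_apply)
  ultimately show ?case by (subst nth_deriv_exists.simps(2)) blast
qed

lemma nth_deriv_exists_SucD: "nth_deriv_exists (Suc n) f x \<Longrightarrow> nth_deriv_exists n (deriv f) x"
proof (induction n arbitrary: x)
  case (Suc n)
  have "\<forall>\<^sub>F y in nhds x. nth_deriv_exists (Suc n) f y"
    using nth_deriv_exists.simps(2)[THEN iffD1, OF Suc.prems] by blast
  then have "\<forall>\<^sub>F y in nhds x. nth_deriv_exists n (deriv f) y" by eventually_elim (rule Suc.IH)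
  moreover have "(deriv ^^ n) (deriv f) differentiable (at x)"
    using Suc.prems by (simp only: nth_deriv_exists.simps funpow_Suc_right o_apply)
  ultimately show ?case by simp
qed simp

lemma nth_deriv_exists_differentiable: "nth_deriv_exists (Suc n) f x \<Longrightarrow> f differentiable (at x)"
proof (induction n arbitrary: x)
  case (Suc n)
  have "\<forall>\<^sub>F y in nhds x. nth_deriv_exists (Suc n) f y"
    using nth_deriv_exists.simps(2)[THEN iffD1, OF Suc.prems] by blast
  then show ?case using Suc.IH by (blast dest: eventually_nhds_x_imp_x)
qed simp

lemma Ck_on_imp_nth_deriv:
  assumes "open S" "Ck_on r f S" "j \<le> r"
  shows "(\<forall>x\<in>S. nth_deriv_exists j f x) \<and> continuous_on S ((deriv ^^ j) f)"
  using assms(2,3)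
proof (induction r arbitrary: f j)
  case 0
  then show ?case by simp
next
  case (Suc r)
  show ?case
  proof (cases j)
    case 0
    then show ?thesis using Ck_on_continuous[OF Suc.prems(1)] by simp
  next
    case (Suc k)
    obtain g where g: "\<And>x. x \<in> S \<Longrightarrow> (f has_real_derivative g x) (at x)" "Ck_on r g S"
      using Suc.prems(1) by auto
    have "Ck_on r (deriv f) S" by (rule Ck_on_cong[OF assms(1) g(2)]) (simp add: DERIV_imp_deriv[OF g(1)])
    from Suc.IH[OF this, of k] have k: "\<forall>x\<in>S. nth_deriv_exists k (deriv f) x" "continuous_on S ((deriv ^^ k) (deriv f))"
      using Suc.prems(2) \<open>j = Suc k\<close> by auto
    have "\<forall>\<^sub>F y in nhds x. f differentiable (at y)" if "x \<in> S" for x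
      using eventually_nhds_in_open[OF assms(1) that]
      by eventually_elim (use g(1) real_differentiable_def in blast)
    then show ?thesis unfolding \<open>j = Suc k\<close> using k nth_deriv_exists_SucI by (auto simp only: funpow_Suc_right o_apply)
  qed
qed

lemma Ck_on_imp_C_diff_on:
  assumes "open S" "Ck_on r f S"
  shows "f \<in> C_diff_on r S"
  unfolding C_diff_on_def using Ck_on_imp_nth_deriv[OF assms] by blast

lemma poly_antiderivative: "\<exists>p. pderiv p = q \<and> poly p 0 = c \<and> degree p \<le> Suc (degree q)" for q :: "real poly"
proof -
  define r where "r = (\<Sum>i\<le>degree q. monom (coeff q i / (real i + 1)) i)"
  have r: "coeff r n = coeff q n / (real n + 1)" for n
    by (cases "n \<le> degree q") (auto simp: r_def coeff_sum coeff_eq_0)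
  have "coeff (pderiv (pCons c r)) n = coeff q n" for n
  proof -
    have "real n + 1 \<noteq> 0" by linarith
    then show ?thesis by (simp add: coeff_pderiv r add.commute)
  qed
  then have "pderiv (pCons c r) = q" by (rule poly_eqI)
  moreover have "degree r \<le> degree q"
    by (rule degree_le) (simp add: r coeff_eq_0)
  then have "degree (pCons c r) \<le> Suc (degree q)"
    by (rule order.trans[OF degree_pCons_le, OF Suc_le_mono[THEN iffD2]])
  ultimately show ?thesis by (intro exI[of _ "pCons c r"]) simp
qed

text \<open>
  For a remainder \<open>o(h\<^sup>n)\<close> the derivative of order \<open>n\<close> at the point itself is
  enough. The expansion of the derivative is integrated, the remainder being controlled by the mean value
  theorem.
\<close>

lemma Peano_expansion:
  assumes "nth_deriv_exists n f x" "n \<ge> 1"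
  shows "\<exists>p. degree p \<le> n \<and> poly p 0 = f x \<and>
    (\<forall>\<epsilon>>0. \<exists>\<delta>>0. \<forall>h. \<bar>h\<bar> < \<delta> \<longrightarrow> \<bar>f (x + h) - poly p h\<bar> \<le> \<epsilon> * \<bar>h\<bar> ^ n)"
  using assms(2,1)
proof (induction n arbitrary: f rule: dec_induct)
  case base
  then have "f differentiable (at x)" by simp
  then obtain D where "(f has_real_derivative D) (at x)" by (auto simp: real_differentiable_def)
  then have lim: "((\<lambda>h. (f (x + h) - f x) / h) \<longlongrightarrow> D) (at 0)" by (simp add: DERIV_def)
  have "\<exists>\<delta>>0. \<forall>h. \<bar>h\<bar> < \<delta> \<longrightarrow> \<bar>f (x + h) - poly [:f x, D:] h\<bar> \<le> \<epsilon> * \<bar>h\<bar> ^ 1" if "\<epsilon> > 0" for \<epsilon>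
  proof -
    obtain \<delta> where \<delta>: "\<delta> > 0" "\<And>h. h \<noteq> 0 \<Longrightarrow> \<bar>h\<bar> < \<delta> \<Longrightarrow> \<bar>(f (x + h) - f x) / h - D\<bar> < \<epsilon>"
      using lim[unfolded LIM_def, rule_format, OF \<open>\<epsilon> > 0\<close>] by (auto simp: dist_real_def)
    have "\<bar>f (x + h) - poly [:f x, D:] h\<bar> \<le> \<epsilon> * \<bar>h\<bar> ^ 1" if "\<bar>h\<bar> < \<delta>" for h
    proof (cases "h = 0")
      case False
      have "f (x + h) - poly [:f x, D:] h = ((f (x + h) - f x) / h - D) * h"
        using False by (simp add: field_simps)
      then show ?thesis using \<delta>(2)[OF False that] by (simp add: abs_mult mult_right_mono)
    qed simp
    then show ?thesis using \<delta>(1) by blast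
  qed
  then show ?case by (intro exI[of _ "[:f x, D:]"]) auto
next
  case (step n)
  obtain q where q: "degree q \<le> n" "poly q 0 = deriv f x"
    "\<And>\<epsilon>. \<epsilon> > 0 \<Longrightarrow> \<exists>\<delta>>0. \<forall>h. \<bar>h\<bar> < \<delta> \<longrightarrow> \<bar>deriv f (x + h) - poly q h\<bar> \<le> \<epsilon> * \<bar>h\<bar> ^ n"
    using step.IH[OF nth_deriv_exists_SucD[OF step.prems]] by blast
  obtain p where p: "pderiv p = q" "poly p 0 = f x" "degree p \<le> Suc (degree q)"
    using poly_antiderivative[of q "f x"] by blast
  obtain m where m: "n = Suc m" using step.hyps by (cases n) auto
  have "\<forall>\<^sub>F y in nhds x. f differentiable (at y)"
    using step.prems unfolding m nth_deriv_exists.simps(2)[of "Suc m"]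
    by (elim conjE eventually_mono) (rule nth_deriv_exists_differentiable)
  then obtain \<delta>0 where \<delta>0: "\<delta>0 > 0" "\<And>y. dist y x < \<delta>0 \<Longrightarrow> f differentiable (at y)"
    unfolding eventually_nhds_metric by blast
  have "\<exists>\<delta>>0. \<forall>h. \<bar>h\<bar> < \<delta> \<longrightarrow> \<bar>f (x + h) - poly p h\<bar> \<le> \<epsilon> * \<bar>h\<bar> ^ Suc n" if "\<epsilon> > 0" for \<epsilon>
  proof -
    obtain \<delta>1 where \<delta>1: "\<delta>1 > 0" "\<And>h. \<bar>h\<bar> < \<delta>1 \<Longrightarrow> \<bar>deriv f (x + h) - poly q h\<bar> \<le> \<epsilon> * \<bar>h\<bar> ^ n"
      using q(3)[OF \<open>\<epsilon> > 0\<close>] by blast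
    define u where "u h = f (x + h) - poly p h" for h
    have Du: "(u has_real_derivative deriv f (x + h) - poly q h) (at h)" if "\<bar>h\<bar> < \<delta>0" for h
    proof -
      have "(f has_real_derivative deriv f (x + h)) (at (x + h))"
        using \<delta>0(2)[of "x + h"] that by (simp add: dist_real_def DERIV_deriv_iff_real_differentiable)
      then have "((\<lambda>h. f (x + h)) has_real_derivative deriv f (x + h)) (at h)"
        using DERIV_shift[of f "deriv f (x + h)" h x] by (simp add: add.commute)
      then show ?thesis unfolding u_def p(1)[symmetric] by (intro DERIV_diff poly_DERIV)
    qed
    have "\<bar>u h\<bar> \<le> \<epsilon> * \<bar>h\<bar> ^ Suc n" if h: "\<bar>h\<bar> < min \<delta>0 \<delta>1" for h
    proof -
      have "norm (u h - u 0) \<le> \<epsilon> * \<bar>h\<bar> ^ n * norm (h - 0)"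
      proof (rule field_differentiable_bound[where S = "{-\<bar>h\<bar>..\<bar>h\<bar>}"])
        fix y assume "y \<in> {-\<bar>h\<bar>..\<bar>h\<bar>}"
        then have y: "\<bar>y\<bar> \<le> \<bar>h\<bar>" by auto
        show "(u has_field_derivative deriv f (x + y) - poly q y) (at y within {-\<bar>h\<bar>..\<bar>h\<bar>})"
          by (rule has_field_derivative_at_within[OF Du]) (use y h in auto)
        have "\<bar>deriv f (x + y) - poly q y\<bar> \<le> \<epsilon> * \<bar>y\<bar> ^ n" by (rule \<delta>1(2)) (use y h in auto)
        also have "\<dots> \<le> \<epsilon> * \<bar>h\<bar> ^ n" using y \<open>\<epsilon> > 0\<close> by (intro mult_left_mono power_mono) auto
        finally show "norm (deriv f (x + y) - poly q y) \<le> \<epsilon> * \<bar>h\<bar> ^ n" by simp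
      qed auto
      moreover have "u 0 = 0" by (simp add: u_def p(2))
      ultimately show ?thesis by (simp add: mult_ac)
    qed
    then show ?thesis unfolding u_def using \<delta>0(1) \<delta>1(1) by (intro exI[of _ "min \<delta>0 \<delta>1"]) auto
  qed
  then show ?case using p q(1) by (intro exI[of _ p]) auto
qed

text \<open>
  The difference of order \<open>r\<close> with step 1, based at 0, with the sign \<open>(-1)\<^sup>r\<close>.
\<close>

definition fdiff :: "nat \<Rightarrow> (real \<Rightarrow> real) \<Rightarrow> real" where
  "fdiff r a = (\<Sum>i\<le>r. (-1) ^ i * real (r choose i) * a (real i))"

lemma fdiff_Suc: "fdiff (Suc r) a = fdiff r (\<lambda>x. a x - a (x + 1))"
proof -
  have "fdiff (Suc r) a = a 0 + (\<Sum>i\<le>r. (-1) ^ Suc i * real (Suc r choose Suc i) * a (real (Suc i)))"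
    unfolding fdiff_def by (subst sum.atMost_Suc_shift) simp
  also have "(\<Sum>i\<le>r. (-1) ^ Suc i * real (Suc r choose Suc i) * a (real (Suc i))) =
     (\<Sum>i\<le>r. (-1) ^ Suc i * real (r choose Suc i) * a (real (Suc i))) - (\<Sum>i\<le>r. (-1) ^ i * real (r choose i) * a (real i + 1))"
    unfolding sum_subtractf[symmetric] by (intro sum.cong refl) (simp add: algebra_simps)
  also have "a 0 + (\<dots>) = (a 0 + (\<Sum>i\<le>r. (-1) ^ Suc i * real (r choose Suc i) * a (real (Suc i)))) - (\<Sum>i\<le>r. (-1) ^ i * real (r choose i) * a (real i + 1))"
    by simp
  also have "a 0 + (\<Sum>i\<le>r. (-1) ^ Suc i * real (r choose Suc i) * a (real (Suc i))) = (\<Sum>i\<le>Suc r. (-1) ^ i * real (r choose i) * a (real i))"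
    by (subst sum.atMost_Suc_shift) simp
  also have "\<dots> = (\<Sum>i\<le>r. (-1) ^ i * real (r choose i) * a (real i))" by simp
  finally show ?thesis by (simp add: fdiff_def right_diff_distrib sum_subtractf)
qed

lemma fdiff_poly_eq_0:
  assumes "degree p < r"
  shows "fdiff r (poly p) = 0"
  using assms
proof (induction r arbitrary: p)
  case (Suc r)
  define q where "q = p - pcompose p [:1, 1:]"
  have q: "poly q x = poly p x - poly p (x + 1)" for x by (simp add: q_def poly_pcompose add.commute)
  have "fdiff r (poly q) = 0"
  proof (cases "degree p = 0")
    case True
    then obtain c where "p = [:c:]" by (auto elim: degree_eq_zeroE)
    then show ?thesis by (simp add: q_def fdiff_def)
  next
    case False
    have d: "degree (pcompose p [:1, 1:]) = degree p" by (simp add: degree_pcompose)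
    have "lead_coeff (pcompose p [:1, 1:]) = lead_coeff p" by (subst lead_coeff_comp) auto
    then have top: "coeff q (degree p) = 0" using d by (simp add: q_def)
    have "degree q \<le> degree p" unfolding q_def using d by (intro degree_diff_le) auto
    moreover have "degree q \<noteq> degree p"
    proof
      assume eq: "degree q = degree p"
      then have "q = 0" using top by (metis leading_coeff_0_iff)
      then show False using eq False by simp
    qed
    ultimately have "degree q < degree p" by simp
    then show ?thesis using Suc by auto
  qed
  then show ?case unfolding fdiff_Suc q[symmetric] .
qed simp

text \<open>
  Boundedness of the difference quotients of order \<open>r\<close> at \<open>x\<close>: a necessary condition
  for the existence of the derivative of order \<open>r\<close> which can be tested on a series term by term.
  The shift \<open>c\<close> distinguishes forward (\<open>c = 0\<close>) from central
  (\<open>c = r / 2\<close>) differences.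
\<close>

definition bounded_diff :: "nat \<Rightarrow> real \<Rightarrow> (real \<Rightarrow> real) \<Rightarrow> real \<Rightarrow> bool" where
  "bounded_diff r c f x \<longleftrightarrow> (\<exists>B. \<exists>\<delta>>0. \<forall>h. 0 < h \<and> h < \<delta> \<longrightarrow> \<bar>fdiff r (\<lambda>i. f (x + (i - c) * h))\<bar> \<le> B * h ^ r)"

lemma fdiff_add: "fdiff r (\<lambda>i. a i + b i) = fdiff r a + fdiff r b"
  by (simp add: fdiff_def distrib_left sum.distrib)

lemma fdiff_cmult: "fdiff r (\<lambda>i. c * a i) = c * fdiff r a"
  by (simp add: fdiff_def sum_distrib_left mult_ac)

lemma fdiff_abs_le:
  assumes "\<And>i. i \<le> r \<Longrightarrow> \<bar>a (real i)\<bar> \<le> M"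
  shows "\<bar>fdiff r a\<bar> \<le> 2 ^ r * M"
proof -
  have "\<bar>fdiff r a\<bar> \<le> (\<Sum>i\<le>r. \<bar>(-1) ^ i * real (r choose i) * a (real i)\<bar>)" unfolding fdiff_def by (rule sum_abs)
  also have "\<dots> \<le> (\<Sum>i\<le>r. real (r choose i) * M)"
    using assms by (intro sum_mono) (auto simp: abs_mult power_abs intro!: mult_left_mono)
  also have "\<dots> = real (\<Sum>i\<le>r. r choose i) * M" by (simp add: sum_distrib_right)
  also have "\<dots> = 2 ^ r * M" by (simp add: choose_row_sum)
  finally show ?thesis .
qed

lemma bounded_diff_add:
  assumes "bounded_diff r c f x" "bounded_diff r c g x"
  shows "bounded_diff r c (\<lambda>y. f y + g y) x"
proof -
  obtain B1 \<delta>1 B2 \<delta>2 where 1: "\<delta>1 > 0" "\<And>h. 0 < h \<Longrightarrow> h < \<delta>1 \<Longrightarrow> \<bar>fdiff r (\<lambda>i. f (x + (i - c) * h))\<bar> \<le> B1 * h ^ r"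
    "\<delta>2 > 0" "\<And>h. 0 < h \<Longrightarrow> h < \<delta>2 \<Longrightarrow> \<bar>fdiff r (\<lambda>i. g (x + (i - c) * h))\<bar> \<le> B2 * h ^ r"
    using assms unfolding bounded_diff_def by blast
  have "\<bar>fdiff r (\<lambda>i. f (x + (i - c) * h) + g (x + (i - c) * h))\<bar> \<le> (B1 + B2) * h ^ r" if "0 < h" "h < min \<delta>1 \<delta>2" for h
    unfolding fdiff_add distrib_right using 1(2)[of h] 1(4)[of h] that by simp
  then show ?thesis unfolding bounded_diff_def using 1(1,3) by (intro exI[of _ "B1 + B2"] exI[of _ "min \<delta>1 \<delta>2"]) auto
qed

lemma bounded_diff_small:
  assumes "\<delta> > 0" "\<And>y. \<bar>y\<bar> < \<delta> \<Longrightarrow> \<bar>f (x + y)\<bar> \<le> K * \<bar>y\<bar> ^ r" "K \<ge> 0"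
  shows "bounded_diff r c f x"
proof -
  define m where "m = real r + \<bar>c\<bar> + 1"
  have m: "m > 0" by (simp add: m_def add_nonneg_pos)
  have "\<bar>fdiff r (\<lambda>i. f (x + (i - c) * h))\<bar> \<le> 2 ^ r * (K * m ^ r) * h ^ r" if h: "0 < h" "h < \<delta> / m" for h
  proof -
    have "\<bar>f (x + (real i - c) * h)\<bar> \<le> K * (m * h) ^ r" if "i \<le> r" for i
    proof -
      have "\<bar>real i - c\<bar> \<le> m" using that by (simp add: m_def)
      then have le: "\<bar>(real i - c) * h\<bar> \<le> m * h" using h(1) by (simp add: abs_mult mult_right_mono)
      moreover have "m * h < \<delta>" using h(2) m by (simp add: field_simps)
      ultimately have "\<bar>f (x + (real i - c) * h)\<bar> \<le> K * \<bar>(real i - c) * h\<bar> ^ r" by (intro assms(2)) linarith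
      also have "\<dots> \<le> K * (m * h) ^ r" using le assms(3) by (intro mult_left_mono power_mono) auto
      finally show ?thesis .
    qed
    from fdiff_abs_le[of r "\<lambda>i. f (x + (i - c) * h)", OF this]
    show ?thesis by (simp add: power_mult_distrib mult_ac)
  qed
  then show ?thesis unfolding bounded_diff_def using assms(1) m
    by (intro exI[of _ "2 ^ r * (K * m ^ r)"] exI[of _ "\<delta> / m"]) auto
qed

lemma bounded_diff_poly:
  assumes "degree p \<le> r"
  shows "bounded_diff r c (\<lambda>y. poly p (y - x)) x"
proof -
  define B where "B = \<bar>coeff p r * fdiff r (\<lambda>i. (i - c) ^ r)\<bar>"
  have "\<bar>fdiff r (\<lambda>i. poly p (x + (i - c) * h - x))\<bar> \<le> B * h ^ r" if "0 < h" for h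
  proof -
    define q where "q = (p - monom (coeff p r) r)"
    have dq: "degree q < r \<or> q = 0"
    proof (cases "r = 0")
      case True
      then have "degree p = 0" using assms by simp
      then show ?thesis using True by (auto simp: q_def monom_0 elim!: degree_eq_zeroE)
    next
      case False
      have "coeff q r = 0" by (simp add: q_def)
      moreover have "degree q \<le> r" unfolding q_def using assms by (intro degree_diff_le) (auto intro: degree_monom_le)
      ultimately show ?thesis using False by (metis degree_0 eq_zero_or_degree_less le_neq_implies_less leading_coeff_0_iff)
    qed
    have "fdiff r (poly (pcompose q [:- c * h, h:])) = 0"
    proof (cases "q = 0")
      case True
      then show ?thesis by (simp add: fdiff_def)
    next
      case False
      then show ?thesis using dq \<open>0 < h\<close> by (intro fdiff_poly_eq_0) (simp add: degree_pcompose)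
    qed
    moreover have "poly p (x + (i - c) * h - x) = poly (pcompose q [:- c * h, h:]) i + coeff p r * h ^ r * (i - c) ^ r" for i
    proof -
      have e: "- c * h + i * h = (i - c) * h" by (simp add: algebra_simps)
      have "poly (pcompose q [:- c * h, h:]) i = poly q ((i - c) * h)"
        unfolding poly_pcompose by (simp add: e[symmetric])
      then show ?thesis by (simp add: q_def poly_monom power_mult_distrib)
    qed
    ultimately have "fdiff r (\<lambda>i. poly p (x + (i - c) * h - x)) = coeff p r * h ^ r * fdiff r (\<lambda>i. (i - c) ^ r)"
      by (simp only: fdiff_add fdiff_cmult)
    then show ?thesis using that by (simp add: B_def abs_mult)
  qed
  then show ?thesis unfolding bounded_diff_def by (intro exI[of _ B] exI[of _ 1]) auto
qed

lemma nth_deriv_bounded_diff: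
  assumes "nth_deriv_exists r f x" "r \<ge> 1"
  shows "bounded_diff r c f x"
proof -
  obtain p where p: "degree p \<le> r" "\<exists>\<delta>>0. \<forall>h. \<bar>h\<bar> < \<delta> \<longrightarrow> \<bar>f (x + h) - poly p h\<bar> \<le> 1 * \<bar>h\<bar> ^ r"
    using Peano_expansion[OF assms] zero_less_one by blast
  then obtain \<delta> where \<delta>: "\<delta> > 0" "\<And>h. \<bar>h\<bar> < \<delta> \<Longrightarrow> \<bar>f (x + h) - poly p h\<bar> \<le> 1 * \<bar>h\<bar> ^ r" by blast
  have "bounded_diff r c (\<lambda>y. f y - poly p (y - x)) x"
    by (rule bounded_diff_small[OF \<delta>(1), of _ _ 1]) (use \<delta>(2) in auto)
  from bounded_diff_add[OF this bounded_diff_poly[OF p(1)]] show ?thesis by simp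
qed

text \<open>
  Passage from the angle \<open>\<theta>\<close> to \<open>t = cos \<theta>\<close> near the equator. The Peano
  polynomial is composed with the smooth function \<open>arccos\<close>, and the remainder is preserved because
  \<open>arccos\<close> is Lipschitz at 0.
\<close>

lemma nth_deriv_bounded_diff_arccos:
  assumes "nth_deriv_exists r f (pi / 2)" "r \<ge> 1"
  shows "bounded_diff r c (\<lambda>t. f (arccos t)) 0"
proof -
  obtain p where p: "\<exists>\<delta>>0. \<forall>h. \<bar>h\<bar> < \<delta> \<longrightarrow> \<bar>f (pi / 2 + h) - poly p h\<bar> \<le> 1 * \<bar>h\<bar> ^ r"
    using Peano_expansion[OF assms] zero_less_one by blast
  then obtain \<delta> where \<delta>: "\<delta> > 0" "\<And>h. \<bar>h\<bar> < \<delta> \<Longrightarrow> \<bar>f (pi / 2 + h) - poly p h\<bar> \<le> 1 * \<bar>h\<bar> ^ r" by blast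
  have "Ck_on r (\<lambda>t. poly p (arccos t - pi / 2)) {-1<..<1}"
    by (intro Ck_on_poly Ck_on_diff Ck_on_arccos Ck_on_const)
  from Ck_on_imp_nth_deriv[OF open_greaterThanLessThan this order.refl]
  have "nth_deriv_exists r (\<lambda>t. poly p (arccos t - pi / 2)) 0" by simp
  then have main: "bounded_diff r c (\<lambda>t. poly p (arccos t - pi / 2)) 0"
    using assms(2) by (rule nth_deriv_bounded_diff)
  have "(arccos has_real_derivative - 1) (at 0)" using DERIV_arccos[of 0] by simp
  then have lim: "((\<lambda>t. (arccos (0 + t) - arccos 0) / t) \<longlongrightarrow> - 1) (at 0)" unfolding DERIV_def .
  then obtain \<eta> where \<eta>: "\<eta> > 0" "\<And>t. t \<noteq> 0 \<Longrightarrow> \<bar>t\<bar> < \<eta> \<Longrightarrow> \<bar>(arccos t - pi / 2) / t + 1\<bar> < 1"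
    using LIM_D[OF lim, of 1] by auto
  have lip: "\<bar>arccos t - pi / 2\<bar> \<le> 2 * \<bar>t\<bar>" if "\<bar>t\<bar> < \<eta>" for t
  proof (cases "t = 0")
    case False
    then have "\<bar>(arccos t - pi / 2) / t\<bar> \<le> 2" using \<eta>(2)[OF False that] by linarith
    then show ?thesis using False by (simp add: abs_divide divide_le_eq)
  qed simp
  have "bounded_diff r c (\<lambda>t. f (arccos t) - poly p (arccos t - pi / 2)) 0"
  proof (rule bounded_diff_small[of "min \<eta> (\<delta> / 2)" _ _ "2 ^ r"])
    fix t :: real assume t: "\<bar>t\<bar> < min \<eta> (\<delta> / 2)"
    then have "\<bar>arccos t - pi / 2\<bar> < \<delta>" using lip[of t] by simp
    from \<delta>(2)[OF this] have "\<bar>f (arccos t) - poly p (arccos t - pi / 2)\<bar> \<le> \<bar>arccos t - pi / 2\<bar> ^ r" by simp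
    also have "\<dots> \<le> (2 * \<bar>t\<bar>) ^ r" using lip[of t] t by (intro power_mono) auto
    finally show "\<bar>f (arccos (0 + t)) - poly p (arccos (0 + t) - pi / 2)\<bar> \<le> 2 ^ r * \<bar>t\<bar> ^ r"
      by (simp add: power_mult_distrib)
  qed (use \<eta> \<delta> in auto)
  from bounded_diff_add[OF this main] show ?thesis by simp
qed

section \<open>Regularity on odd-dimensional spheres\<close>

text \<open>
  Two differences multiply \<open>cos\<close> by a constant and shift its phase.
\<close>

lemma fdiff_cos:
  "fdiff (2 * k) (\<lambda>i. cos (\<phi> + i * y)) = (- 4 * (sin (y / 2))\<^sup>2) ^ k * cos (\<phi> + real k * y)"
proof (induction k arbitrary: \<phi>)
  case 0
  then show ?case by (simp add: fdiff_def)
next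
  case (Suc k)
  have "cos (\<phi> + i * y) - cos (\<phi> + (i + 1) * y) - (cos (\<phi> + (i + 1) * y) - cos (\<phi> + (i + 1 + 1) * y)) =
     - 4 * (sin (y / 2))\<^sup>2 * cos ((\<phi> + y) + i * y)" for i
  proof -
    let ?z = "\<phi> + y + i * y"
    have a: "\<phi> + i * y = ?z - y" "\<phi> + (i + 1) * y = ?z" "\<phi> + (i + 1 + 1) * y = ?z + y"
      by (simp_all add: algebra_simps)
    have c: "cos y = 1 - 2 * (sin (y / 2))\<^sup>2" using cos_double_sin[of "y / 2"] by simp
    show ?thesis unfolding a cos_add[of ?z y] cos_diff[of ?z y] c by (simp add: algebra_simps)
  qed
  then have "fdiff (2 * Suc k) (\<lambda>i. cos (\<phi> + i * y)) = - 4 * (sin (y / 2))\<^sup>2 * fdiff (2 * k) (\<lambda>i. cos ((\<phi> + y) + i * y))"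
    by (simp only: mult_Suc_right numeral_2_eq_2 add_Suc add_0 fdiff_Suc fdiff_cmult)
  also have "\<dots> = (- 4 * (sin (y / 2))\<^sup>2) ^ Suc k * cos (\<phi> + real (Suc k) * y)"
    unfolding Suc by (simp add: algebra_simps)
  finally show ?case .
qed

lemma fdiff_sum: "fdiff r (\<lambda>i. \<Sum>l\<in>A. a l i) = (\<Sum>l\<in>A. fdiff r (a l))"
  unfolding fdiff_def sum_distrib_left by (rule sum.swap)

text \<open>
  In the cosine expansion of \<open>P\<^sub>n (cos \<theta>)\<close> the central differences at 0 of all terms
  have the sign \<open>(-1)\<^sup>k\<close>.
\<close>

lemma fdiff_Geg_cos:
  assumes "\<And>u. poly (Geg e n) u = (\<Sum>l\<le>n. \<alpha> l * poly (Geg 0 l) u)"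
  shows "(-1) ^ k * fdiff (2 * k) (\<lambda>i. zonal e n ((i - real k) * h)) =
     (\<Sum>l\<le>n. \<alpha> l * (4 * (sin (real l * h / 2))\<^sup>2) ^ k)"
proof -
  have "fdiff (2 * k) (\<lambda>i. zonal e n ((i - real k) * h)) =
    (\<Sum>l\<le>n. \<alpha> l * fdiff (2 * k) (\<lambda>i. cos (- (real k * (real l * h)) + i * (real l * h))))"
    unfolding assms Geg_0_cos fdiff_sum fdiff_cmult by (simp add: algebra_simps)
  also have "\<dots> = (\<Sum>l\<le>n. \<alpha> l * (- 4 * (sin (real l * h / 2))\<^sup>2) ^ k)"
    by (simp only: fdiff_cos) simp
  also have "\<dots> = (-1) ^ k * (\<Sum>l\<le>n. \<alpha> l * (4 * (sin (real l * h / 2))\<^sup>2) ^ k)"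
  proof -
    have "(- 4 * x) ^ k = (-1) ^ k * (4 * x) ^ k" for x :: real
      using power_mult_distrib[of "-1" "4 * x" k] by simp
    then show ?thesis by (simp only: sum_distrib_left mult.left_commute)
  qed
  finally have eq: "fdiff (2 * k) (\<lambda>i. zonal e n ((i - real k) * h)) =
    (-1) ^ k * (\<Sum>l\<le>n. \<alpha> l * (4 * (sin (real l * h / 2))\<^sup>2) ^ k)" .
  have "(-1) ^ k * ((-1) ^ k * (\<Sum>l\<le>n. \<alpha> l * (4 * (sin (real l * h / 2))\<^sup>2) ^ k)) =
     (\<Sum>l\<le>n. \<alpha> l * (4 * (sin (real l * h / 2))\<^sup>2) ^ k)"
  proof -
    have "(-1) ^ k * (-1) ^ k = (1 :: real)" by (simp flip: power_mult_distrib)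
    then show ?thesis by (simp only: mult.assoc[symmetric] mult_1)
  qed
  then show ?thesis unfolding eq .
qed

text \<open>
  Both sides are the derivative at 1. On the right it is given by the differential equation, whose leading
  coefficient vanishes there; on the left likewise for \<open>e = 0\<close>.
\<close>

lemma second_moment:
  assumes "\<And>u. poly (Geg e n) u = (\<Sum>l\<le>n. \<alpha> l * poly (Geg 0 l) u)"
  shows "(\<Sum>l\<le>n. \<alpha> l * (real l)\<^sup>2) = real n * (real n + real e) / (real e + 1)"
proof -
  have "real e' + 1 \<noteq> 0" for e' by linarith
  then have D1: "poly (pderiv (Geg e' n')) 1 = real n' * (real n' + real e') / (real e' + 1)" for e' n'
    using Geg_ode[of 1 e' n'] by (simp add: field_simps)
  have "poly (Geg e n) u = poly (\<Sum>l\<le>n. smult (\<alpha> l) (Geg 0 l)) u" for u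
    unfolding assms by (simp add: poly_sum)
  then have "Geg e n = (\<Sum>l\<le>n. smult (\<alpha> l) (Geg 0 l))" by (simp flip: poly_eq_poly_eq_iff add: fun_eq_iff)
  then have "pderiv (Geg e n) = (\<Sum>l\<le>n. smult (\<alpha> l) (pderiv (Geg 0 l)))"
    by (simp add: higher_pderiv_sum[of 1, simplified] pderiv_smult)
  then have "poly (pderiv (Geg e n)) 1 = (\<Sum>l\<le>n. \<alpha> l * poly (pderiv (Geg 0 l)) 1)" by (simp add: poly_sum)
  then show ?thesis unfolding D1 by (simp add: power2_eq_square)
qed

lemma power_sum_le_sum_power:
  fixes \<alpha> x :: "nat \<Rightarrow> real"
  assumes "\<And>l. \<alpha> l \<ge> 0" "(\<Sum>l\<le>n. \<alpha> l) = 1" "\<And>l. x l \<ge> 0"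
  shows "(\<Sum>l\<le>n. \<alpha> l * x l) ^ k \<le> (\<Sum>l\<le>n. \<alpha> l * x l ^ k)"
proof -
  have "convex_on {0..} (\<lambda>x::real. x ^ k)"
  proof (cases "even k")
    case True
    then show ?thesis by (rule convex_on_subset[OF convex_power_even]) auto
  next
    case False
    then show ?thesis by (rule convex_power_odd)
  qed
  from convex_on_sum[OF _ _ this, of "{..n}" \<alpha> x] show ?thesis using assms by simp
qed

text \<open>
  The limit is \<open>\<Sum>l\<le>n. \<alpha> l * l\<^bsup>2k\<^esup>\<close> for the cosine coefficients
  \<open>\<alpha>\<close>, which form a probability distribution. By convexity it is at least the power of the
  second moment.
\<close>

lemma Geg_diff_at_0:
  "\<exists>M. ((\<lambda>h. (-1) ^ k * fdiff (2 * k) (\<lambda>i. zonal e n ((i - real k) * h)) / h ^ (2 * k)) \<longlongrightarrow> M) (at_right 0) \<and>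
    M \<ge> (real n ^ 2 / (real e + 1)) ^ k \<and>
    (\<forall>h. (-1) ^ k * fdiff (2 * k) (\<lambda>i. zonal e n ((i - real k) * h)) \<ge> 0)"
proof -
  obtain \<alpha> where \<alpha>: "\<And>l. \<alpha> l \<ge> 0" "\<And>u. poly (Geg e n) u = (\<Sum>l\<le>n. \<alpha> l * poly (Geg 0 l) u)"
    using Geg_cos_expansion[of e n] by blast
  note eq = fdiff_Geg_cos[OF \<alpha>(2), of k]
  show ?thesis
  proof (intro exI[of _ "\<Sum>l\<le>n. \<alpha> l * ((real l)\<^sup>2) ^ k"] conjI allI)
    have lim: "((\<lambda>h. sin (real l * h / 2) / h) \<longlongrightarrow> real l / 2) (at_right 0)" for l
    proof -
      have "((\<lambda>h. sin (real l * h / 2)) has_real_derivative real l / 2) (at 0)"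
        by (auto intro!: derivative_eq_intros)
      then have "((\<lambda>h. sin (real l * h / 2) / h) \<longlongrightarrow> real l / 2) (at 0)" by (simp add: DERIV_def)
      then show ?thesis by (rule tendsto_mono[OF at_le[OF subset_UNIV]])
    qed
    have "((\<lambda>h. \<Sum>l\<le>n. \<alpha> l * (4 * (sin (real l * h / 2) / h)\<^sup>2) ^ k) \<longlongrightarrow> (\<Sum>l\<le>n. \<alpha> l * (4 * (real l / 2)\<^sup>2) ^ k)) (at_right 0)"
      by (intro tendsto_intros lim)
    also have "(\<Sum>l\<le>n. \<alpha> l * (4 * (real l / 2)\<^sup>2) ^ k) = (\<Sum>l\<le>n. \<alpha> l * ((real l)\<^sup>2) ^ k)"
      by (simp add: power_divide)
    also have "(\<lambda>h. \<Sum>l\<le>n. \<alpha> l * (4 * (sin (real l * h / 2) / h)\<^sup>2) ^ k) =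
      (\<lambda>h. (\<Sum>l\<le>n. \<alpha> l * (4 * (sin (real l * h / 2))\<^sup>2) ^ k) / h ^ (2 * k))"
      by (simp add: power_divide sum_divide_distrib power_mult fun_eq_iff)
    finally show "((\<lambda>h. (-1) ^ k * fdiff (2 * k) (\<lambda>i. zonal e n ((i - real k) * h)) / h ^ (2 * k)) \<longlongrightarrow>
       (\<Sum>l\<le>n. \<alpha> l * ((real l)\<^sup>2) ^ k)) (at_right 0)" unfolding eq .
    have "real n ^ 2 / (real e + 1) \<le> real n * (real n + real e) / (real e + 1)"
      by (intro divide_right_mono) (auto simp: power2_eq_square algebra_simps)
    also have "\<dots> = (\<Sum>l\<le>n. \<alpha> l * (real l)\<^sup>2)" by (rule second_moment[OF \<alpha>(2), symmetric])
    finally have "(real n ^ 2 / (real e + 1)) ^ k \<le> (\<Sum>l\<le>n. \<alpha> l * (real l)\<^sup>2) ^ k" by (intro power_mono) auto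
    also have "\<dots> \<le> (\<Sum>l\<le>n. \<alpha> l * ((real l)\<^sup>2) ^ k)"
      using \<alpha>(1) \<alpha>(2)[of 1] by (intro power_sum_le_sum_power) auto
    finally show "(real n ^ 2 / (real e + 1)) ^ k \<le> (\<Sum>l\<le>n. \<alpha> l * ((real l)\<^sup>2) ^ k)" .
    show "(-1) ^ k * fdiff (2 * k) (\<lambda>i. zonal e n ((i - real k) * h)) \<ge> 0" for h
      unfolding eq using \<alpha>(1) by (intro sum_nonneg mult_nonneg_nonneg) auto
  qed
qed

lemma bounded_diff_cong:
  assumes "bounded_diff r c f x" "\<delta> > 0" "\<And>y. \<bar>y\<bar> < \<delta> \<Longrightarrow> f (x + y) = g (x + y)"
  shows "bounded_diff r c g x"
proof -
  have "bounded_diff r c (\<lambda>z. g z - f z) x"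
    by (rule bounded_diff_small[OF assms(2), of _ _ 0]) (use assms(3) in auto)
  from bounded_diff_add[OF assms(1) this] show ?thesis by simp
qed

lemma fdiff_suminf:
  assumes "\<And>i. i \<le> r \<Longrightarrow> summable (\<lambda>n. a n (real i))"
  shows "summable (\<lambda>n. fdiff r (a n))" "fdiff r (\<lambda>i. \<Sum>n. a n i) = (\<Sum>n. fdiff r (a n))"
proof -
  have s: "summable (\<lambda>n. (-1) ^ i * real (r choose i) * a n (real i))" if "i \<in> {..r}" for i
    using assms that by (intro summable_mult) auto
  show "summable (\<lambda>n. fdiff r (a n))" unfolding fdiff_def by (rule summable_sum[OF s])
  have "(\<Sum>n. fdiff r (a n)) = (\<Sum>i\<le>r. \<Sum>n. (-1) ^ i * real (r choose i) * a n (real i))"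
    unfolding fdiff_def by (rule suminf_sum[OF s])
  also have "\<dots> = fdiff r (\<lambda>i. \<Sum>n. a n i)"
    unfolding fdiff_def using assms by (intro sum.cong refl suminf_mult) auto
  finally show "fdiff r (\<lambda>i. \<Sum>n. a n i) = (\<Sum>n. fdiff r (a n))" ..
qed

text \<open>
  The central difference of the series is a sum of terms of one sign. So each partial sum is bounded by the
  difference quotient of the whole function, and this bound persists as the step tends to 0.
\<close>

lemma moments_summable:
  assumes b: "\<And>n. b n \<ge> 0" "summable b"
    and diff: "bounded_diff (2 * k) (real k) (\<lambda>t. \<Sum>n. b n * zonal e n t) 0"
  shows "summable (\<lambda>n. b n * real n ^ (2 * k))"
proof -
  define D where "D n h = (-1) ^ k * fdiff (2 * k) (\<lambda>i. zonal e n ((i - real k) * h))" for n h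
  have "\<exists>M. ((\<lambda>h. D n h / h ^ (2 * k)) \<longlongrightarrow> M) (at_right 0) \<and> M \<ge> (real n ^ 2 / (real e + 1)) ^ k \<and> (\<forall>h. D n h \<ge> 0)" for n
    unfolding D_def by (rule Geg_diff_at_0)
  then obtain M where M: "\<And>n. ((\<lambda>h. D n h / h ^ (2 * k)) \<longlongrightarrow> M n) (at_right 0)"
    "\<And>n. M n \<ge> (real n ^ 2 / (real e + 1)) ^ k" "\<And>n h. D n h \<ge> 0" by metis
  obtain B \<delta> where B: "\<delta> > 0" "\<And>h. 0 < h \<Longrightarrow> h < \<delta> \<Longrightarrow>
      \<bar>fdiff (2 * k) (\<lambda>i. \<Sum>n. b n * zonal e n (0 + (i - real k) * h))\<bar> \<le> B * h ^ (2 * k)"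
    using diff unfolding bounded_diff_def by blast
  have part: "(\<Sum>n<N. b n * (D n h / h ^ (2 * k))) \<le> B" if h: "0 < h" "h < \<delta>" for h N
  proof -
    have s: "summable (\<lambda>n. b n * zonal e n \<theta>)" for \<theta>
      using Geg_series(1)[OF b, of "e" "\<lambda>n. n"] by simp
    note fs = fdiff_suminf[of "2 * k" "\<lambda>n i. b n * zonal e n (0 + (i - real k) * h)", OF s]
    have sum: "summable (\<lambda>n. b n * D n h)"
      using summable_mult[OF fs(1), of "(-1) ^ k"] by (simp add: fdiff_cmult D_def mult.left_commute)
    have "(\<Sum>n<N. b n * D n h) \<le> (\<Sum>n. b n * D n h)"
      using b M(3) by (intro sum_le_suminf sum) auto
    also have "\<dots> = (-1) ^ k * fdiff (2 * k) (\<lambda>i. \<Sum>n. b n * zonal e n (0 + (i - real k) * h))"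
      unfolding fs(2) by (subst suminf_mult[OF fs(1), symmetric]) (simp add: fdiff_cmult D_def mult.left_commute)
    also have "\<dots> \<le> \<bar>\<dots>\<bar>" by (rule abs_ge_self)
    also have "\<dots> \<le> B * h ^ (2 * k)" using B(2)[OF h] by (simp add: abs_mult power_abs)
    finally have "(\<Sum>n<N. b n * D n h) / h ^ (2 * k) \<le> B" using h by (simp add: divide_le_eq)
    then show ?thesis by (simp add: sum_divide_distrib)
  qed
  have "(\<Sum>n<N. b n * M n) \<le> B" for N
  proof (rule tendsto_upperbound)
    show "((\<lambda>h. \<Sum>n<N. b n * (D n h / h ^ (2 * k))) \<longlongrightarrow> (\<Sum>n<N. b n * M n)) (at_right 0)"
      by (intro tendsto_intros M)
    show "\<forall>\<^sub>F h in at_right 0. (\<Sum>n<N. b n * (D n h / h ^ (2 * k))) \<le> B"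
      using B(1) part unfolding eventually_at_right_field by blast
  qed simp
  moreover have Mn: "0 \<le> M n" for n by (rule order.trans[OF _ M(2)[of n]]) simp
  ultimately have "summable (\<lambda>n. b n * M n)"
    using b by (intro summableI_nonneg_bounded[of _ B]) auto
  then have "summable (\<lambda>n. (real e + 1) ^ k * (b n * M n))" by (rule summable_mult)
  then show ?thesis
  proof (rule summable_comparison_test'[where N = 0])
    fix n :: nat
    have "real n ^ (2 * k) = (real e + 1) ^ k * (real n ^ 2 / (real e + 1)) ^ k"
      by (simp add: power_mult power_divide add_eq_0_iff)
    also have "\<dots> \<le> (real e + 1) ^ k * M n" by (intro mult_left_mono M) auto
    finally have "b n * real n ^ (2 * k) \<le> b n * ((real e + 1) ^ k * M n)" using b by (intro mult_left_mono) auto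
    then show "norm (b n * real n ^ (2 * k)) \<le> (real e + 1) ^ k * (b n * M n)" using b(1)[of n] by (simp add: mult_ac)
  qed
qed

lemma DERIV_cos_shift:
  "((\<lambda>x. c * a ^ i * cos (a * x + real i * (pi / 2))) has_real_derivative
     c * a ^ Suc i * cos (a * x + real (Suc i) * (pi / 2))) (at x)"
proof -
  have "cos (a * x + real (Suc i) * (pi / 2)) = - sin (a * x + real i * (pi / 2))"
  proof -
    have "a * x + real (Suc i) * (pi / 2) = (a * x + real i * (pi / 2)) + pi / 2" by (simp add: algebra_simps)
    then show ?thesis by (simp only: cos_add) simp
  qed
  then show ?thesis by (auto intro!: derivative_eq_intros)
qed

lemma Ck_on_subset: "Ck_on r f S \<Longrightarrow> T \<subseteq> S \<Longrightarrow> Ck_on r f T"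
proof (induction r arbitrary: f)
  case 0
  then show ?case by (auto intro: continuous_on_subset)
next
  case (Suc r)
  from Suc.prems(1) obtain g where g: "\<And>x. x \<in> S \<Longrightarrow> (f has_real_derivative g x) (at x)" "Ck_on r g S"
    by (rule Ck_on_SucE) blast
  show ?case by (rule Ck_on_SucI[OF g(1) Suc.IH[OF g(2)]]) (use Suc.prems(2) in auto)
qed

lemma cos_series_Ck_on:
  assumes b: "\<And>n. b n \<ge> 0" "summable b" "summable (\<lambda>n. b n * real n ^ r)"
  shows "Ck_on r (\<lambda>x. \<Sum>n. b n * cos (real (n + q) * x)) UNIV"
proof -
  define U where "U i n x = b n * real (n + q) ^ i * cos (real (n + q) * x + real i * (pi / 2))" for i n x
  define M where "M i n = b n * real (n + q) ^ i" for i n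
  have "summable (M i)" if "i \<le> r" for i
  proof (rule summable_comparison_test'[where N = 0])
    show "summable (\<lambda>n. b n + 2 ^ r * (b n * real n ^ r + real q ^ r * b n))"
      using b by (intro summable_add summable_mult)
    fix n
    have "real (n + q) ^ i \<le> 1 + real (n + q) ^ r"
    proof (cases "n + q = 0")
      case False
      then have "real (n + q) ^ i \<le> real (n + q) ^ r" using that by (intro power_increasing) auto
      then show ?thesis by simp
    qed (simp add: power_0_left)
    also have "real (n + q) ^ r \<le> 2 ^ r * (real n ^ r + real q ^ r)"
    proof -
      have "real (n + q) ^ r \<le> (2 * max (real n) (real q)) ^ r" by (intro power_mono) auto
      also have "\<dots> = 2 ^ r * max (real n) (real q) ^ r" by (simp add: power_mult_distrib)
      also have "\<dots> \<le> 2 ^ r * (real n ^ r + real q ^ r)" by (intro mult_left_mono) (auto simp: max_def)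
      finally show ?thesis .
    qed
    finally have "b n * real (n + q) ^ i \<le> b n * (1 + 2 ^ r * (real n ^ r + real q ^ r))"
      using b by (intro mult_left_mono) auto
    then show "norm (M i n) \<le> b n + 2 ^ r * (b n * real n ^ r + real q ^ r * b n)"
      using b(1)[of n] by (simp add: M_def algebra_simps)
  qed
  moreover have "\<bar>U i n x\<bar> \<le> M i n" for i n x
  proof -
    have "\<bar>U i n x\<bar> = M i n * \<bar>cos (real (n + q) * x + real i * (pi / 2))\<bar>"
      using b(1)[of n] by (simp add: U_def M_def abs_mult)
    also have "\<dots> \<le> M i n * 1" using b(1)[of n] by (intro mult_left_mono) (auto simp: M_def)
    finally show ?thesis by simp
  qed
  moreover have "(U i n has_real_derivative U (Suc i) n x) (at x)" for i n x
    unfolding U_def by (rule DERIV_cos_shift)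
  ultimately have "Ck_on r (\<lambda>x. \<Sum>n. U 0 n x) UNIV" by (intro Ck_on_suminf[where M = M])
  then show ?thesis by (simp add: U_def)
qed

text \<open>
  The differentiated series of \<open>DERIV_sin_power_Geg\<close>, solved for the derivative of
  \<open>\<psi>\<close>.
\<close>

lemma Geg_series_descent:
  fixes b :: "nat \<Rightarrow> real" and e q :: nat
  assumes b: "\<And>n. b n \<ge> 0" "summable b" and \<theta>: "\<theta> \<in> {0<..<pi}"
  defines "\<psi> \<equiv> \<lambda>\<theta>. \<Sum>n. b n * zonal (e + 2) (n + q) \<theta>"
    and "g \<equiv> \<lambda>\<theta>. \<Sum>n. b n * zonal e (n + Suc q) \<theta>"
  shows "(\<psi> has_real_derivative (real e + 1) * ((g \<theta> - cos \<theta> * \<psi> \<theta>) * inverse (sin \<theta>))) (at \<theta>)"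
proof -
  let ?f = "\<lambda>n \<theta>. b n * (sin \<theta> ^ Suc e * zonal (e + 2) (n + q) \<theta>)"
  let ?f' = "\<lambda>n \<theta>. b n * ((real e + 1) * sin \<theta> ^ e * zonal e (Suc (n + q)) \<theta>)"
  have le: "norm (?f' n \<theta>) \<le> b n * (real e + 1)" for n \<theta>
  proof -
    have "\<bar>sin \<theta>\<bar> ^ e * \<bar>zonal e (Suc (n + q)) \<theta>\<bar> \<le> 1 * 1"
      by (intro mult_mono power_le_one Geg_abs_le_1) auto
    then have "(real e + 1) * (\<bar>sin \<theta>\<bar> ^ e * \<bar>zonal e (Suc (n + q)) \<theta>\<bar>) \<le> (real e + 1) * 1"
      by (intro mult_left_mono) auto
    then have "b n * ((real e + 1) * (\<bar>sin \<theta>\<bar> ^ e * \<bar>zonal e (Suc (n + q)) \<theta>\<bar>)) \<le> b n * ((real e + 1) * 1)"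
      by (rule mult_left_mono[OF _ b(1)])
    then show ?thesis using b(1)[of n] by (simp add: abs_mult power_abs mult.assoc)
  qed
  have "uniform_limit UNIV (\<lambda>N \<theta>. \<Sum>n<N. ?f' n \<theta>) (\<lambda>\<theta>. \<Sum>n. ?f' n \<theta>) sequentially"
    by (rule Weierstrass_m_test[OF le summable_mult2[OF b(2)]])
  then have u: "uniformly_convergent_on UNIV (\<lambda>N \<theta>. \<Sum>n<N. ?f' n \<theta>)"
    by (auto simp: uniformly_convergent_on_def)
  have D: "((\<lambda>\<theta>. \<Sum>n. ?f n \<theta>) has_real_derivative (\<Sum>n. ?f' n \<theta>)) (at \<theta>)"
  proof (rule has_field_derivative_series'(2)[of UNIV _ _ 0])
    show "(?f n has_real_derivative ?f' n x) (at x within UNIV)" for n x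
      by (rule DERIV_cmult[OF DERIV_sin_power_Geg])
  qed (use u in auto)
  have s1: "summable (\<lambda>n. b n * zonal (e + 2) (n + q) x)" for x
    by (rule Geg_series(1)[OF b])
  have s2: "summable (\<lambda>n. b n * zonal e (n + Suc q) x)" for x
    by (rule Geg_series(1)[OF b])
  have f: "(\<Sum>n. ?f n x) = sin x ^ Suc e * \<psi> x" for x
    unfolding \<psi>_def by (subst suminf_mult[OF s1, symmetric]) (simp add: mult_ac)
  have f': "(\<Sum>n. ?f' n x) = (real e + 1) * sin x ^ e * g x" for x
    unfolding g_def by (subst suminf_mult[OF s2, symmetric]) (simp add: mult_ac)
  have D': "((\<lambda>x. sin x ^ Suc e * \<psi> x) has_real_derivative (real e + 1) * sin \<theta> ^ e * g \<theta>) (at \<theta>)"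
    using D unfolding f f' .
  have sin: "sin \<theta> \<noteq> 0" using \<theta> sin_gt_zero[of \<theta>] by auto
  have "((\<lambda>x. (sin x ^ Suc e * \<psi> x) / sin x ^ Suc e) has_real_derivative
     ((real e + 1) * sin \<theta> ^ e * g \<theta> * sin \<theta> ^ Suc e - (sin \<theta> ^ Suc e * \<psi> \<theta>) * ((1 + real e) * (cos \<theta> * sin \<theta> ^ e)))
       / (sin \<theta> ^ Suc e * sin \<theta> ^ Suc e)) (at \<theta>)"
    using DERIV_divide[OF D' DERIV_power_Suc[OF DERIV_sin, of e]] sin by simp
  also have "((real e + 1) * sin \<theta> ^ e * g \<theta> * sin \<theta> ^ Suc e - (sin \<theta> ^ Suc e * \<psi> \<theta>) * ((1 + real e) * (cos \<theta> * sin \<theta> ^ e)))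
       / (sin \<theta> ^ Suc e * sin \<theta> ^ Suc e) = (real e + 1) * ((g \<theta> - cos \<theta> * \<psi> \<theta>) * inverse (sin \<theta>))"
    using sin by (simp add: divide_simps) (simp add: algebra_simps)
  finally show ?thesis
  proof (rule has_field_derivative_transform_within_open[where S = "{0<..<pi}"])
    fix x assume "x \<in> {0<..<pi}"
    then have "sin x \<noteq> 0" using sin_gt_zero[of x] by auto
    then show "sin x ^ Suc e * \<psi> x / sin x ^ Suc e = \<psi> x" by simp
  qed (use \<theta> in auto)
qed

text \<open>
  The derivative of the series \<open>\<psi>\<close> for dimension \<open>2p + 3\<close> is a smooth function of
  \<open>\<theta>\<close>, of \<open>\<psi>\<close> itself and of the series \<open>g\<close> for dimension
  \<open>2p + 1\<close>. So \<open>\<psi>\<close> bootstraps to one derivative more than \<open>g\<close>. The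
  shift \<open>q\<close> of degrees accumulates on the way down to the circle.
\<close>

lemma odd_sphere_series_Ck_on:
  assumes b: "\<And>n. b n \<ge> 0" "summable b" "summable (\<lambda>n. b n * real n ^ r)"
  shows "Ck_on (r + p) (\<lambda>\<theta>. \<Sum>n. b n * zonal (2 * p) (n + q) \<theta>) {0<..<pi}"
proof (induction p arbitrary: q)
  case 0
  have "Ck_on r (\<lambda>x. \<Sum>n. b n * cos (real (n + q) * x)) {0<..<pi}"
    by (rule Ck_on_subset[OF cos_series_Ck_on[OF b]]) simp
  then show ?case by (simp add: Geg_0_cos)
next
  case (Suc p)
  define \<psi> where "\<psi> = (\<lambda>\<theta>. \<Sum>n. b n * zonal (2 * p + 2) (n + q) \<theta>)"
  define g where "g = (\<lambda>\<theta>. \<Sum>n. b n * zonal (2 * p) (n + Suc q) \<theta>)"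
  have g: "Ck_on (r + p) g {0<..<pi}" unfolding g_def by (rule Suc.IH)
  have D: "(\<psi> has_real_derivative (real (2 * p) + 1) * ((g \<theta> - cos \<theta> * \<psi> \<theta>) * inverse (sin \<theta>))) (at \<theta>)"
    if "\<theta> \<in> {0<..<pi}" for \<theta>
    unfolding \<psi>_def g_def by (rule Geg_series_descent[OF b(1,2) that])
  have le: "Ck_on i g {0<..<pi}" if "i \<le> r + p" for i
    using that
  proof (induction rule: inc_induct)
    case base
    show ?case by (rule g)
  next
    case (step n)
    from step(3) show ?case by (rule Ck_on_SucD)
  qed
  have "Ck_on i \<psi> {0<..<pi}" if "i \<le> Suc (r + p)" for i
    using that
  proof (induction i)
    case 0
    show ?case unfolding \<psi>_def using Geg_series(3)[OF b(1,2)] by simp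
  next
    case (Suc i)
    have "Ck_on i (\<lambda>\<theta>. (real (2 * p) + 1) * ((g \<theta> - cos \<theta> * \<psi> \<theta>) * inverse (sin \<theta>))) {0<..<pi}"
      using Suc le[of i] Ck_on_sin_cos by (intro Ck_on_mult Ck_on_diff Ck_on_const Ck_on_inverse_sin) auto
    then show ?case by (intro Ck_on_SucI[OF D]) auto
  qed
  from this[of "Suc (r + p)"] show ?case by (simp add: \<psi>_def)
qed

theorem odd_sphere_regularity:
  assumes \<psi>: "\<psi> \<in> Psi (2 * p + 1)" and diff: "times_differentiable_at (2 * k) (even_cont \<psi>) 0"
  shows "\<psi> \<in> C_diff_on (2 * k + p) {0<..<pi}"
proof -
  have "\<psi> \<in> Psi (Suc (2 * p))" using \<psi> by simp
  from Schoenberg[OF this] obtain b where b: "\<And>n. b n \<ge> 0" "summable b"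
    and series: "\<And>\<theta>. \<theta> \<in> {0..pi} \<Longrightarrow> \<psi> \<theta> = (\<Sum>n. b n * zonal (2 * p) n \<theta>)" by blast
  have "summable (\<lambda>n. b n * real n ^ (2 * k))"
  proof (cases "k = 0")
    case True
    then show ?thesis using b by simp
  next
    case False
    then have "nth_deriv_exists (2 * k) (even_cont \<psi>) 0" using diff by (simp add: times_differentiable_at_def)
    then have "bounded_diff (2 * k) (real k) (even_cont \<psi>) 0"
      using False by (intro nth_deriv_bounded_diff) auto
    then have "bounded_diff (2 * k) (real k) (\<lambda>t. \<Sum>n. b n * zonal (2 * p) n t) 0"
    proof (rule bounded_diff_cong[OF _ pi_gt_zero])
      fix y :: real assume "\<bar>y\<bar> < pi"
      then show "even_cont \<psi> (0 + y) = (\<Sum>n. b n * zonal (2 * p) n (0 + y))"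
        by (simp add: even_cont_def series)
    qed
    then show ?thesis by (rule moments_summable[OF b])
  qed
  from odd_sphere_series_Ck_on[OF b this, of p 0]
  have "Ck_on (2 * k + p) (\<lambda>\<theta>. \<Sum>n. b n * zonal (2 * p) n \<theta>) {0<..<pi}" by simp
  then have "Ck_on (2 * k + p) \<psi> {0<..<pi}"
    by (rule Ck_on_cong[OF open_greaterThanLessThan]) (simp add: series)
  then show ?thesis by (intro Ck_on_imp_C_diff_on open_greaterThanLessThan)
qed

section \<open>Growth at the equator and the gliding hump\<close>

text \<open>
  Each derivative raises \<open>e\<close> by 2 and contributes a factor of order \<open>n\<^sup>2\<close>.
\<close>

lemma higher_pderiv_Geg:
  "\<exists>\<kappa>. (pderiv ^^ r) (Geg e (n + r)) = smult \<kappa> (Geg (e + 2 * r) n) \<and>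
     \<kappa> \<ge> ((real n + 1)\<^sup>2 / (real e + 2 * real r + 1)) ^ r"
proof (induction r arbitrary: e)
  case (Suc r)
  define C where "C = real e + 2 * real (Suc r) + 1"
  define c where "c = (real (n + r) + 1) * (real (n + r) + real e + 1) / (real e + 1)"
  obtain \<kappa> where \<kappa>: "(pderiv ^^ r) (Geg (e + 2) (n + r)) = smult \<kappa> (Geg (e + 2 + 2 * r) n)"
    "\<kappa> \<ge> ((real n + 1)\<^sup>2 / (real (e + 2) + 2 * real r + 1)) ^ r"
    using Suc.IH by blast
  have C: "real (e + 2) + 2 * real r + 1 = C" by (simp add: C_def)
  have "(pderiv ^^ Suc r) (Geg e (n + Suc r)) = (pderiv ^^ r) (pderiv (Geg e (Suc (n + r))))"
    by (simp only: funpow_Suc_right o_apply add_Suc_right)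
  also have "\<dots> = smult (c * \<kappa>) (Geg (e + 2 * Suc r) n)"
    by (simp only: pderiv_Geg higher_pderiv_smult \<kappa>(1) c_def[symmetric] smult_smult) (simp add: algebra_simps)
  finally have eq: "(pderiv ^^ Suc r) (Geg e (n + Suc r)) = smult (c * \<kappa>) (Geg (e + 2 * Suc r) n)" .
  have "(real n + 1)\<^sup>2 \<le> (real (n + r) + 1) * (real (n + r) + real e + 1)"
    unfolding power2_eq_square by (intro mult_mono) auto
  then have "(real n + 1)\<^sup>2 / C \<le> c" unfolding c_def C_def by (intro frac_le) auto
  then have "((real n + 1)\<^sup>2 / C) ^ Suc r \<le> c * \<kappa>"
    using \<kappa>(2) unfolding C power_Suc by (intro mult_mono) (auto simp: c_def C_def)
  then show ?case using eq by (auto simp: C_def)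
qed (auto intro: exI[of _ 1])

text \<open>
  Up to sign the values at 0 are central binomial probabilities, so their squares are of order
  \<open>1 / j\<close>; the product shown is nondecreasing in \<open>j\<close> and equals 1 at the start.
\<close>

lemma Legendre_at_0: "(poly (Geg 1 (2 * Suc j)) 0)\<^sup>2 * (4 * real (Suc j)) \<ge> 1"
proof (induction j)
  case 0
  have "2 * poly (Geg 1 2) 0 = - 1" using Geg_rec[of 0 1 0] by (simp add: numeral_2_eq_2)
  then have "poly (Geg 1 2) 0 = - (1 / 2)" by simp
  then show ?case by (simp add: power2_eq_square)
next
  case (Suc j)
  define N where "N = real (Suc j)"
  let ?a = "poly (Geg 1 (2 * Suc j)) 0" and ?b = "poly (Geg 1 (2 * Suc (Suc j))) 0"
  have N: "N > 0" by (simp add: N_def)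
  have rec: "(2 * N + 2) * ?b = - ((2 * N + 1) * ?a)"
    using Geg_rec[of "2 * Suc j" 1 0] by (simp add: N_def algebra_simps)
  have "(2 * N + 2)\<^sup>2 * ?b\<^sup>2 = (2 * N + 1)\<^sup>2 * ?a\<^sup>2"
    unfolding power_mult_distrib[symmetric] rec by simp
  then have "(2 * N + 2)\<^sup>2 * (?b\<^sup>2 * (4 * (N + 1))) * N = (2 * N + 1)\<^sup>2 * (N + 1) * (?a\<^sup>2 * (4 * N))"
    by (simp add: algebra_simps)
  also have "\<dots> \<ge> (2 * N + 1)\<^sup>2 * (N + 1) * 1" using Suc.IH N by (intro mult_left_mono) (auto simp: N_def)
  finally have "(2 * N + 2)\<^sup>2 * N * (?b\<^sup>2 * (4 * (N + 1))) \<ge> (2 * N + 1)\<^sup>2 * (N + 1)" by (simp add: mult_ac)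
  moreover have "(2 * N + 1)\<^sup>2 * (N + 1) \<ge> (2 * N + 2)\<^sup>2 * N * 1"
    using N by (simp add: power2_eq_square algebra_simps)
  ultimately have "(2 * N + 2)\<^sup>2 * N * 1 \<le> (2 * N + 2)\<^sup>2 * N * (?b\<^sup>2 * (4 * (N + 1)))" by linarith
  then have "1 \<le> ?b\<^sup>2 * (4 * (N + 1))"
    by (rule mult_left_le_imp_le) (use N in simp)
  then show ?case by (simp add: N_def)
qed

text \<open>
  At 0 one of the three terms of \<open>Geg_shift\<close> drops out, so raising \<open>e\<close> by 2 costs at
  most one factor \<open>n\<close>.
\<close>

lemma Geg_odd_at_0: "\<bar>poly (Geg (2 * M + 1) n) 0\<bar> * (real n + 2 * real M + 2) ^ M \<ge> \<bar>poly (Geg 1 (n + 2 * M)) 0\<bar>"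
proof (induction M arbitrary: n)
  case (Suc M)
  define a b where "a = \<bar>poly (Geg (2 * Suc M + 1) n) 0\<bar>" and "b = \<bar>poly (Geg (2 * M + 1) (n + 2)) 0\<bar>"
  define y where "y = real n + 2 * real M + 4"
  have "(real (2 * M + 1) + 1) * poly (Geg (2 * M + 1) (Suc (Suc n))) 0 = - (real n + 1) * poly (Geg (2 * Suc M + 1) n) 0"
    using Geg_shift[of "2 * M + 1" "Suc n" 0] by (simp add: algebra_simps)
  then have "\<bar>(real (2 * M + 1) + 1) * poly (Geg (2 * M + 1) (Suc (Suc n))) 0\<bar> = \<bar>- (real n + 1) * poly (Geg (2 * Suc M + 1) n) 0\<bar>"
    by (rule arg_cong)
  then have eq: "(2 * real M + 2) * b = (real n + 1) * a"
    by (simp add: a_def b_def abs_mult add.commute)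
  have "a \<ge> 0" "b \<ge> 0" by (simp_all add: a_def b_def)
  have "1 * b \<le> (2 * real M + 2) * b" using \<open>b \<ge> 0\<close> by (intro mult_right_mono) auto
  also have "\<dots> \<le> y * a" unfolding eq using \<open>a \<ge> 0\<close> by (intro mult_right_mono) (auto simp: y_def)
  finally have "b * y ^ M \<le> (y * a) * y ^ M" by (intro mult_right_mono) (auto simp: y_def)
  moreover have "\<bar>poly (Geg 1 (n + 2 * Suc M)) 0\<bar> \<le> b * y ^ M"
    using Suc.IH[of "n + 2"] by (simp add: b_def y_def algebra_simps)
  ultimately show ?case by (simp add: a_def y_def algebra_simps)
qed simp

text \<open>
  The coefficient is the derivative of order \<open>r\<close> at 0 over \<open>r!\<close>. The \<open>r\<close>
  derivatives contribute \<open>n\<^bsup>2r\<^esup>\<close>. The value at 0 of the resulting polynomial, for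
  \<open>e + 2r = 2M + 1\<close> with \<open>M = m + r - 1\<close>, contributes
  \<open>n\<^bsup>-M-1/2\<^esup>\<close>. As \<open>2r - M = 2k + 1\<close>, the product is of order
  \<open>n\<^bsup>2k+1/2\<^esup>\<close>.
\<close>

lemma Geg_coeff_growth:
  assumes "m \<ge> 1" and r: "r = 2 * k + m"
  shows "\<exists>n. \<bar>coeff (Geg (2 * m - 1) n) r\<bar> \<ge> B * (real n + 1) ^ (2 * k)"
proof -
  define e where "e = 2 * m - 1"
  define M where "M = m + r - 1"
  have e: "real e + 2 * real r + 1 = 2 * real M + 2" "e + 2 * r = 2 * M + 1"
    using assms by (auto simp: e_def M_def of_nat_diff)
  have M: "2 * r = M + (2 * k + 1)" using assms by (simp add: M_def)
  define C where "C = 2 * real M + 2"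
  have C: "C > 0" by (simp add: C_def)
  \<comment> \<open>The powers of \<open>C\<close> come from \<open>y \<le> (n + 1) C\<close>, used \<open>2r\<close> times,
    and from the \<open>r\<close> denominators in \<open>higher_pderiv_Geg\<close>; the \<open>2\<close> is
    that of the bound \<open>1 / (2 sqrt y)\<close> for the Legendre polynomial.\<close>
  define c where "c = 1 / (C ^ (3 * r) * 2 * fact r)"
  have c: "c > 0" using C by (simp add: c_def)
  have main: "\<bar>coeff (Geg e (2 * j + r)) r\<bar> \<ge> c * sqrt (real (2 * j)) * (real (2 * j + r) + 1) ^ (2 * k)" if j: "j \<ge> 1" for j
  proof -
    define n where "n = 2 * j"
    define y where "y = real n + 2 * real M + 2"
    have y: "y > 0" by (simp add: y_def)
    obtain \<kappa> where \<kappa>: "(pderiv ^^ r) (Geg e (n + r)) = smult \<kappa> (Geg (e + 2 * r) n)"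
      "\<kappa> \<ge> ((real n + 1)\<^sup>2 / (real e + 2 * real r + 1)) ^ r"
      using higher_pderiv_Geg[of r e n] by blast
    have "coeff ((pderiv ^^ r) (Geg e (n + r))) 0 = fact r * coeff (Geg e (n + r)) r"
      by (simp add: coeff_higher_pderiv pochhammer_fact)
    then have eq: "fact r * coeff (Geg e (n + r)) r = \<kappa> * poly (Geg (2 * M + 1) n) 0"
      by (simp add: \<kappa>(1) e(2) poly_0_coeff_0)
    have "y \<le> (real n + 1) * C" by (simp add: y_def C_def algebra_simps)
    then have "y / C \<le> real n + 1" using C by (simp add: divide_le_eq)
    then have "(y / C)\<^sup>2 / C \<le> (real n + 1)\<^sup>2 / C" using y C by (intro divide_right_mono power_mono) auto
    then have "((y / C)\<^sup>2 / C) ^ r \<le> ((real n + 1)\<^sup>2 / C) ^ r" using y C by (intro power_mono) auto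
    moreover have "((y / C)\<^sup>2 / C) ^ r = y ^ (2 * r) / C ^ (3 * r)"
    proof -
      have "(y / C)\<^sup>2 / C = y\<^sup>2 / C ^ 3" by (simp add: power2_eq_square power3_eq_cube)
      then show ?thesis by (simp only: power_divide power_mult[symmetric])
    qed
    ultimately have \<kappa>': "\<kappa> \<ge> y ^ (2 * r) / C ^ (3 * r)"
      using \<kappa>(2) unfolding e C_def[symmetric] by linarith
    have p1: "\<bar>poly (Geg 1 (n + 2 * M)) 0\<bar> \<ge> 1 / (2 * sqrt y)"
    proof -
      obtain j' where j': "j + M = Suc j'" using j by (cases "j + M") auto
      define a where "a = poly (Geg 1 (2 * Suc j')) 0"
      have "1 \<le> a\<^sup>2 * (4 * real (Suc j'))" unfolding a_def by (rule Legendre_at_0)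
      also have "\<dots> \<le> a\<^sup>2 * (4 * y)" using j' by (intro mult_left_mono) (auto simp: y_def n_def)
      also have "\<dots> = (\<bar>a\<bar> * (2 * sqrt y))\<^sup>2" using y by (simp add: power_mult_distrib)
      finally have "1\<^sup>2 \<le> (\<bar>a\<bar> * (2 * sqrt y))\<^sup>2" by simp
      then have "1 \<le> \<bar>a\<bar> * (2 * sqrt y)" by (rule power2_le_imp_le) (use y in auto)
      moreover have "n + 2 * M = 2 * Suc j'" using j' by (simp add: n_def)
      ultimately show ?thesis using y by (simp add: a_def divide_le_eq)
    qed
    have p: "\<bar>poly (Geg (2 * M + 1) n) 0\<bar> \<ge> 1 / (2 * sqrt y) / y ^ M"
    proof -
      have "1 / (2 * sqrt y) \<le> \<bar>poly (Geg (2 * M + 1) n) 0\<bar> * y ^ M"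
        using order.trans[OF p1 Geg_odd_at_0[of n M]] by (simp only: y_def)
      then show ?thesis using y by (simp only: pos_divide_le_eq zero_less_power)
    qed
    have "y ^ (2 * r) / C ^ (3 * r) * (1 / (2 * sqrt y) / y ^ M) \<le> \<kappa> * \<bar>poly (Geg (2 * M + 1) n) 0\<bar>"
    proof (intro mult_mono \<kappa>' p)
      show "0 \<le> \<kappa>" using order.trans[OF _ \<kappa>'] y C by simp
    qed (use y C in auto)
    also have "\<dots> \<le> fact r * \<bar>coeff (Geg e (n + r)) r\<bar>"
      using arg_cong[OF eq, of abs] by (simp add: abs_mult mult_right_mono)
    also have "y ^ (2 * r) / C ^ (3 * r) * (1 / (2 * sqrt y) / y ^ M) = fact r * (c * (sqrt y * y ^ (2 * k)))"
    proof -
      have "y ^ (2 * r) = y ^ M * y ^ (2 * k) * (sqrt y * sqrt y)"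
        unfolding M using y by (simp add: power_add)
      then show ?thesis using y C by (simp add: c_def field_simps)
    qed
    finally have "c * (sqrt y * y ^ (2 * k)) \<le> \<bar>coeff (Geg e (n + r)) r\<bar>" by simp
    moreover have "c * sqrt (real n) * (real (n + r) + 1) ^ (2 * k) \<le> c * (sqrt y * y ^ (2 * k))"
      unfolding mult.assoc
    proof (intro mult_left_mono mult_mono power_mono)
      show "real (n + r) + 1 \<le> y" using assms by (simp add: y_def M_def)
    qed (use y c in \<open>auto simp: y_def\<close>)
    ultimately show ?thesis by (simp add: n_def)
  qed
  obtain j :: nat where j: "real j > (max 1 (B / c))\<^sup>2" using reals_Archimedean2 by blast
  have "(max 1 (B / c))\<^sup>2 \<le> real (2 * j)" using j by simp
  then have "max 1 (B / c) \<le> sqrt (real (2 * j))" by (rule real_le_rsqrt)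
  then have "B \<le> c * sqrt (real (2 * j))" using c by (simp add: divide_le_eq mult.commute)
  then have "B * (real (2 * j + r) + 1) ^ (2 * k) \<le> c * sqrt (real (2 * j)) * (real (2 * j + r) + 1) ^ (2 * k)"
    by (intro mult_right_mono) auto
  moreover have "j \<ge> 1"
  proof (rule ccontr)
    assume "\<not> j \<ge> 1"
    then have "j = 0" by simp
    then show False using j by (simp add: not_less)
  qed
  ultimately show ?thesis using main[of j] unfolding e_def by (meson order.trans)
qed

lemma fdiff_power: "fdiff r (\<lambda>i. i ^ r) = (-1) ^ r * fact r"
proof (induction r)
  case 0
  then show ?case by (simp add: fdiff_def)
next
  case (Suc r)
  define q where "q = monom 1 (Suc r) - pcompose (monom 1 (Suc r)) [:1, 1:] + smult (real (Suc r)) (monom 1 r)"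
  have q: "poly q x = x ^ Suc r - (x + 1) ^ Suc r + real (Suc r) * x ^ r" for x
    by (simp add: q_def poly_pcompose poly_monom add.commute)
  have binom: "(x + 1) ^ Suc r = (\<Sum>i\<le>Suc r. real (Suc r choose i) * x ^ i)" for x :: real
    by (subst binomial_ring) simp
  have "poly q x = poly (\<Sum>i<r. monom (- real (Suc r choose i)) i) x" for x
    unfolding q binom by (simp add: poly_sum poly_monom sum_negf lessThan_Suc_atMost[symmetric])
  then have "q = (\<Sum>i<r. monom (- real (Suc r choose i)) i)" by (simp flip: poly_eq_poly_eq_iff add: fun_eq_iff)
  then have "q = 0 \<or> degree q < r"
  proof (cases "r = 0")
    case False
    assume q': "q = (\<Sum>i<r. monom (- real (Suc r choose i)) i)"
    have "degree q \<le> r - 1" unfolding q'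
      by (intro degree_sum_le) (auto intro: order.trans[OF degree_monom_le])
    then show ?thesis using False by (cases r) auto
  qed simp
  then have "fdiff r (poly q) = 0" using fdiff_poly_eq_0[of q r] by (auto simp: fdiff_def)
  have "fdiff (Suc r) (\<lambda>i. i ^ Suc r) = fdiff r (\<lambda>i. poly q i + (- real (Suc r)) * i ^ r)"
    unfolding fdiff_Suc q by (simp add: algebra_simps)
  also have "\<dots> = (- real (Suc r)) * fdiff r (\<lambda>i. i ^ r)"
    unfolding fdiff_add fdiff_cmult using \<open>fdiff r (poly q) = 0\<close> by simp
  finally show ?case using Suc by (simp add: algebra_simps)
qed

text \<open>
  Lower powers are annihilated by the difference, and higher ones vanish in the limit.
\<close>

lemma fdiff_poly_limit:
  "((\<lambda>h. fdiff r (\<lambda>i. poly q (i * h)) / h ^ r) \<longlongrightarrow> coeff q r * ((-1) ^ r * fact r)) (at_right 0)"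
proof -
  define a where "a l = coeff q l * fdiff r (\<lambda>i. i ^ l)" for l
  have a0: "a l = 0" if "l < r" for l
  proof -
    have "fdiff r (poly (monom 1 l)) = 0" using that by (intro fdiff_poly_eq_0) (simp add: degree_monom_eq)
    moreover have "poly (monom 1 l) = (\<lambda>i :: real. i ^ l)" by (simp add: fun_eq_iff poly_monom)
    ultimately show ?thesis by (simp add: a_def)
  qed
  have ev: "fdiff r (\<lambda>i. poly q (i * h)) / h ^ r = (\<Sum>l\<le>degree q. a l * h ^ (l - r))" if "h > 0" for h
  proof -
    have "fdiff r (\<lambda>i. poly q (i * h)) = (\<Sum>l\<le>degree q. fdiff r (\<lambda>i. (coeff q l * h ^ l) * i ^ l))"
      unfolding fdiff_sum[symmetric] poly_altdef by (simp add: power_mult_distrib mult_ac)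
    also have "\<dots> = (\<Sum>l\<le>degree q. a l * h ^ l)" unfolding fdiff_cmult a_def by (simp add: mult_ac)
    also have "\<dots> / h ^ r = (\<Sum>l\<le>degree q. a l * h ^ (l - r))"
      unfolding sum_divide_distrib
    proof (intro sum.cong refl)
      fix l show "a l * h ^ l / h ^ r = a l * h ^ (l - r)"
        using a0[of l] that by (cases "l < r") (auto simp: power_diff)
    qed
    finally show ?thesis .
  qed
  have "((\<lambda>h. \<Sum>l\<le>degree q. a l * h ^ (l - r)) \<longlongrightarrow> (\<Sum>l\<le>degree q. a l * 0 ^ (l - r))) (at_right 0)"
    by (intro tendsto_intros)
  also have "(\<Sum>l\<le>degree q. a l * 0 ^ (l - r)) = (\<Sum>l\<le>degree q. if l = r then a r else 0)"
    using a0 by (intro sum.cong refl) (auto simp: power_0_left not_le)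
  also have "\<dots> = coeff q r * ((-1) ^ r * fact r)"
    by (simp add: a_def fdiff_power coeff_eq_0)
  finally show ?thesis
    by (rule Lim_transform_eventually) (auto simp: ev eventually_at_right_field intro: exI[of _ 1])
qed

text \<open>
  The functionals \<open>\<phi> n h\<close> are uniformly bounded but, divided by \<open>h\<^sup>r\<close>, have
  limits \<open>L n\<close> which are not controlled by \<open>w n\<close>. The terms of the series are chosen
  one after the other. A new term is so small that it does not disturb the difference quotients at the steps
  chosen before, even together with all later terms; its index is such that its limit dominates that of the
  earlier terms; and a new step is then chosen at which this is visible.
\<close>

lemma gliding_hump:
  fixes \<phi> :: "nat \<Rightarrow> real \<Rightarrow> real" and L w :: "nat \<Rightarrow> real"
  assumes bound: "\<And>n h. 0 < h \<Longrightarrow> h < \<eta> \<Longrightarrow> \<bar>\<phi> n h\<bar> \<le> K" and "\<eta> > 0" "K > 0"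
    and lim: "\<And>n. ((\<lambda>h. \<phi> n h / h ^ r) \<longlongrightarrow> L n) (at_right 0)"
    and w: "\<And>n. w n \<ge> 1" and unbounded: "\<And>B. \<exists>n. \<bar>L n\<bar> \<ge> B * w n"
  shows "\<exists>N \<beta>. (\<forall>j. \<beta> j > 0) \<and> summable (\<lambda>j. \<beta> j * w (N j)) \<and>
    (\<forall>B \<delta>. \<delta> > 0 \<longrightarrow> (\<exists>h. 0 < h \<and> h < \<delta> \<and> B * h ^ r < \<bar>\<Sum>j. \<beta> j * \<phi> (N j) h\<bar>))"
proof -
  \<comment> \<open>A state consists of the last index, its weight, the last step, and the functional of the partial sum. The
    initial state carries no term, so the sequences below start with its successor.\<close>
  define P where "P = (\<lambda>(_ :: nat) (N :: nat, b :: real, h :: real, F :: real \<Rightarrow> real).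
    0 < h \<and> h < \<eta> \<and> (\<exists>l. ((\<lambda>h. F h / h ^ r) \<longlongrightarrow> l) (at_right 0)))"
  define Q where "Q = (\<lambda>n (N :: nat, b :: real, h :: real, F :: real \<Rightarrow> real) (N', b', h', F').
     F' = (\<lambda>t. F t + b' * \<phi> N' t) \<and> h' < h / 2 \<and> b' > 0 \<and> b' * w N' \<le> (1 / 2) ^ n \<and>
     b' * K \<le> (1 / 2) ^ n * h ^ r \<and> real n * h' ^ r \<le> \<bar>F' h'\<bar>)"
  have "\<exists>f. \<forall>n. P n (f n) \<and> Q n (f n) (f (Suc n))"
  proof (rule dependent_nat_choice)
    show "\<exists>x. P 0 x"
      using \<open>\<eta> > 0\<close> by (intro exI[of _ "(0, 0, \<eta> / 2, \<lambda>_. 0)"]) (auto simp: P_def)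
    fix x n assume "P n x"
    obtain N b h F where x: "x = (N, b, h, F)" by (cases x)
    obtain l where h: "0 < h" "h < \<eta>" and l: "((\<lambda>h. F h / h ^ r) \<longlongrightarrow> l) (at_right 0)"
      using \<open>P n x\<close> unfolding P_def x by auto
    \<comment> \<open>The first factor makes the series summable; the second, relative to the old step, keeps the term
      invisible there.\<close>
    define \<epsilon> where "\<epsilon> = (1 / 2) ^ n * min 1 (h ^ r / K)"
    have \<epsilon>: "\<epsilon> > 0" using h \<open>K > 0\<close> by (simp add: \<epsilon>_def)
    obtain N' where N': "\<bar>L N'\<bar> \<ge> (real n + 1 + \<bar>l\<bar>) / \<epsilon> * w N'" using unbounded by blast
    have w0: "w N' > 0" using w[of N'] by linarith
    define b' where "b' = \<epsilon> / w N'"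
    have b': "b' > 0" using \<epsilon> w0 by (simp add: b'_def)
    define F' where "F' = (\<lambda>t. F t + b' * \<phi> N' t)"
    have l': "((\<lambda>h. F' h / h ^ r) \<longlongrightarrow> l + b' * L N') (at_right 0)"
      unfolding F'_def add_divide_distrib times_divide_eq_right[symmetric] by (intro tendsto_intros l lim)
    have "b' * ((real n + 1 + \<bar>l\<bar>) / \<epsilon> * w N') \<le> b' * \<bar>L N'\<bar>" using N' b' by (intro mult_left_mono) auto
    moreover have "b' * ((real n + 1 + \<bar>l\<bar>) / \<epsilon> * w N') = real n + 1 + \<bar>l\<bar>" using \<epsilon> w0 by (simp add: b'_def)
    moreover have "b' * \<bar>L N'\<bar> = \<bar>b' * L N'\<bar>" using b' by (simp add: abs_mult)
    ultimately have "real n < \<bar>l + b' * L N'\<bar>" by linarith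
    then have "\<forall>\<^sub>F h in at_right 0. real n < \<bar>F' h / h ^ r\<bar>"
      using order_tendstoD(1)[OF tendsto_rabs[OF l']] by blast
    then obtain h1 where h1: "h1 > 0" "\<And>t. 0 < t \<Longrightarrow> t < h1 \<Longrightarrow> real n < \<bar>F' t / t ^ r\<bar>"
      unfolding eventually_at_right_field by auto
    define h' where "h' = min h1 (h / 2) / 2"
    have h': "0 < h'" "h' < h1" "h' < h / 2" using h h1 by (auto simp: h'_def)
    have "real n * h' ^ r \<le> \<bar>F' h'\<bar>" using h1(2)[OF h'(1,2)] h'(1) by (simp add: abs_divide less_divide_eq)
    moreover have "b' * w N' \<le> (1 / 2) ^ n" using w0 by (simp add: b'_def \<epsilon>_def)
    moreover have "b' * K \<le> (1 / 2) ^ n * h ^ r"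
    proof -
      have "b' \<le> \<epsilon>" using \<epsilon> w[of N'] by (simp add: b'_def divide_le_eq)
      also have "\<epsilon> \<le> (1 / 2) ^ n * (h ^ r / K)" unfolding \<epsilon>_def by (intro mult_left_mono) auto
      finally show ?thesis using \<open>K > 0\<close> by (simp add: le_divide_eq)
    qed
    ultimately show "\<exists>y. P (Suc n) y \<and> Q n x y"
      using h h' l' b' by (intro exI[of _ "(N', b', h', F')"]) (auto simp: P_def Q_def x F'_def)
  qed
  then obtain f where f: "\<And>n. P n (f n)" "\<And>n. Q n (f n) (f (Suc n))" by blast
  define hh where "hh n = fst (snd (snd (f n)))" for n
  define FF where "FF n = snd (snd (snd (f n)))" for n
  define N where "N n = fst (f (Suc n))" for n
  define \<beta> where "\<beta> n = fst (snd (f (Suc n)))" for n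
  have hh: "0 < hh n" "hh n < \<eta>" for n
    using f(1)[of n] by (auto simp: P_def hh_def split_beta)
  have step: "FF (Suc n) = (\<lambda>t. FF n t + \<beta> n * \<phi> (N n) t)" "hh (Suc n) < hh n / 2" "\<beta> n > 0"
    "\<beta> n * w (N n) \<le> (1 / 2) ^ n" "\<beta> n * K \<le> (1 / 2) ^ n * hh n ^ r"
    "real n * hh (Suc n) ^ r \<le> \<bar>FF (Suc n) (hh (Suc n))\<bar>" for n
    using f(2)[of n] unfolding Q_def hh_def FF_def N_def \<beta>_def split_beta by auto
  have FF: "FF n t = FF 0 t + (\<Sum>j<n. \<beta> j * \<phi> (N j) t)" for n t by (induction n) (auto simp: step(1))
  have decr: "hh (n + i) \<le> hh n" for n i
  proof (induction i)
    case (Suc i)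
    then show ?case using step(2)[of "n + i"] hh(1)[of "n + i"] by simp
  qed simp
  have small: "hh n \<le> \<eta> * (1 / 2) ^ n" for n
  proof (induction n)
    case 0
    then show ?case using hh(2)[of 0] by simp
  next
    case (Suc n)
    then show ?case using step(2)[of n] by simp
  qed
  have geo: "summable (\<lambda>n. (1 / 2) ^ n :: real)" by (rule summable_geometric) simp
  have sum\<beta>: "summable \<beta>"
  proof (rule summable_comparison_test'[OF geo, where N = 0])
    fix n
    have "\<beta> n * 1 \<le> \<beta> n * w (N n)" using step(3)[of n] w by (intro mult_left_mono) auto
    then have "\<beta> n \<le> (1 / 2) ^ n" using step(4)[of n] by linarith
    then show "norm (\<beta> n) \<le> (1 / 2) ^ n" using step(3)[of n] by simp
  qed
  have sumw: "summable (\<lambda>j. \<beta> j * w (N j))"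
  proof (rule summable_comparison_test'[OF geo, where N = 0])
    fix n
    have "0 \<le> \<beta> n * w (N n)" using step(3)[of n] w[of "N n"] by (intro mult_nonneg_nonneg) linarith+
    then show "norm (\<beta> n * w (N n)) \<le> (1 / 2) ^ n" using step(4)[of n] by simp
  qed
  \<comment> \<open>At the step chosen together with a term, the later terms contribute at most \<open>h\<^sup>r\<close> in
    total.\<close>
  have key: "real n * hh (Suc n) ^ r - \<bar>FF 0 (hh (Suc n))\<bar> - hh (Suc n) ^ r \<le> \<bar>\<Sum>j. \<beta> j * \<phi> (N j) (hh (Suc n))\<bar>" for n
  proof -
    let ?h = "hh (Suc n)"
    have b: "norm (\<beta> j * \<phi> (N j) ?h) \<le> \<beta> j * K" for j
      using bound[OF hh] step(3)[of j] by (simp add: abs_mult mult_left_mono)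
    have s: "summable (\<lambda>j. \<beta> j * \<phi> (N j) ?h)"
      by (rule summable_comparison_test'[OF summable_mult2[OF sum\<beta>] b])
    have tail: "\<bar>\<Sum>i. \<beta> (i + Suc n) * \<phi> (N (i + Suc n)) ?h\<bar> \<le> ?h ^ r"
    proof -
      have b2: "norm (\<beta> (i + Suc n) * \<phi> (N (i + Suc n)) ?h) \<le> ?h ^ r / 2 * (1 / 2) ^ i" for i
      proof -
        have "norm (\<beta> (i + Suc n) * \<phi> (N (i + Suc n)) ?h) \<le> (1 / 2) ^ (i + Suc n) * hh (i + Suc n) ^ r"
          using b[of "i + Suc n"] step(5)[of "i + Suc n"] by linarith
        also have "\<dots> \<le> (1 / 2) ^ Suc i * ?h ^ r"
        proof (intro mult_mono power_mono)
          show "(1 / 2) ^ (i + Suc n) \<le> (1 / 2 :: real) ^ Suc i" by (intro power_decreasing) auto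
          show "hh (i + Suc n) \<le> ?h" using decr[of "Suc n" i] by (simp add: add.commute)
        qed (use hh in \<open>auto simp: less_imp_le\<close>)
        finally show ?thesis by (simp add: mult_ac)
      qed
      have "norm (\<Sum>i. \<beta> (i + Suc n) * \<phi> (N (i + Suc n)) ?h) \<le> (\<Sum>i. ?h ^ r / 2 * (1 / 2) ^ i)"
        by (rule norm_suminf_le[OF b2 summable_mult[OF geo]])
      also have "\<dots> = ?h ^ r"
      proof -
        have "(\<lambda>i. ?h ^ r / 2 * (1 / 2) ^ i) sums (?h ^ r / 2 * (1 / (1 - 1 / 2)))"
          by (intro sums_mult geometric_sums) simp
        then show ?thesis by (simp add: sums_iff)
      qed
      finally show ?thesis by simp
    qed
    have "(\<Sum>j. \<beta> j * \<phi> (N j) ?h) = (\<Sum>i. \<beta> (i + Suc n) * \<phi> (N (i + Suc n)) ?h) + (\<Sum>j<Suc n. \<beta> j * \<phi> (N j) ?h)"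
      by (rule suminf_split_initial_segment[OF s])
    then show ?thesis using tail step(6)[of n] FF[of "Suc n" ?h] by linarith
  qed
  obtain l where l: "((\<lambda>h. FF 0 h / h ^ r) \<longlongrightarrow> l) (at_right 0)"
    using f(1)[of 0] unfolding P_def FF_def by (auto simp: split_beta)
  have "\<forall>\<^sub>F h in at_right 0. \<bar>FF 0 h / h ^ r\<bar> < \<bar>l\<bar> + 1"
    using order_tendstoD(2)[OF tendsto_rabs[OF l]] by simp
  then obtain \<delta>0 where \<delta>0: "\<delta>0 > 0" "\<And>h. 0 < h \<Longrightarrow> h < \<delta>0 \<Longrightarrow> \<bar>FF 0 h / h ^ r\<bar> < \<bar>l\<bar> + 1"
    unfolding eventually_at_right_field by auto
  have "\<exists>h. 0 < h \<and> h < \<delta> \<and> B * h ^ r < \<bar>\<Sum>j. \<beta> j * \<phi> (N j) h\<bar>" if "\<delta> > 0" for B \<delta>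
  proof -
    have "(\<lambda>n. \<eta> * (1 / 2) ^ n) \<longlonglongrightarrow> \<eta> * 0" by (intro tendsto_intros LIMSEQ_power_zero) simp
    then have "\<forall>\<^sub>F n in sequentially. \<eta> * (1 / 2) ^ n < min \<delta> \<delta>0"
      using that \<delta>0(1) by (intro order_tendstoD(2)) auto
    then obtain n0 where n0: "\<And>n. n \<ge> n0 \<Longrightarrow> \<eta> * (1 / 2) ^ n < min \<delta> \<delta>0"
      unfolding eventually_sequentially by blast
    obtain n1 :: nat where n1: "real n1 > B + 2 + \<bar>l\<bar>" using reals_Archimedean2 by blast
    define n where "n = max n0 n1"
    let ?h = "hh (Suc n)"
    have "n0 \<le> Suc n" by (simp add: n_def)
    then have h: "0 < ?h" "?h < min \<delta> \<delta>0"
      using hh(1) le_less_trans[OF small n0] by auto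
    have pos: "?h ^ r > 0" using h by simp
    have "\<bar>FF 0 ?h\<bar> < (\<bar>l\<bar> + 1) * ?h ^ r" using \<delta>0(2)[of ?h] h pos by (simp add: abs_divide divide_less_eq)
    moreover have "(B + 2 + \<bar>l\<bar>) * ?h ^ r \<le> real n * ?h ^ r"
      using n1 pos by (intro mult_right_mono) (auto simp: n_def)
    ultimately have "B * ?h ^ r < \<bar>\<Sum>j. \<beta> j * \<phi> (N j) ?h\<bar>" using key[of n] by (simp add: algebra_simps)
    then show ?thesis using h by auto
  qed
  then show ?thesis using step(3) sumw by blast
qed

section \<open>The extremal functions\<close>

text \<open>
  The powers of \<open>(1 + t) / 2\<close> serve as positive definite approximations of the indicator of
  \<open>t = 1\<close>.
\<close>

lemma cap_power_features:
  "has_features (topspace (nsphere d)) (\<lambda>x y. ((1 + dotp d x y) / 2) ^ n)"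
proof (induction n)
  case 0
  show ?case unfolding has_features_def by (intro exI[of _ "[\<lambda>_. 1]"]) simp
next
  case (Suc n)
  let ?S = "topspace (nsphere d)" and ?K = "\<lambda>x y. ((1 + dotp d x y) / 2) ^ n"
  define a :: real where "a = sqrt (1 / 2)"
  have a: "a * a = 1 / 2" unfolding a_def by simp
  have eq: "((1 + dotp d x y) / 2) ^ Suc n = a * a * ?K x y + (\<Sum>i\<le>d. (a * x i) * (a * y i) * ?K x y)" for x y
  proof -
    have "(\<Sum>i\<le>d. (a * x i) * (a * y i) * ?K x y) = (\<Sum>i\<le>d. (a * a * ?K x y) * (x i * y i))"
      by (intro sum.cong refl) (simp only: mult_ac)
    also have "\<dots> = (a * a * ?K x y) * dotp d x y" by (simp only: sum_distrib_left)
    finally show ?thesis unfolding a by (simp only:) (simp add: field_simps)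
  qed
  show ?case unfolding eq
    by (intro has_features_add has_features_sum finite_atMost
        has_features_pullback[OF Suc, where v = "\<lambda>x. x" and g = "\<lambda>_. a"]
        has_features_pullback[OF Suc, where v = "\<lambda>x. x"]) auto
qed

lemma dotp_less_1:
  assumes "x \<in> topspace (nsphere d)" "y \<in> topspace (nsphere d)" "x \<noteq> y"
  shows "dotp d x y < 1"
proof -
  obtain i where i: "x i \<noteq> y i" using assms(3) by auto
  have "i \<le> d" using i assms(1,2) by (force simp: nsphere_iff not_le[symmetric])
  then have "0 < (\<Sum>i\<le>d. (x i - y i)\<^sup>2)" using i by (intro sum_pos2[of _ i]) auto
  also have "\<dots> = dotp d x x + dotp d y y - 2 * dotp d x y"
    by (simp add: power2_eq_square algebra_simps sum.distrib sum_subtractf sum_distrib_left)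
  finally show ?thesis using assms by (simp add: nsphere_iff)
qed

lemma bounded_diff_cmult:
  assumes "bounded_diff r c f x"
  shows "bounded_diff r c (\<lambda>y. a * f y) x"
proof -
  obtain B \<delta> where B: "\<delta> > 0" "\<And>h. 0 < h \<Longrightarrow> h < \<delta> \<Longrightarrow> \<bar>fdiff r (\<lambda>i. f (x + (i - c) * h))\<bar> \<le> B * h ^ r"
    using assms unfolding bounded_diff_def by blast
  have "\<bar>fdiff r (\<lambda>i. a * f (x + (i - c) * h))\<bar> \<le> (\<bar>a\<bar> * B) * h ^ r" if "0 < h" "h < \<delta>" for h
    unfolding fdiff_cmult abs_mult mult.assoc by (intro mult_left_mono B that) simp
  then show ?thesis unfolding bounded_diff_def using B(1) by blast
qed

lemma exp_kernel_sums:
  fixes t :: "'i \<Rightarrow> 'i \<Rightarrow> real"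
  shows "(\<lambda>n. exp (- 1) / fact n * (\<Sum>i\<in>I. \<Sum>j\<in>I. c i * c j * ((1 + t i j) / 2) ^ n)) sums
     (\<Sum>i\<in>I. \<Sum>j\<in>I. c i * c j * exp ((t i j - 1) / 2))"
proof -
  have "(\<lambda>n. \<Sum>i\<in>I. \<Sum>j\<in>I. c i * c j * (exp (- 1) * (((1 + t i j) / 2) ^ n /\<^sub>R fact n))) sums
     (\<Sum>i\<in>I. \<Sum>j\<in>I. c i * c j * (exp (- 1) * exp ((1 + t i j) / 2)))"
    by (intro sums_sum sums_mult exp_converges)
  moreover have "exp (- 1) * exp ((1 + t i j) / 2) = exp ((t i j - 1) / 2)" for i j
    unfolding exp_add[symmetric] by (simp add: field_simps)
  moreover have "(\<Sum>i\<in>I. \<Sum>j\<in>I. c i * c j * (exp (- 1) * (((1 + t i j) / 2) ^ n /\<^sub>R fact n))) =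
      exp (- 1) / fact n * (\<Sum>i\<in>I. \<Sum>j\<in>I. c i * c j * ((1 + t i j) / 2) ^ n)" for n
    unfolding sum_distrib_left by (intro sum.cong refl) (simp only: real_scaleR_def divide_inverse mult_ac)
  ultimately show ?thesis by simp
qed

lemma exp_kernel_nonneg:
  assumes x: "\<And>i. i \<in> I \<Longrightarrow> x i \<in> topspace (nsphere d)"
  shows "(\<Sum>i\<in>I. \<Sum>j\<in>I. c i * c j * exp ((dotp d (x i) (x j) - 1) / 2)) \<ge> (0 :: real)"
proof -
  note sums = exp_kernel_sums[of c "\<lambda>i j. dotp d (x i) (x j)" I]
  have "0 \<le> (\<Sum>n. exp (- 1) / fact n * (\<Sum>i\<in>I. \<Sum>j\<in>I. c i * c j * ((1 + dotp d (x i) (x j)) / 2) ^ n))"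
    by (intro suminf_nonneg[OF sums_summable[OF sums]] mult_nonneg_nonneg
        features_positive_definite[OF cap_power_features] x) auto
  then show ?thesis using sums_unique[OF sums] by simp
qed

text \<open>
  Up to a factor, the kernel is the exponential series in \<open>(1 + t) / 2\<close>. For large \<open>n\<close>
  the entrywise power \<open>n\<close> of this quantity is close to the identity matrix on distinct points, so
  some term of the series is positive.
\<close>

lemma exp_kernel_strictly_positive:
  assumes "finite I" and x: "\<And>i. i \<in> I \<Longrightarrow> x i \<in> topspace (nsphere d)" and inj: "inj_on x I"
    and c: "\<exists>i\<in>I. c i \<noteq> 0"
  shows "(\<Sum>i\<in>I. \<Sum>j\<in>I. c i * c j * exp ((dotp d (x i) (x j) - 1) / 2)) > (0 :: real)"
proof -
  define t where "t i j = (1 + dotp d (x i) (x j)) / 2" for i j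
  define Q where "Q n = (\<Sum>i\<in>I. \<Sum>j\<in>I. c i * c j * t i j ^ n)" for n
  have Q0: "Q n \<ge> 0" for n
    unfolding Q_def t_def by (intro features_positive_definite[OF cap_power_features] x)
  have tlim: "(\<lambda>n. t i j ^ n) \<longlonglongrightarrow> (if i = j then 1 else 0)" if "i \<in> I" "j \<in> I" for i j
  proof (cases "i = j")
    case True
    then have "t i j = 1" using x[OF that(1)] by (simp add: t_def nsphere_iff)
    then show ?thesis using True by simp
  next
    case False
    then have "x i \<noteq> x j" using inj that by (auto simp: inj_on_def)
    then have "dotp d (x i) (x j) < 1" by (intro dotp_less_1 x that)
    moreover have "\<bar>dotp d (x i) (x j)\<bar> \<le> 1" by (intro dotp_bound x that)
    ultimately have "norm (t i j) < 1" by (simp add: t_def abs_le_iff)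
    then show ?thesis using False by (simp add: LIMSEQ_power_zero)
  qed
  have "Q \<longlonglongrightarrow> (\<Sum>i\<in>I. \<Sum>j\<in>I. c i * c j * (if i = j then 1 else 0))"
    unfolding Q_def by (intro tendsto_intros tlim)
  also have "(\<Sum>i\<in>I. \<Sum>j\<in>I. c i * c j * (if i = j then 1 else 0)) = (\<Sum>i\<in>I. c i * c i)"
    using \<open>finite I\<close> by (intro sum.cong refl) (simp add: if_distrib cong: if_cong)
  finally have lim: "Q \<longlonglongrightarrow> (\<Sum>i\<in>I. c i * c i)" .
  have "(\<Sum>i\<in>I. c i * c i) > 0"
  proof -
    obtain i where "i \<in> I" "c i \<noteq> 0" using c by blast
    then show ?thesis using \<open>finite I\<close> by (intro sum_pos2[of _ i]) (auto simp: zero_less_mult_iff)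
  qed
  then have ev: "\<forall>\<^sub>F n in sequentially. Q n > 0" by (rule order_tendstoD(1)[OF lim])
  obtain n where n: "Q n > 0" using eventually_happens'[OF sequentially_bot ev] by blast
  have sums: "(\<lambda>n. exp (- 1) / fact n * Q n) sums
     (\<Sum>i\<in>I. \<Sum>j\<in>I. c i * c j * exp ((dotp d (x i) (x j) - 1) / 2))"
    unfolding Q_def t_def by (rule exp_kernel_sums)
  then have "0 < (\<Sum>n. exp (- 1) / fact n * Q n)"
    using Q0 n by (intro suminf_pos2[of _ n]) (auto simp: sums_iff)
  then show ?thesis using sums by (simp add: sums_iff)
qed

text \<open>
  By the cosine expansion, the derivative of order \<open>i\<close> of \<open>P\<^sub>n (cos x)\<close> is
  bounded by \<open>n\<^sup>i\<close> on the whole line, poles included.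
\<close>

lemma Geg_series_cos_Ck_on:
  assumes \<beta>: "\<And>j. \<beta> j > 0" "summable (\<lambda>j. \<beta> j * (real (N j) + 1) ^ r)"
  shows "Ck_on r (\<lambda>x. \<Sum>j. \<beta> j * zonal e (N j) x) UNIV"
proof -
  obtain \<alpha> where \<alpha>: "\<And>n l. \<alpha> n l \<ge> 0" "\<And>n u. poly (Geg e n) u = (\<Sum>l\<le>n. \<alpha> n l * poly (Geg 0 l) u)"
    using Geg_cos_expansion[of e] by metis
  have \<alpha>1: "(\<Sum>l\<le>n. \<alpha> n l) = 1" for n using \<alpha>(2)[of n 1] by simp
  define V where "V i j l x = \<beta> j * \<alpha> (N j) l * real l ^ i * cos (real l * x + real i * (pi / 2))" for i j l x
  define U where "U i j x = (\<Sum>l\<le>N j. V i j l x)" for i j x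
  have "Ck_on r (\<lambda>x. \<Sum>j. U 0 j x) UNIV"
  proof (rule Ck_on_suminf[where M = "\<lambda>_ j. \<beta> j * (real (N j) + 1) ^ r"])
    show "(U i j has_real_derivative U (Suc i) j x) (at x)" for i j x
      unfolding U_def V_def by (intro DERIV_sum DERIV_cos_shift)
    show "\<bar>U i j x\<bar> \<le> \<beta> j * (real (N j) + 1) ^ r" if "i \<le> r" for i j x
    proof -
      have "\<bar>U i j x\<bar> \<le> (\<Sum>l\<le>N j. \<bar>V i j l x\<bar>)" unfolding U_def by (rule sum_abs)
      also have "\<dots> \<le> (\<Sum>l\<le>N j. \<alpha> (N j) l * (\<beta> j * (real (N j) + 1) ^ r))"
      proof (intro sum_mono)
        fix l assume l: "l \<in> {..N j}"
        have "real l ^ i \<le> (real (N j) + 1) ^ i" using l by (intro power_mono) auto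
        also have "\<dots> \<le> (real (N j) + 1) ^ r" using that by (intro power_increasing) auto
        finally have p: "real l ^ i * \<bar>cos (real l * x + real i * (pi / 2))\<bar> \<le> (real (N j) + 1) ^ r * 1"
          by (intro mult_mono) auto
        have "\<bar>V i j l x\<bar> = \<alpha> (N j) l * \<beta> j * (real l ^ i * \<bar>cos (real l * x + real i * (pi / 2))\<bar>)"
          using \<alpha>(1)[of "N j" l] \<beta>(1)[of j] by (simp add: V_def abs_mult)
        also have "\<dots> \<le> \<alpha> (N j) l * \<beta> j * ((real (N j) + 1) ^ r * 1)"
          using \<alpha>(1)[of "N j" l] \<beta>(1)[of j] by (intro mult_left_mono p) auto
        finally show "\<bar>V i j l x\<bar> \<le> \<alpha> (N j) l * (\<beta> j * (real (N j) + 1) ^ r)" by simp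
      qed
      also have "\<dots> = \<beta> j * (real (N j) + 1) ^ r" using \<alpha>1[of "N j"] by (simp flip: sum_distrib_right)
      finally show ?thesis .
    qed
  qed (use \<beta> in auto)
  moreover have "U 0 j x = \<beta> j * zonal e (N j) x" for j x
    unfolding U_def V_def \<alpha>(2) Geg_0_cos by (simp add: sum_distrib_left mult_ac)
  ultimately show ?thesis by simp
qed

text \<open>
  Since \<open>\<Psi>\<^bsub>2m\<^esub>\<close> is contained in \<open>\<Psi>\<^bsub>2m-1\<^esub>\<close>, the
  order for dimension \<open>2m - 1\<close> applies, which is the same.
\<close>

theorem even_sphere_regularity:
  assumes "m \<ge> 1" "\<psi> \<in> Psi (2 * m)" "times_differentiable_at (2 * k) (even_cont \<psi>) 0"
  shows "\<psi> \<in> C_diff_on (2 * k + m - 1) {0<..<pi}"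
proof -
  have "2 * m = Suc (2 * (m - 1) + 1)" using assms(1) by simp
  then have "\<psi> \<in> Psi (2 * (m - 1) + 1)" using Psi_antimono assms(2) by metis
  from odd_sphere_regularity[OF this assms(3)] show ?thesis using assms(1) by simp
qed

text \<open>
  The gliding hump is applied to the differences of \<open>P\<^sub>n\<close> at \<open>t = 0\<close>, with the
  cost \<open>(n + 1)\<^bsup>2k\<^esup>\<close> which keeps the series \<open>2k\<close> times differentiable at
  the pole.
\<close>

theorem singular_function_exists:
  assumes "m \<ge> 1"
  shows "\<exists>\<psi> \<in> Psi_plus (2 * m). times_differentiable_at (2 * k) (even_cont \<psi>) 0 \<and>
    \<not> nth_deriv_exists (2 * k + m) \<psi> (pi / 2)"
proof -
  define e where "e = 2 * m - 1"
  define r where "r = 2 * k + m"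
  have d: "2 * m = Suc e" using assms by (simp add: e_def)
  have r: "r \<ge> 1" using assms by (simp add: r_def)
  define \<phi> where "\<phi> n h = fdiff r (\<lambda>i. poly (Geg e n) (i * h))" for n h
  define w where "w n = (real n + 1) ^ (2 * k)" for n
  have "\<exists>N \<beta>. (\<forall>j. \<beta> j > 0) \<and> summable (\<lambda>j. \<beta> j * w (N j)) \<and>
    (\<forall>B \<delta>. \<delta> > 0 \<longrightarrow> (\<exists>h. 0 < h \<and> h < \<delta> \<and> B * h ^ r < \<bar>\<Sum>j. \<beta> j * \<phi> (N j) h\<bar>))"
  proof (rule gliding_hump[where \<eta> = "1 / real r" and K = "2 ^ r" and L = "\<lambda>n. coeff (Geg e n) r * ((-1) ^ r * fact r)"])
    show "\<bar>\<phi> n h\<bar> \<le> 2 ^ r" if h: "0 < h" "h < 1 / real r" for n h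
    proof -
      have "\<bar>poly (Geg e n) (real i * h)\<bar> \<le> 1" if "i \<le> r" for i
      proof -
        have "real i * h \<le> real r * h" using that h by (intro mult_right_mono) auto
        also have "\<dots> \<le> 1" using h r by (simp add: field_simps)
        finally have "cos (arccos (real i * h)) = real i * h" using h by (intro cos_arccos) (auto intro: order.trans[of _ 0])
        then show ?thesis using Geg_abs_le_1[of e n "arccos (real i * h)"] by simp
      qed
      from fdiff_abs_le[of r "\<lambda>i. poly (Geg e n) (i * h)" 1, OF this] show ?thesis by (simp add: \<phi>_def)
    qed
    show "((\<lambda>h. \<phi> n h / h ^ r) \<longlongrightarrow> coeff (Geg e n) r * ((-1) ^ r * fact r)) (at_right 0)" for n
      unfolding \<phi>_def by (rule fdiff_poly_limit)
    show "w n \<ge> 1" for n unfolding w_def by (rule one_le_power) simp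
    show "\<exists>n. \<bar>coeff (Geg e n) r * ((-1) ^ r * fact r)\<bar> \<ge> B * w n" for B
    proof -
      obtain n where n: "\<bar>coeff (Geg e n) r\<bar> \<ge> B * w n"
        using Geg_coeff_growth[OF assms r_def, of B] unfolding e_def w_def by blast
      have "\<bar>coeff (Geg e n) r\<bar> * 1 \<le> \<bar>coeff (Geg e n) r\<bar> * fact r" by (intro mult_left_mono) auto
      then have "B * w n \<le> \<bar>coeff (Geg e n) r * ((-1) ^ r * fact r)\<bar>" using n by (simp add: abs_mult power_abs)
      then show ?thesis by blast
    qed
  qed (use r in auto)
  then obtain N \<beta> where \<beta>: "\<And>j. \<beta> j > 0" and sumw: "summable (\<lambda>j. \<beta> j * w (N j))"
    and hump: "\<And>B \<delta>. \<delta> > 0 \<Longrightarrow> \<exists>h. 0 < h \<and> h < \<delta> \<and> B * h ^ r < \<bar>\<Sum>j. \<beta> j * \<phi> (N j) h\<bar>" by blast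
  have sum\<beta>: "summable \<beta>"
  proof (rule summable_comparison_test'[OF sumw, where N = 0])
    fix j
    have "\<beta> j * 1 \<le> \<beta> j * w (N j)" using \<beta>[of j] by (intro mult_left_mono) (auto simp: w_def intro: one_le_power)
    then show "norm (\<beta> j) \<le> \<beta> j * w (N j)" using \<beta>[of j] by simp
  qed
  have \<beta>0: "\<beta> j \<ge> 0" for j using \<beta>[of j] by simp
  note Geg_sum = Geg_series[where b = \<beta> and e = e and k = N, OF \<beta>0 sum\<beta>]
  define S where "S \<theta> = (\<Sum>j. \<beta> j * zonal e (N j) \<theta>)" for \<theta>
  define E where "E \<theta> = exp ((cos \<theta> - 1) / 2)" for \<theta> :: real
  define Z where "Z = 1 + (\<Sum>j. \<beta> j)"
  have Z: "Z > 0" unfolding Z_def by (intro add_pos_nonneg suminf_nonneg sum\<beta> \<beta>0) simp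
  define \<psi> where "\<psi> \<theta> = 1 / Z * (E \<theta> + S \<theta>)" for \<theta>
  have smooth: "Ck_on (2 * k) \<psi> UNIV"
    unfolding \<psi>_def E_def S_def
    by (intro Ck_on_mult Ck_on_const Ck_on_add Ck_on_exp_cos Geg_series_cos_Ck_on \<beta> sumw[unfolded w_def])
  have even: "even_cont \<psi> = \<psi>"
    by (simp add: fun_eq_iff even_cont_def \<psi>_def E_def S_def)
  have cont: "continuous_on A \<psi>" for A
    by (rule continuous_on_subset[OF Ck_on_continuous[OF smooth]]) simp
  have tdiff: "times_differentiable_at (2 * k) (even_cont \<psi>) 0"
  proof (cases "k = 0")
    case True
    then show ?thesis unfolding even times_differentiable_at_def using cont[of UNIV]
      by (simp add: continuous_on_eq_continuous_at)
  next
    case False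
    then show ?thesis unfolding even times_differentiable_at_def
      using Ck_on_imp_nth_deriv[OF open_UNIV smooth order.refl] by simp
  qed
  have form: "(\<Sum>i\<in>I. \<Sum>j\<in>I. c i * c j * \<psi> (geo_dist (Suc e) (x i) (x j))) =
      1 / Z * ((\<Sum>i\<in>I. \<Sum>j\<in>I. c i * c j * exp ((dotp (Suc e) (x i) (x j) - 1) / 2)) +
        (\<Sum>n. \<beta> n * (\<Sum>i\<in>I. \<Sum>j\<in>I. c i * c j * poly (Geg e (N n)) (dotp (Suc e) (x i) (x j)))))"
    and nonneg: "(\<Sum>n. \<beta> n * (\<Sum>i\<in>I. \<Sum>j\<in>I. c i * c j * poly (Geg e (N n)) (dotp (Suc e) (x i) (x j)))) \<ge> 0"
    if I: "finite I" and on_sphere: "\<forall>i\<in>I. x i \<in> topspace (nsphere (Suc e))"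
    for I :: "nat set" and x and c :: "nat \<Rightarrow> real"
  proof -
    note x = bspec[OF on_sphere]
    have cosg: "cos (geo_dist (Suc e) (x i) (x j)) = dotp (Suc e) (x i) (x j)" if "i \<in> I" "j \<in> I" for i j
      by (rule geo_dist_range(2)[OF x x]) (use that in auto)
    have s: "summable (\<lambda>n. \<beta> n * poly (Geg e (N n)) (dotp (Suc e) (x i) (x j)))" if "i \<in> I" "j \<in> I" for i j
      using Geg_sum(1)[of "geo_dist (Suc e) (x i) (x j)"] by (simp only: cosg[OF that])
    have sums: "(\<lambda>n. \<Sum>i\<in>I. \<Sum>j\<in>I. c i * c j * (\<beta> n * poly (Geg e (N n)) (dotp (Suc e) (x i) (x j)))) sums
       (\<Sum>i\<in>I. \<Sum>j\<in>I. c i * c j * (\<Sum>n. \<beta> n * poly (Geg e (N n)) (dotp (Suc e) (x i) (x j))))"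
      by (intro sums_sum sums_mult summable_sums s)
    have eq: "(\<Sum>i\<in>I. \<Sum>j\<in>I. c i * c j * (\<beta> n * poly (Geg e (N n)) (dotp (Suc e) (x i) (x j)))) =
       \<beta> n * (\<Sum>i\<in>I. \<Sum>j\<in>I. c i * c j * poly (Geg e (N n)) (dotp (Suc e) (x i) (x j)))" for n
      unfolding sum_distrib_left by (intro sum.cong refl) simp
    have S: "(\<Sum>i\<in>I. \<Sum>j\<in>I. c i * c j * S (geo_dist (Suc e) (x i) (x j))) =
       (\<Sum>n. \<beta> n * (\<Sum>i\<in>I. \<Sum>j\<in>I. c i * c j * poly (Geg e (N n)) (dotp (Suc e) (x i) (x j))))"
      using sums_unique[OF sums] unfolding eq S_def by (simp add: cosg)
    have "(\<Sum>i\<in>I. \<Sum>j\<in>I. c i * c j * \<psi> (geo_dist (Suc e) (x i) (x j))) =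
      1 / Z * ((\<Sum>i\<in>I. \<Sum>j\<in>I. c i * c j * E (geo_dist (Suc e) (x i) (x j))) +
        (\<Sum>i\<in>I. \<Sum>j\<in>I. c i * c j * S (geo_dist (Suc e) (x i) (x j))))"
      unfolding sum.distrib[symmetric] sum_distrib_left \<psi>_def by (intro sum.cong refl) (simp add: algebra_simps)
    then show "(\<Sum>i\<in>I. \<Sum>j\<in>I. c i * c j * \<psi> (geo_dist (Suc e) (x i) (x j))) =
      1 / Z * ((\<Sum>i\<in>I. \<Sum>j\<in>I. c i * c j * exp ((dotp (Suc e) (x i) (x j) - 1) / 2)) +
        (\<Sum>n. \<beta> n * (\<Sum>i\<in>I. \<Sum>j\<in>I. c i * c j * poly (Geg e (N n)) (dotp (Suc e) (x i) (x j)))))"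
      unfolding S E_def by (simp add: cosg)
    show "(\<Sum>n. \<beta> n * (\<Sum>i\<in>I. \<Sum>j\<in>I. c i * c j * poly (Geg e (N n)) (dotp (Suc e) (x i) (x j)))) \<ge> 0"
      using sums_summable[OF sums] unfolding eq
      by (intro suminf_nonneg mult_nonneg_nonneg \<beta>0 features_positive_definite[OF Geg_has_features] x)
  qed
  \<comment> \<open>The exponential kernel makes the form strictly positive; the sparse series contributes a nonnegative
    form.\<close>
  have strict: "(\<Sum>i\<in>I. \<Sum>j\<in>I. c i * c j * \<psi> (geo_dist (Suc e) (x i) (x j))) > 0"
    if I: "finite I" and x: "\<forall>i\<in>I. x i \<in> topspace (nsphere (Suc e))"
      and "inj_on x I" "\<exists>i\<in>I. c i \<noteq> 0"
    for I :: "nat set" and x and c :: "nat \<Rightarrow> real"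
  proof -
    have "(\<Sum>i\<in>I. \<Sum>j\<in>I. c i * c j * exp ((dotp (Suc e) (x i) (x j) - 1) / 2)) > 0"
      by (rule exp_kernel_strictly_positive) (use that in auto)
    then show ?thesis unfolding form[where x = x and c = c, OF I x]
      using nonneg[where x = x and c = c, OF I x] Z by (intro mult_pos_pos add_pos_nonneg) auto
  qed
  have weak: "(\<Sum>i\<in>I. \<Sum>j\<in>I. c i * c j * \<psi> (geo_dist (Suc e) (x i) (x j))) \<ge> 0"
    if I: "finite I" and x: "\<forall>i\<in>I. x i \<in> topspace (nsphere (Suc e))"
    for I :: "nat set" and x and c :: "nat \<Rightarrow> real"
  proof -
    have "(\<Sum>i\<in>I. \<Sum>j\<in>I. c i * c j * exp ((dotp (Suc e) (x i) (x j) - 1) / 2)) \<ge> 0"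
      by (rule exp_kernel_nonneg) (use x in blast)
    then show ?thesis unfolding form[where x = x and c = c, OF I x]
      using nonneg[where x = x and c = c, OF I x] Z by (intro mult_nonneg_nonneg add_nonneg_nonneg) auto
  qed
  have "S 0 = (\<Sum>j. \<beta> j)" by (simp add: S_def)
  then have "\<psi> 0 = 1" using Z by (simp add: \<psi>_def E_def Z_def)
  then have "\<psi> \<in> Psi (Suc e)" unfolding Psi_def using cont weak by simp
  then have "\<psi> \<in> Psi_plus (2 * m)" unfolding Psi_plus_def d using strict by simp
  moreover have "\<not> nth_deriv_exists (2 * k + m) \<psi> (pi / 2)"
  proof
    assume "nth_deriv_exists (2 * k + m) \<psi> (pi / 2)"
    then have 1: "bounded_diff r 0 (\<lambda>t. Z * \<psi> (arccos t)) 0"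
      using r unfolding r_def[symmetric] by (intro bounded_diff_cmult nth_deriv_bounded_diff_arccos)
    have "nth_deriv_exists r E (pi / 2)"
      using Ck_on_imp_nth_deriv[OF open_UNIV Ck_on_exp_cos order.refl, of r] by (simp add: E_def[abs_def])
    then have 2: "bounded_diff r 0 (\<lambda>t. - 1 * E (arccos t)) 0"
      using r by (intro bounded_diff_cmult nth_deriv_bounded_diff_arccos)
    have "bounded_diff r 0 (\<lambda>t. Z * \<psi> (arccos t) + - 1 * E (arccos t)) 0"
      by (rule bounded_diff_add[OF 1 2])
    then have "bounded_diff r 0 (\<lambda>t. S (arccos t)) 0" using Z by (simp add: \<psi>_def)
    then obtain B \<delta> where B: "\<delta> > 0" "\<And>h. 0 < h \<Longrightarrow> h < \<delta> \<Longrightarrow> \<bar>fdiff r (\<lambda>i. S (arccos (i * h)))\<bar> \<le> B * h ^ r"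
      unfolding bounded_diff_def by auto
    obtain h where h: "0 < h" "h < min \<delta> (1 / real r)" "B * h ^ r < \<bar>\<Sum>j. \<beta> j * \<phi> (N j) h\<bar>"
      using hump[of "min \<delta> (1 / real r)" B] B(1) r by auto
    have cosarc: "cos (arccos (real i * h)) = real i * h" if "i \<le> r" for i
    proof -
      have "real i * h \<le> real r * h" using that h by (intro mult_right_mono) auto
      also have "\<dots> \<le> 1" using h r by (simp add: field_simps)
      finally show ?thesis using h by (intro cos_arccos) (auto intro: order.trans[of _ 0])
    qed
    have "fdiff r (\<lambda>i. S (arccos (i * h))) = fdiff r (\<lambda>i. \<Sum>j. \<beta> j * zonal e (N j) (arccos (i * h)))"
      by (simp add: S_def)
    also have "\<dots> = (\<Sum>j. fdiff r (\<lambda>i. \<beta> j * zonal e (N j) (arccos (i * h))))"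
      by (rule fdiff_suminf(2)[OF Geg_sum(1)])
    also have "\<dots> = (\<Sum>j. \<beta> j * \<phi> (N j) h)"
    proof -
      have "fdiff r (\<lambda>i. zonal e (N j) (arccos (i * h))) = \<phi> (N j) h" for j
        unfolding \<phi>_def fdiff_def by (intro sum.cong refl) (simp add: cosarc)
      then show ?thesis by (simp only: fdiff_cmult)
    qed
    finally show False using B(2)[of h] h by simp
  qed
  ultimately show ?thesis using tdiff by blast
qed

theorem theorem1p2:
  fixes d m k :: nat
  assumes "m \<ge> 1" and "d = 2 * m"
  shows "(\<exists>\<psi> \<in> Psi_plus d.
            times_differentiable_at (2 * k) (even_cont \<psi>) 0 \<and>
            \<psi> \<in> C_diff_on (2 * k + m - 1) {0<..<pi} \<and>
            \<not> nth_deriv_exists (2 * k + m) \<psi> (pi / 2) \<and>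
            \<not> times_differentiable_at (2 * k + 2) (even_cont \<psi>) 0 \<and>
            \<psi> \<notin> Psi (d + 1))
       \<and> int (2 * k + m - 1) = 2 * int k + \<lfloor>(real d - 1) / 2\<rfloor>
       \<and> (\<forall>\<psi> \<in> Psi d. times_differentiable_at (2 * k) (even_cont \<psi>) 0 \<longrightarrow>
            \<psi> \<in> C_diff_on (2 * k + m - 1) {0<..<pi})
       \<and> (\<forall>r :: nat. (\<forall>\<psi> \<in> Psi d. times_differentiable_at (2 * k) (even_cont \<psi>) 0 \<longrightarrow>
            \<psi> \<in> C_diff_on r {0<..<pi}) \<longrightarrow> r \<le> 2 * k + m - 1)"
proof -
  have regular: "\<psi> \<in> C_diff_on (2 * k + m - 1) {0<..<pi}"
    if "\<psi> \<in> Psi d" "times_differentiable_at (2 * k) (even_cont \<psi>) 0" for \<psi> k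
    using even_sphere_regularity[OF assms(1)] that assms(2) by simp
  have at_pi_half: "nth_deriv_exists (2 * k + m) \<psi> (pi / 2)"
    if "\<psi> \<in> C_diff_on r {0<..<pi}" "2 * k + m \<le> r" for \<psi> r
  proof -
    have "pi / 2 \<in> {0<..<pi}" by simp
    then show ?thesis using that unfolding C_diff_on_def by blast
  qed
  obtain \<psi> where \<psi>: "\<psi> \<in> Psi_plus d" "times_differentiable_at (2 * k) (even_cont \<psi>) 0"
    "\<not> nth_deriv_exists (2 * k + m) \<psi> (pi / 2)"
    using singular_function_exists[OF assms(1)] assms(2) by blast
  have Psi: "\<psi> \<in> Psi d" using \<psi>(1) by (simp add: Psi_plus_def)
  have "\<not> times_differentiable_at (2 * k + 2) (even_cont \<psi>) 0"
  proof
    assume "times_differentiable_at (2 * k + 2) (even_cont \<psi>) 0"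
    then have "\<psi> \<in> C_diff_on (2 * (k + 1) + m - 1) {0<..<pi}" using regular[OF Psi, of "k + 1"] by simp
    then show False using at_pi_half \<psi>(3) by simp
  qed
  moreover have "\<psi> \<notin> Psi (d + 1)"
  proof
    assume "\<psi> \<in> Psi (d + 1)"
    then have "\<psi> \<in> Psi (2 * m + 1)" by (simp add: assms(2))
    from odd_sphere_regularity[OF this \<psi>(2)] show False using at_pi_half \<psi>(3) by simp
  qed
  moreover have "int (2 * k + m - 1) = 2 * int k + \<lfloor>(real d - 1) / 2\<rfloor>"
  proof -
    have "(real d - 1) / 2 = real_of_int (int m - 1) + 1 / 2" by (simp add: assms(2) field_simps)
    then have "\<lfloor>(real d - 1) / 2\<rfloor> = int m - 1" by linarith
    then show ?thesis using assms(1) by simp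
  qed
  moreover have "r \<le> 2 * k + m - 1"
    if "\<forall>\<psi> \<in> Psi d. times_differentiable_at (2 * k) (even_cont \<psi>) 0 \<longrightarrow> \<psi> \<in> C_diff_on r {0<..<pi}" for r
  proof (rule ccontr)
    assume "\<not> r \<le> 2 * k + m - 1"
    then have "2 * k + m \<le> r" by arith
    then show False using that at_pi_half[of \<psi> r] Psi \<psi>(2,3) by simp
  qed
  ultimately show ?thesis using \<psi> Psi regular by blast
qed

end
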